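(* (Phase transition in exit lane capacity.) Consider the toy network described in the context, with congested initial data: for a constant $\rho_{\mathrm{init}}\le 1$ with $\rho_{\mathrm{init}}>\sigma_i$ for $i\in\{1,2,3,4\}$, $\rho_i(0,x)\equiv\rho_{\mathrm{init}}$ for $i\in\{1,2,3,4\}$, and $\rho_5(0,x)\equiv 0$. Then the critical exit lane threshold is $$n_5^\star:=\frac{f_{c,2}+f_{c,4}}{f_{c,1}} .$$ That is, as long as the initial queues on the roads entering the right junction have not depleted, the exit throughput $\gamma_5$ (the flux assigned to road 5 at the right junction) satisfies $$\gamma_5=n_5f_{c,1}\ \text{ if } n_5<n_5^\star,\qquad \gamma_5=f_{c,2}+f_{c,4}\ \text{ if } n_5\ge n_5^\star,$$ so that it scales linearly in $n_5$ for $n_5<n_5^\star$ and is independent of $n_5$ for $n_5\ge n_5^\star$.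
   Context: **Network.** There are five roads; road $i$ is an interval $[0,L_i]$ carrying traffic from $0$ to $L_i$. Road 1 (entry) ends at the left junction, from which roads 2 and 4 start; road 2 ends at a middle junction from which road 3 starts; roads 3 and 4 end at the right junction, from which road 5 (exit) starts. Roads 2 and 3 have identical parameters and together form one extended road of length $L_2+L_3$ (the middle junction is trivial: one road in, one road out). At the left junction a fraction $\alpha\in(0,1)$ of drivers prefers road 2 and $1-\alpha$ prefers road 4, i.e. the distribution matrix is $(\alpha,1-\alpha)^T$; at the right junction the distribution matrix is $(1\ \ 1)$. **Fluxes.** The density $\rho_i(t,x)\in[0,n_i]$ (normalized by the jam density per lane, $n_i$ = number of lanes) is an entropy solution of $\partial_t\rho_i+\partial_xf_i(\rho_i)=0$ on road $i$, where $$f_i(\rho)=\begin{cases}v_i\rho,&\rho\in[0,\sigma_i],\\ A_i(\rho-\sigma_i)^2+f_{c,i},&\rho\in[\sigma_i,n_i],\end{cases}\qquad \sigma_i=\frac{f_{c,i}}{v_i},\quad A_i=-\frac{f_{c,i}}{(n_i-\sigma_i)^2},$$ with free-flow speed $v_i>0$, flux capacity $f_{c,i}>0$, $0<\sigma_i<n_i$. Here $n_1=n_2=n_3=n_4=1$; $v_3=v_2$, $f_{c,3}=f_{c,2}$; $n_5>0$ is the number of exit lanes. **Structural conditions.** (i) $v_2<v_4$. (ii) $L:=L_2+L_3=L_4$. (iii) $f_{c,5}=n_5f_{c,1}$, $v_5=v_1$, $\sigma_5=n_5\sigma_1$, $A_5=A_1/n_5$. **Junction rule.** At each time, the capacity of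 an incoming road with boundary density $\rho$ at the junction is $c_i=f_i(\rho)$ if $\rho\le\sigma_i$ and $c_i=f_{c,i}$ if $\rho\ge\sigma_i$; the capacity of an outgoing road with boundary density $\rho$ is $c_j=f_{c,j}$ if $\rho\le\sigma_j$ and $c_j=f_j(\rho)$ if $\rho\ge\sigma_j$. With $c_{\rm in}$ the vector of incoming capacities, $c_{\rm out}$ the vector of outgoing capacities and $A$ the distribution matrix, fluxes $\hat\gamma$ through the junction are assigned as follows. If $Ac_{\rm in}\le c_{\rm out}$ componentwise, they maximize the total incoming flux subject to $0\le\hat\gamma_i\le c_i$ on all roads and (outgoing fluxes) $=A\,\cdot$ (incoming fluxes). Otherwise, incoming fluxes are $\mu c_{\rm in}$ and outgoing fluxes are $\lambda c_{\rm out}$, with $(\lambda,\mu)\in[0,1]^2$ maximizing the total incoming flux subject to equality of total incoming and total outgoing flux. Junction boundary densities are consistent with waves of negative speed on incoming roads and positive speed on outgoing roads. The far end of road 5 is non-reflecting (waves leave freely). **Non-depletion.** The initial queues on the roads entering the right junction have not depleted by time $t$ if the amount of traffic that has left the residential route (extended road 2–3) and the amount that has left road 4 through the right junction during $[0,t]$ are each at most the initial amount $\rho_{\mathrm{init}}L$ on that route.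
   Formalization: Non-depletion by time t also requires that the amount that left each route was strictly below its initial amount at all earlier times; otherwise, with fully jammed data and no later inflow, an emptied route still counts as not depleted and the claim fails. *)

theory Defs
  imports "HOL-Analysis.Analysis"
begin

record road =
  lanes :: real
  vfree :: real
  fcap :: real
  len :: real

definition crit_density :: "road \<Rightarrow> real" where
  "crit_density r = fcap r / vfree r"

definition curv :: "road \<Rightarrow> real" where
  "curv r = - fcap r / (lanes r - crit_density r)\<^sup>2"

definition flux :: "road \<Rightarrow> real \<Rightarrow> real" where
  "flux r d = (if d \<le> crit_density r then vfree r * d else curv r * (d - crit_density r)\<^sup>2 + fcap r)"

definition valid_road :: "road \<Rightarrow> bool" where
  "valid_road r \<longleftrightarrow> 0 < vfree r \<and> 0 < fcap r \<and> crit_density r < lanes r \<and> 0 < len r"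

definition cap_in :: "road \<Rightarrow> real \<Rightarrow> real" where
  "cap_in r d = (if d \<le> crit_density r then flux r d else fcap r)"

definition cap_out :: "road \<Rightarrow> real \<Rightarrow> real" where
  "cap_out r d = (if d \<le> crit_density r then fcap r else flux r d)"


section \<open>Entropy solutions and boundary traces on one road\<close>

text \<open>
  Nonnegative \<open>C\<^sup>1\<close> functions on the plane, given with their two partial derivatives, with compact
  support in \<open>(-\<infinity>, T) \<times> (0, L)\<close>. They need not vanish at time \<open>0\<close>, so that the entropy inequality
  below also encodes the initial condition.
\<close>

definition test_function ::
  "real \<Rightarrow> real \<Rightarrow> (real \<Rightarrow> real \<Rightarrow> real) \<Rightarrow> (real \<Rightarrow> real \<Rightarrow> real) \<Rightarrow> (real \<Rightarrow> real \<Rightarrow> real) \<Rightarrow> bool"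
where
  "test_function T L \<phi> \<phi>t \<phi>x \<longleftrightarrow>
     (\<forall>t x. 0 \<le> \<phi> t x) \<and>
     (\<forall>t x. ((\<lambda>s. \<phi> s x) has_real_derivative \<phi>t t x) (at t)) \<and>
     (\<forall>t x. ((\<lambda>y. \<phi> t y) has_real_derivative \<phi>x t x) (at x)) \<and>
     continuous_on UNIV (\<lambda>(t, x). \<phi>t t x) \<and>
     continuous_on UNIV (\<lambda>(t, x). \<phi>x t x) \<and>
     (\<exists>K. compact K \<and> K \<subseteq> {..<T} \<times> {0<..<L} \<and> (\<forall>t x. (t, x) \<notin> K \<longrightarrow> \<phi> t x = 0))"

text \<open>Kruzhkov entropy solutions of \<open>\<partial>\<^sub>t \<rho> + \<partial>\<^sub>x f(\<rho>) = 0\<close> on \<open>(0, T) \<times> (0, L)\<close> with initial datum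
  \<open>\<rho>0\<close>. The constants \<open>k = 0\<close> and \<open>k = n\<close> yield the weak form of the conservation law.\<close>

definition entropy_solution ::
  "road \<Rightarrow> real \<Rightarrow> (real \<Rightarrow> real) \<Rightarrow> (real \<Rightarrow> real \<Rightarrow> real) \<Rightarrow> bool"
where
  "entropy_solution r T \<rho>0 \<rho> \<longleftrightarrow>
     (\<lambda>(t, x). \<rho> t x) \<in> borel_measurable borel \<and>
     (\<forall>t\<in>{0..T}. \<forall>x\<in>{0..len r}. \<rho> t x \<in> {0..lanes r}) \<and>
     (\<forall>k\<in>{0..lanes r}. \<forall>\<phi> \<phi>t \<phi>x. test_function T (len r) \<phi> \<phi>t \<phi>x \<longrightarrow>
        0 \<le> (LINT p:{0..T} \<times> {0..len r}|lborel.
               (case p of (t, x) \<Rightarrow>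
                  \<bar>\<rho> t x - k\<bar> * \<phi>t t x
                  + sgn (\<rho> t x - k) * (flux r (\<rho> t x) - flux r k) * \<phi>x t x))
            + (LINT x:{0..len r}|lborel. \<bar>\<rho>0 x - k\<bar> * \<phi> 0 x))"

text \<open>Strong \<open>L\<^sup>1\<close> traces at the two ends of a road, in averaged form, so that they do not
  depend on the values of \<open>\<rho>\<close> on null sets. The bounds on the trace make the integrands
  integrable; otherwise the limit would hold trivially for a non-integrable trace.\<close>

definition trace_start ::
  "road \<Rightarrow> real \<Rightarrow> (real \<Rightarrow> real \<Rightarrow> real) \<Rightarrow> (real \<Rightarrow> real) \<Rightarrow> bool"
where
  "trace_start r T \<rho> a \<longleftrightarrow>
     a \<in> borel_measurable borel \<and> (\<forall>t\<in>{0..T}. a t \<in> {0..lanes r}) \<and>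
     ((\<lambda>h. (LINT p:{0..T} \<times> {0..h}|lborel. (case p of (t, x) \<Rightarrow> \<bar>\<rho> t x - a t\<bar>)) / h)
        \<longlongrightarrow> 0) (at_right 0)"

definition trace_end ::
  "road \<Rightarrow> real \<Rightarrow> (real \<Rightarrow> real \<Rightarrow> real) \<Rightarrow> (real \<Rightarrow> real) \<Rightarrow> bool"
where
  "trace_end r T \<rho> b \<longleftrightarrow>
     b \<in> borel_measurable borel \<and> (\<forall>t\<in>{0..T}. b t \<in> {0..lanes r}) \<and>
     ((\<lambda>h. (LINT p:{0..T} \<times> {len r - h..len r}|lborel. (case p of (t, x) \<Rightarrow> \<bar>\<rho> t x - b t\<bar>)) / h)
        \<longlongrightarrow> 0) (at_right 0)"


section \<open>Junctions\<close>

text \<open>\<open>I\<close> and \<open>J\<close> are the incoming and outgoing roads, \<open>A j i\<close> is the entry of the distribution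
  matrix for outgoing road \<open>j\<close> and incoming road \<open>i\<close>, and \<open>c\<close> collects all capacities.\<close>

definition distribution_feasible ::
  "nat set \<Rightarrow> nat set \<Rightarrow> (nat \<Rightarrow> nat \<Rightarrow> real) \<Rightarrow> (nat \<Rightarrow> real) \<Rightarrow> (nat \<Rightarrow> real) \<Rightarrow> bool"
where
  "distribution_feasible I J A c g \<longleftrightarrow>
     (\<forall>i\<in>I \<union> J. 0 \<le> g i \<and> g i \<le> c i) \<and> (\<forall>j\<in>J. g j = (\<Sum>i\<in>I. A j i * g i))"

definition proportional_feasible ::
  "nat set \<Rightarrow> nat set \<Rightarrow> (nat \<Rightarrow> real) \<Rightarrow> real \<times> real \<Rightarrow> bool"
where
  "proportional_feasible I J c = (\<lambda>(l, m).
     l \<in> {0..1} \<and> m \<in> {0..1} \<and> (\<Sum>i\<in>I. m * c i) = (\<Sum>j\<in>J. l * c j))"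

definition junction_rule ::
  "nat set \<Rightarrow> nat set \<Rightarrow> (nat \<Rightarrow> nat \<Rightarrow> real) \<Rightarrow> (nat \<Rightarrow> real) \<Rightarrow> (nat \<Rightarrow> real) \<Rightarrow> bool"
where
  "junction_rule I J A c g \<longleftrightarrow>
     (if \<forall>j\<in>J. (\<Sum>i\<in>I. A j i * c i) \<le> c j
      then is_arg_max (\<lambda>g'. \<Sum>i\<in>I. g' i) (distribution_feasible I J A c) g
      else \<exists>l m. is_arg_max (\<lambda>(l', m'). \<Sum>i\<in>I. m' * c i) (proportional_feasible I J c) (l, m) \<and>
             (\<forall>i\<in>I. g i = m * c i) \<and> (\<forall>j\<in>J. g j = l * c j))"

text \<open>The Riemann problem with left state \<open>a\<close> and right state \<open>b\<close> has only waves of negative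
  (positive) speed. As \<open>flux r\<close> is concave, the solution is a shock, whose speed is the slope
  of the chord, if \<open>a < b\<close>, and a fan or contact wave through all states between if \<open>b < a\<close>.\<close>

definition negative_waves :: "road \<Rightarrow> real \<Rightarrow> real \<Rightarrow> bool" where
  "negative_waves r a b \<longleftrightarrow>
     (a < b \<longrightarrow> flux r b < flux r a) \<and>
     (b < a \<longrightarrow> (\<forall>x y. b \<le> x \<longrightarrow> x < y \<longrightarrow> y \<le> a \<longrightarrow> flux r y < flux r x))"

definition positive_waves :: "road \<Rightarrow> real \<Rightarrow> real \<Rightarrow> bool" where
  "positive_waves r a b \<longleftrightarrow>
     (a < b \<longrightarrow> flux r a < flux r b) \<and>
     (b < a \<longrightarrow> (\<forall>x y. b \<le> x \<longrightarrow> x < y \<longrightarrow> y \<le> a \<longrightarrow> flux r x < flux r y))"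

text \<open>The junction Riemann solver: boundary densities \<open>d\<close> are assigned fluxes \<open>g\<close> and
  junction densities \<open>d'\<close>.\<close>

definition junction_riemann ::
  "(nat \<Rightarrow> road) \<Rightarrow> nat set \<Rightarrow> nat set \<Rightarrow> (nat \<Rightarrow> nat \<Rightarrow> real) \<Rightarrow>
   (nat \<Rightarrow> real) \<Rightarrow> (nat \<Rightarrow> real) \<Rightarrow> (nat \<Rightarrow> real) \<Rightarrow> bool"
where
  "junction_riemann N I J A d g d' \<longleftrightarrow>
     junction_rule I J A (\<lambda>i. if i \<in> I then cap_in (N i) (d i) else cap_out (N i) (d i)) g \<and>
     (\<forall>i\<in>I \<union> J. d' i \<in> {0..lanes (N i)} \<and> flux (N i) (d' i) = g i) \<and>
     (\<forall>i\<in>I. negative_waves (N i) (d i) (d' i)) \<and>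
     (\<forall>j\<in>J. positive_waves (N j) (d' j) (d j))"


section \<open>The toy network\<close>

datatype junction = Left_Junction | Middle_Junction | Right_Junction

fun incoming :: "junction \<Rightarrow> nat set" where
  "incoming Left_Junction = {1}"
| "incoming Middle_Junction = {2}"
| "incoming Right_Junction = {3, 4}"

fun outgoing :: "junction \<Rightarrow> nat set" where
  "outgoing Left_Junction = {2, 4}"
| "outgoing Middle_Junction = {3}"
| "outgoing Right_Junction = {5}"

fun distribution :: "real \<Rightarrow> junction \<Rightarrow> nat \<Rightarrow> nat \<Rightarrow> real" where
  "distribution \<alpha> Left_Junction j i = (if j = 2 then \<alpha> else 1 - \<alpha>)"
| "distribution \<alpha> Middle_Junction j i = 1"
| "distribution \<alpha> Right_Junction j i = 1"

definition toy_network :: "(nat \<Rightarrow> road) \<Rightarrow> real \<Rightarrow> bool" where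
  "toy_network N n5 \<longleftrightarrow>
     (\<forall>i\<in>{1..5}. valid_road (N i)) \<and>
     (\<forall>i\<in>{1..4}. lanes (N i) = 1) \<and> lanes (N 5) = n5 \<and> 0 < n5 \<and>
     vfree (N 3) = vfree (N 2) \<and> fcap (N 3) = fcap (N 2) \<and>
     vfree (N 2) < vfree (N 4) \<and>
     len (N 2) + len (N 3) = len (N 4) \<and>
     fcap (N 5) = n5 * fcap (N 1) \<and> vfree (N 5) = vfree (N 1) \<and>
     crit_density (N 5) = n5 * crit_density (N 1) \<and> curv (N 5) = curv (N 1) / n5"

text \<open>
  Solutions on the time interval \<open>[0, T]\<close>: \<open>\<rho> i t x\<close> is the density on road \<open>i\<close>, \<open>a i t\<close> and
  \<open>b i t\<close> are its traces at the start \<open>x = 0\<close> and at the end \<open>x = L\<^sub>i\<close> of the road, and \<open>\<gamma> v t i\<close> is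
  the flux that junction \<open>v\<close> assigns to road \<open>i\<close>. At almost every time the traces at a junction
  are in equilibrium, that is, the junction Riemann solver maps them to themselves.

  The last clause makes the far end of road \<open>5\<close> non-reflecting: everything that the road can
  send leaves, so no wave of negative speed enters there. The start of road \<open>1\<close>
  carries no condition, so every inflow into the network is admitted.

  Measurability of \<open>\<gamma>\<close> is needed because the integral of a non-measurable function is \<open>0\<close>.
\<close>

definition network_solution ::
  "(nat \<Rightarrow> road) \<Rightarrow> real \<Rightarrow> real \<Rightarrow> (nat \<Rightarrow> real \<Rightarrow> real) \<Rightarrow> (nat \<Rightarrow> real \<Rightarrow> real \<Rightarrow> real) \<Rightarrow>
   (nat \<Rightarrow> real \<Rightarrow> real) \<Rightarrow> (nat \<Rightarrow> real \<Rightarrow> real) \<Rightarrow> (junction \<Rightarrow> real \<Rightarrow> nat \<Rightarrow> real) \<Rightarrow> bool"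
where
  "network_solution N \<alpha> T \<rho>0 \<rho> a b \<gamma> \<longleftrightarrow>
     (\<forall>i\<in>{1..5}. entropy_solution (N i) T (\<rho>0 i) (\<rho> i)) \<and>
     (\<forall>i\<in>{2..5}. trace_start (N i) T (\<rho> i) (a i)) \<and>
     (\<forall>i\<in>{1..5}. trace_end (N i) T (\<rho> i) (b i)) \<and>
     (\<forall>v. \<forall>i\<in>incoming v \<union> outgoing v. (\<lambda>t. \<gamma> v t i) \<in> borel_measurable borel) \<and>
     (\<forall>v. AE t\<in>{0..T} in lborel.
        (let d = (\<lambda>i. if i \<in> incoming v then b i t else a i t)
         in junction_riemann N (incoming v) (outgoing v) (distribution \<alpha> v) d (\<gamma> v t) d)) \<and>
     (AE t\<in>{0..T} in lborel. flux (N 5) (b 5 t) = cap_in (N 5) (b 5 t))"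

definition amount_left :: "(junction \<Rightarrow> real \<Rightarrow> nat \<Rightarrow> real) \<Rightarrow> nat \<Rightarrow> real \<Rightarrow> real" where
  "amount_left \<gamma> i t = (LINT s:{0..t}|lborel. \<gamma> Right_Junction s i)"

text \<open>
  Roads \<open>3\<close> and \<open>4\<close> are the last roads of the two routes, both of length \<open>L\<^sub>4\<close>. The conjunct on
  earlier times only matters if a route receives no inflow at all: the amount that has left then
  stays equal to the initial amount forever after the queue is gone, and these later
  times must not count as times before depletion.
\<close>

definition queues_not_depleted ::
  "(nat \<Rightarrow> road) \<Rightarrow> real \<Rightarrow> (junction \<Rightarrow> real \<Rightarrow> nat \<Rightarrow> real) \<Rightarrow> real \<Rightarrow> bool"
where
  "queues_not_depleted N \<rho>init \<gamma> t \<longleftrightarrow>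
     (\<forall>i\<in>{3, 4}. amount_left \<gamma> i t \<le> \<rho>init * len (N 4) \<and>
                 (\<forall>s\<in>{0..<t}. amount_left \<gamma> i s < \<rho>init * len (N 4)))"

definition n5_star :: "(nat \<Rightarrow> road) \<Rightarrow> real" where
  "n5_star N = (fcap (N 2) + fcap (N 4)) / fcap (N 1)"

end

theory Submission
  imports Defs
begin

text \<open>
  On one road, \<open>u = (\<sigma> - \<rho>)\<^sup>+\<close> is a Kruzhkov entropy whose flux is \<open>v u\<close>, so \<open>u\<close> does not increase
  along the free-flow characteristics \<open>x = v (t - s)\<close>. If the end of the road is uncongested at
  time \<open>t\<close>, then so is the whole characteristic arriving there, and it must have entered
  through the start of the road, because the initial datum is congested. As \<open>f(\<rho>) = v \<rho>\<close> along it, no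
  traffic crosses it, and conservation of mass in front of it shows that all initial traffic has left.
  Before depletion the roads entering the right junction therefore offer their full capacity. The
  exit road stays free of congestion, since \<open>(\<rho> - \<sigma>)\<^sup>+\<close> vanishes initially and cannot enter through the
  non-reflecting end, so it offers \<open>n\<^sub>5 f\<^sub>c\<^sub>,\<^sub>1\<close>, and the junction assigns the minimum of the two.
\<close>

section \<open>Integrals of bounded functions on the line and the plane\<close>

text \<open>Nothing is regular enough to be followed along a curve: \<open>\<rho>\<close> is only
  measurable, the entropy inequality sees only test functions that vanish at both ends of a road,
  and traces are averaged limits. Every claim about a characteristic is therefore first an
  inequality for test functions \<open>\<theta> (t - x / v) * Z x\<close>, with boundary terms won
  by spatial cutoffs; localizing \<open>\<theta>\<close> and \<open>Z\<close> turns it into a claim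
  about almost every characteristic. The entropies come from the Kruzhkov family on
  \<open>[0, n]\<close>: the constant \<open>\<sigma>\<close> together with \<open>n\<close> yields
  the slack, together with \<open>0\<close> the congestion, and \<open>n\<close> alone yields the
  half of mass conservation that bounds the outflow from below. On the residential route the
  argument runs twice: a free arrival at the end of road 3 entered that road free, the middle
  junction then forces the end of road 2 to be free at that moment, and the two mass balances add
  up. A free arrival only shows that at least the initial amount has left, which equality before
  depletion does not contradict. Equality happens at one time per route, hence on a null
  set.\<close>

lemma set_integrable_bounded:
  fixes f :: "'a::euclidean_space \<Rightarrow> real"
  assumes "A \<in> sets borel" "bounded A" "f \<in> borel_measurable borel" "\<And>x. x \<in> A \<Longrightarrow> \<bar>f x\<bar> \<le> C"
  shows "set_integrable lborel A f"
  unfolding set_integrable_def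
proof (rule integrableI_bounded_set_indicator[where B=C])
  show "emeasure lborel A < \<infinity>" using assms emeasure_bounded_finite by blast
qed (use assms in auto)

lemma LINT_Times:
  fixes f :: "real \<times> real \<Rightarrow> real"
  assumes "set_integrable lborel (A \<times> B) f"
  shows "(LINT p:A \<times> B|lborel. f p) = (LINT x:A|lborel. LINT y:B|lborel. f (x, y))"
proof -
  have "integrable (lborel \<Otimes>\<^sub>M lborel) (\<lambda>(x, y). indicator A x *\<^sub>R (indicator B y *\<^sub>R f (x, y)))"
    using assms by (simp add: set_integrable_def lborel_prod case_prod_unfold indicator_times mult.assoc)
  from lborel_pair.integral_fst[OF this] show ?thesis
    by (simp add: set_lebesgue_integral_def lborel_prod case_prod_unfold indicator_times mult.assoc)
qed

lemma LINT_Times_swap: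
  fixes f :: "real \<times> real \<Rightarrow> real"
  assumes "set_integrable lborel (A \<times> B) f"
  shows "(LINT p:A \<times> B|lborel. f p) = (LINT y:B|lborel. LINT x:A|lborel. f (x, y))"
proof -
  have eq: "(\<lambda>(x, y). indicator B y *\<^sub>R (indicator A x *\<^sub>R f (x, y))) = (\<lambda>p. indicator (A \<times> B) p *\<^sub>R f p)"
    by (auto simp: fun_eq_iff indicator_times)
  have "integrable (lborel \<Otimes>\<^sub>M lborel) (\<lambda>(x, y). indicator B y *\<^sub>R (indicator A x *\<^sub>R f (x, y)))"
    using assms unfolding eq lborel_prod set_integrable_def .
  from lborel_pair.integral_snd[OF this] show ?thesis
    unfolding eq lborel_prod by (simp add: set_lebesgue_integral_def)
qed

lemma LINT_Icc_FTC:
  fixes f F :: "real \<Rightarrow> real"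
  assumes "a \<le> b" "\<And>x. (F has_real_derivative f x) (at x)" "continuous_on UNIV f"
  shows "(LINT x:{a..b}|lborel. f x) = F b - F a"
  unfolding set_lebesgue_integral_def
  using integral_FTC_Icc[of a b F f] assms
  by (auto simp: has_real_derivative_iff_has_vector_derivative intro: has_vector_derivative_at_within
      continuous_on_subset)

lemma continuous_antiderivative:
  fixes f :: "real \<Rightarrow> real"
  assumes "continuous_on UNIV f"
  obtains F where "\<And>x. (F has_real_derivative f x) (at x)"
  using einterval_antiderivative[of "-\<infinity>" "\<infinity>" f] assms
  by (auto simp: continuous_on_eq_continuous_at has_real_derivative_iff_has_vector_derivative)

section \<open>Shears of the plane and convergence of bounded integrands\<close>

lemma measurable_shear [measurable]:
  "(\<lambda>p. (fst p + c * snd p, snd p)) \<in> borel_measurable (borel :: (real \<times> real) measure)"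
  by (intro borel_measurable_continuous_onI continuous_intros)

text \<open>For a fixed second coordinate the map is a translation, so Tonelli applies. With
  \<open>c = 1 / v\<close> it sends a departure time and a position \<open>(s, x)\<close> to the
  point \<open>(s + x / v, x)\<close> of a free-flow characteristic.\<close>

lemma lborel_shear:
  "distr lborel lborel (\<lambda>p. (fst p + c * snd p, snd p)) = (lborel :: (real \<times> real) measure)"
proof (rule measure_eqI)
  fix A :: "(real \<times> real) set"
  assume "A \<in> sets (distr lborel lborel (\<lambda>p. (fst p + c * snd p, snd p)))"
  then have A[measurable]: "A \<in> sets borel" by simp
  have [measurable]: "A \<in> sets (borel \<Otimes>\<^sub>M borel)" using A unfolding borel_prod .
  have "emeasure (distr lborel lborel (\<lambda>p. (fst p + c * snd p, snd p))) A
      = (\<integral>\<^sup>+p. indicator A (fst p + c * snd p, snd p) \<partial>(lborel \<Otimes>\<^sub>M lborel))"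
  proof -
    have "emeasure (distr lborel lborel (\<lambda>p. (fst p + c * snd p, snd p))) A
        = (\<integral>\<^sup>+p. indicator A p \<partial>distr lborel lborel (\<lambda>p. (fst p + c * snd p, snd p)))"
      by simp
    also have "\<dots> = (\<integral>\<^sup>+p. indicator A (fst p + c * snd p, snd p) \<partial>lborel)"
      by (rule nn_integral_distr) simp_all
    finally show ?thesis by (simp add: lborel_prod)
  qed
  also have "\<dots> = (\<integral>\<^sup>+y. \<integral>\<^sup>+x. indicator A (x + c * y, y) \<partial>lborel \<partial>lborel)"
    by (subst lborel_pair.nn_integral_snd[symmetric]) (simp_all add: case_prod_beta)
  also have "\<dots> = (\<integral>\<^sup>+y. \<integral>\<^sup>+x. indicator A (x, y) \<partial>lborel \<partial>lborel)"
  proof (rule nn_integral_cong)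
    fix y :: real
    show "(\<integral>\<^sup>+x. indicator A (x + c * y, y) \<partial>lborel) = (\<integral>\<^sup>+x. indicator A (x, y) \<partial>lborel)"
      by (subst (2) nn_integral_real_affine[of _ 1 "c * y"]) (simp_all add: add.commute)
  qed
  also have "\<dots> = (\<integral>\<^sup>+p. indicator A p \<partial>(lborel \<Otimes>\<^sub>M lborel))"
    by (subst lborel_pair.nn_integral_snd[symmetric]) (simp_all add: case_prod_beta)
  also have "\<dots> = emeasure lborel A" by (simp add: lborel_prod)
  finally show "emeasure (distr lborel lborel (\<lambda>p. (fst p + c * snd p, snd p))) A = emeasure lborel A" .
qed simp

lemma LINT_shear:
  fixes f :: "real \<times> real \<Rightarrow> real"
  assumes [measurable]: "f \<in> borel_measurable borel"
  shows "(LINT p|lborel. f p) = (LINT p|lborel. f (fst p + c * snd p, snd p))"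
proof -
  have "(LINT p|lborel. f p) = (LINT p|distr lborel lborel (\<lambda>p. (fst p + c * snd p, snd p)). f p)"
    by (simp only: lborel_shear)
  also have "\<dots> = (LINT p|lborel. f (fst p + c * snd p, snd p))"
    by (subst integral_distr) simp_all
  finally show ?thesis .
qed

lemma set_integral_abs_le:
  fixes f g :: "'a \<Rightarrow> real"
  assumes "set_integrable M A f" "set_integrable M A g" "\<And>x. x \<in> A \<Longrightarrow> \<bar>f x\<bar> \<le> g x"
  shows "\<bar>LINT x:A|M. f x\<bar> \<le> (LINT x:A|M. g x)"
proof -
  have "(LINT x:A|M. f x) \<le> (LINT x:A|M. g x)"
    using assms by (intro set_integral_mono) (auto dest: order_trans[OF abs_ge_self])
  moreover have "- (LINT x:A|M. f x) \<le> (LINT x:A|M. g x)"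
  proof -
    have "(LINT x:A|M. - f x) \<le> (LINT x:A|M. g x)"
      using assms by (intro set_integral_mono) (auto simp: set_integrable_def dest: order_trans[OF abs_ge_minus_self])
    then show ?thesis using assms by (simp add: set_integral_uminus)
  qed
  ultimately show ?thesis by linarith
qed

lemma set_integral_tendsto_bounded:
  fixes f :: "nat \<Rightarrow> 'a::euclidean_space \<Rightarrow> real"
  assumes A: "A \<in> sets borel" "bounded A" and f: "\<And>i. f i \<in> borel_measurable borel" "g \<in> borel_measurable borel"
    and bdd: "\<And>i x. x \<in> A \<Longrightarrow> \<bar>f i x\<bar> \<le> C"
    and lim: "AE x in lborel. x \<in> A \<longrightarrow> (\<lambda>i. f i x) \<longlonglongrightarrow> g x"
  shows "(\<lambda>i. LINT x:A|lborel. f i x) \<longlonglongrightarrow> (LINT x:A|lborel. g x)"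
  unfolding set_lebesgue_integral_def
proof (rule integral_dominated_convergence[where w="\<lambda>x. indicator A x *\<^sub>R C"])
  show "integrable lborel (\<lambda>x. indicator A x *\<^sub>R C)"
    using set_integrable_bounded[OF A, of "\<lambda>_. C" "\<bar>C\<bar>"] by (simp add: set_integrable_def)
  show "AE x in lborel. (\<lambda>i. indicator A x *\<^sub>R f i x) \<longlonglongrightarrow> indicator A x *\<^sub>R g x"
    using lim by eventually_elim (auto simp: indicator_def)
  show "AE x in lborel. norm (indicator A x *\<^sub>R f i x) \<le> indicator A x *\<^sub>R C" for i
    using bdd by (auto simp: indicator_def)
qed (use A f in auto)

lemma measurable_Pair_curry:
  fixes f :: "real \<Rightarrow> real \<Rightarrow> real"
  assumes "(\<lambda>(t, x). f t x) \<in> borel_measurable borel"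
    "u \<in> borel_measurable borel" "v \<in> borel_measurable borel"
  shows "(\<lambda>p. f (u p) (v p)) \<in> borel_measurable (borel :: 'a::euclidean_space measure)"
  using measurable_compose[OF borel_measurable_Pair[OF assms(2,3)] assms(1)] by simp

lemma measurable_fst_snd_plane [measurable]:
  "fst \<in> borel_measurable (borel :: (real \<times> real) measure)"
  "snd \<in> borel_measurable (borel :: (real \<times> real) measure)"
  by (intro borel_measurable_continuous_onI continuous_intros)+

lemma sets_Times_Icc [measurable, simp]: "{a..b} \<times> {c..d} \<in> sets (borel :: (real \<times> real) measure)"
  by (simp add: closed_Times)

lemma bounded_Times_Icc [simp]: "bounded ({a..b} \<times> {c..d} :: (real \<times> real) set)"
  by (simp add: bounded_Times)

text \<open>The spatial cutoffs of \<open>balance_kruzhkov_nonneg\<close> converge only away from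
  the two ends of the road; this makes the exceptional points negligible.\<close>

lemma AE_snd_neq:
  fixes c :: real
  shows "AE p in (lborel :: (real \<times> real) measure). snd p \<noteq> c"
proof -
  have "emeasure (lborel \<Otimes>\<^sub>M lborel) ((UNIV :: real set) \<times> {c}) = emeasure (lborel::real measure) UNIV * emeasure (lborel::real measure) {c}"
    by (rule lborel.emeasure_pair_measure_Times) auto
  then have "(UNIV \<times> {c}) \<in> null_sets (lborel :: (real \<times> real) measure)"
    by (intro null_setsI) (auto simp: lborel_prod intro!: borel_closed closed_Times)
  from AE_not_in[OF this] show ?thesis by eventually_elim auto
qed

lemma continuous_on_Pair_curry:
  fixes f :: "real \<Rightarrow> real \<Rightarrow> real"
  assumes "continuous_on UNIV (\<lambda>(t, x). f t x)" "continuous_on A u" "continuous_on A v"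
  shows "continuous_on A (\<lambda>p. f (u p) (v p))"
  using continuous_on_compose2[OF assms(1) continuous_on_Pair[OF assms(2,3)]] by simp

lemma continuous_bounded_Times:
  fixes f :: "real \<Rightarrow> real \<Rightarrow> real"
  assumes "continuous_on UNIV (\<lambda>(t, x). f t x)"
  obtains M where "\<And>t x. t \<in> {a..b} \<Longrightarrow> x \<in> {c..d} \<Longrightarrow> \<bar>f t x\<bar> \<le> M"
proof -
  have "compact ((\<lambda>(t, x). f t x) ` ({a..b} \<times> {c..d}))"
    by (intro compact_continuous_image compact_Times continuous_on_subset[OF assms]) auto
  then obtain M where "\<And>y. y \<in> (\<lambda>(t, x). f t x) ` ({a..b} \<times> {c..d}) \<Longrightarrow> norm y \<le> M"
    using compact_imp_bounded bounded_iff by metis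
  then show ?thesis by (intro that[of M]) force
qed

text \<open>Reversing the road turns the trace at its end into a trace at its start, so that
  \<open>trace_limit\<close> serves both ends.\<close>

lemma LINT_Times_reflect:
  fixes f :: "real \<times> real \<Rightarrow> real"
  assumes [measurable]: "f \<in> borel_measurable borel"
  shows "(LINT p:{s..t} \<times> {L - d..L - c}|lborel. f p) = (LINT p:{s..t} \<times> {c..d}|lborel. f (fst p, L - snd p))"
proof -
  have m[measurable]: "(\<lambda>p. (fst p, L - snd p)) \<in> borel_measurable (borel :: (real \<times> real) measure)"
    by (intro borel_measurable_continuous_onI continuous_intros)
  have "distr lborel lborel (\<lambda>p. (fst p, L - snd p)) = (lborel :: (real \<times> real) measure)"
  proof (rule measure_eqI)
    fix A :: "(real \<times> real) set"
    assume "A \<in> sets (distr lborel lborel (\<lambda>p. (fst p, L - snd p)))"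
    then have A[measurable]: "A \<in> sets borel" by simp
    have [measurable]: "A \<in> sets (borel \<Otimes>\<^sub>M borel)" using A unfolding borel_prod .
    have "emeasure (distr lborel lborel (\<lambda>p. (fst p, L - snd p))) A
        = (\<integral>\<^sup>+p. indicator A p \<partial>distr lborel lborel (\<lambda>p. (fst p, L - snd p)))"
      by simp
    also have "\<dots> = (\<integral>\<^sup>+p. indicator A (fst p, L - snd p) \<partial>(lborel \<Otimes>\<^sub>M lborel))"
      unfolding lborel_prod by (rule nn_integral_distr) simp_all
    also have "\<dots> = (\<integral>\<^sup>+x. \<integral>\<^sup>+y. indicator A (x, L - y) \<partial>lborel \<partial>lborel)"
      by (subst lborel.nn_integral_fst[symmetric]) (simp_all add: case_prod_beta)
    also have "\<dots> = (\<integral>\<^sup>+x. \<integral>\<^sup>+y. indicator A (x, y) \<partial>lborel \<partial>lborel)"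
    proof (rule nn_integral_cong)
      fix x :: real
      show "(\<integral>\<^sup>+y. indicator A (x, L - y) \<partial>lborel) = (\<integral>\<^sup>+y. indicator A (x, y) \<partial>lborel)"
        by (subst (2) nn_integral_real_affine[of _ "-1" L]) simp_all
    qed
    also have "\<dots> = (\<integral>\<^sup>+p. indicator A p \<partial>(lborel \<Otimes>\<^sub>M lborel))"
      by (subst lborel.nn_integral_fst[symmetric]) (simp_all add: case_prod_beta)
    also have "\<dots> = emeasure lborel A" by (simp add: lborel_prod)
    finally show "emeasure (distr lborel lborel (\<lambda>p. (fst p, L - snd p))) A = emeasure lborel A" .
  qed simp
  then have "(LINT p:{s..t} \<times> {L - d..L - c}|lborel. f p)
    = (LINT p|distr lborel lborel (\<lambda>p. (fst p, L - snd p)). indicator ({s..t} \<times> {L - d..L - c}) p *\<^sub>R f p)"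
    by (simp add: set_lebesgue_integral_def)
  also have "\<dots> = (LINT p|lborel. indicator ({s..t} \<times> {L - d..L - c}) (fst p, L - snd p) *\<^sub>R f (fst p, L - snd p))"
    by (rule integral_distr) simp_all
  also have "\<dots> = (LINT p:{s..t} \<times> {c..d}|lborel. f (fst p, L - snd p))"
    unfolding set_lebesgue_integral_def
    by (rule Bochner_Integration.integral_cong) (auto simp: indicator_def)
  finally show ?thesis .
qed

lemma integrable_bounded_support:
  fixes f :: "'a::euclidean_space \<Rightarrow> real"
  assumes "A \<in> sets borel" "bounded A" "f \<in> borel_measurable borel" "\<And>x. x \<in> A \<Longrightarrow> \<bar>f x\<bar> \<le> C"
    and "\<And>x. x \<notin> A \<Longrightarrow> f x = 0"
  shows "integrable lborel f"
proof -
  have "(\<lambda>x. indicator A x *\<^sub>R f x) = f" by (auto simp: fun_eq_iff indicator_def assms(5))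
  then show ?thesis using set_integrable_bounded[OF assms(1-4)] by (simp add: set_integrable_def)
qed

text \<open>Moves statements about almost every time between departure and arrival times of a
  characteristic.\<close>

lemma AE_translate:
  fixes k :: real
  assumes "AE x in lborel. P x"
  shows "AE x in lborel. P (k + x)"
proof (rule AE_distrD[of "(+) k" lborel borel P])
  show "AE x in distr lborel borel ((+) k). P x" unfolding lborel_distr_plus by (rule assms)
qed simp

lemma LINT_translate:
  fixes f :: "real \<Rightarrow> real"
  shows "(LINT x|lborel. f x) = (LINT x|lborel. f (k + x))"
  using lborel_integral_real_affine[of 1 f k] by simp

lemma LINT_prod:
  fixes f g :: "real \<Rightarrow> real"
  assumes "integrable lborel (\<lambda>P :: real \<times> real. f (fst P) * g (snd P))"
  shows "(LINT P|lborel. f (fst P) * g (snd P)) = (LINT x|lborel. f x) * (LINT y|lborel. g y)"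
proof -
  have "(LINT P:UNIV \<times> UNIV|lborel. f (fst P) * g (snd P)) = (LINT x:UNIV|lborel. LINT y:UNIV|lborel. f x * g y)"
    using LINT_Times[of UNIV UNIV "\<lambda>P. f (fst P) * g (snd P)"] assms by (simp add: set_integrable_def)
  then show ?thesis by (simp add: set_lebesgue_integral_def)
qed

lemma LINT_Icc_abs_le:
  fixes f :: "real \<Rightarrow> real"
  assumes "l \<le> u" "f \<in> borel_measurable borel" "\<And>x. x \<in> {l..u} \<Longrightarrow> \<bar>f x\<bar> \<le> C"
  shows "\<bar>LINT x:{l..u}|lborel. f x\<bar> \<le> C * (u - l)"
proof -
  have "\<bar>LINT x:{l..u}|lborel. f x\<bar> \<le> (LINT x:{l..u}|lborel. C)"
  proof (rule set_integral_abs_le)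
    show "set_integrable lborel {l..u} f"
      by (rule set_integrable_bounded[where C=C]) (use assms in auto)
    show "set_integrable lborel {l..u} (\<lambda>x. C)"
      by (rule set_integrable_bounded[where C="\<bar>C\<bar>"]) auto
  qed (use assms in auto)
  also have "\<dots> = C * (u - l)" using assms(1) by (simp add: set_lebesgue_integral_def)
  finally show ?thesis .
qed

lemma LINT_pair:
  fixes f :: "real \<times> real \<Rightarrow> real"
  assumes "integrable lborel f"
  shows "(LINT P|lborel. f P) = (LINT x|lborel. LINT y|lborel. f (x, y))"
  using LINT_Times[of UNIV UNIV f] assms by (simp add: set_integrable_def set_lebesgue_integral_def)

section \<open>Nonnegativity from integrals over boxes\<close>

text \<open>The measures \<open>P\<close> and \<open>M\<close> have the positive and the negative
  part of \<open>g\<close> as densities, and the hypothesis says \<open>M \<le> P\<close> on boxes.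
  The set \<open>E\<close> where \<open>g\<close> is negative is \<open>P\<close>-null. Covering it
  by almost disjoint boxes inside a slightly larger open set \<open>V\<close> gives
  \<open>M E \<le> P V = P (V - E)\<close>, which is as small as desired since \<open>g\<close> is
  bounded.\<close>

lemma AE_nonneg_if_box_integrals_nonneg:
  fixes g :: "'a::euclidean_space \<Rightarrow> real"
  assumes g[measurable]: "g \<in> borel_measurable borel" and bdd: "\<And>x. x \<in> box l u \<Longrightarrow> \<bar>g x\<bar> \<le> C"
    and box: "\<And>c d. cbox c d \<subseteq> box l u \<Longrightarrow> 0 \<le> (LINT x:box c d|lborel. g x)"
  shows "AE x in lborel. x \<in> box l u \<longrightarrow> 0 \<le> g x"
proof (cases "box l u = {}")
  case True
  then show ?thesis by simp
next
  case False
  define P where "P = density lborel (\<lambda>x. ennreal (g x))"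
  define M where "M = density lborel (\<lambda>x. ennreal (- g x))"
  define E where "E = {x \<in> box l u. g x < 0}"
  have [measurable]: "E \<in> sets borel" unfolding E_def by measurable
  have C0: "0 \<le> C" using False bdd abs_ge_zero order_trans by blast
  have PM: "M (box c d) \<le> P (box c d)" if cd: "cbox c d \<subseteq> box l u" for c d
  proof -
    have bdd: "\<bar>g x\<bar> \<le> C" if "x \<in> box c d" for x
      using that cd box_subset_cbox bdd by blast
    have fin: "set_integrable lborel (box c d) h"
      if "h \<in> borel_measurable borel" "\<And>x. x \<in> box c d \<Longrightarrow> \<bar>h x\<bar> \<le> C" for h :: "'a \<Rightarrow> real"
      unfolding set_integrable_def
      by (rule integrableI_bounded_set_indicator[where B=C])
        (use that emeasure_bounded_finite[OF bounded_box] in auto)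
    have i1: "set_integrable lborel (box c d) (\<lambda>x. max 0 (g x))"
      by (rule fin) (use bdd C0 in \<open>auto simp: abs_le_iff max_def intro: order_trans[OF abs_ge_self]\<close>)
    have i2: "set_integrable lborel (box c d) (\<lambda>x. max 0 (- g x))"
      by (rule fin) (use bdd C0 in \<open>auto simp: abs_le_iff max_def intro: order_trans[OF abs_ge_self]\<close>)
    have "(LINT x:box c d|lborel. g x)
        = (LINT x:box c d|lborel. max 0 (g x) - max 0 (- g x))"
      by (intro set_lebesgue_integral_cong) auto
    also have "\<dots> = (LINT x:box c d|lborel. max 0 (g x)) - (LINT x:box c d|lborel. max 0 (- g x))"
      using i1 i2 by (rule set_integral_diff)
    finally have le: "(LINT x:box c d|lborel. max 0 (- g x)) \<le> (LINT x:box c d|lborel. max 0 (g x))"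
      using box[OF cd] by linarith
    have e: "emeasure (density lborel (\<lambda>x. ennreal (h x))) (box c d) = ennreal (LINT x:box c d|lborel. max 0 (h x))"
      if "set_integrable lborel (box c d) (\<lambda>x. max 0 (h x))" "h \<in> borel_measurable borel" for h
    proof -
      have "emeasure (density lborel (\<lambda>x. ennreal (h x))) (box c d) = (\<integral>\<^sup>+x\<in>box c d. ennreal (h x) \<partial>lborel)"
        using that(2) by (intro emeasure_density) auto
      also have "\<dots> = (\<integral>\<^sup>+x. ennreal (indicator (box c d) x *\<^sub>R max 0 (h x)) \<partial>lborel)"
        by (intro nn_integral_cong) (auto simp: indicator_def max_def ennreal_neg)
      also have "\<dots> = ennreal (LINT x:box c d|lborel. max 0 (h x))"
        unfolding set_lebesgue_integral_def
        by (rule nn_integral_eq_integral) (use that in \<open>auto simp: set_integrable_def\<close>)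
      finally show ?thesis .
    qed
    show ?thesis unfolding M_def P_def
      using e[OF i1] e[OF i2] le by (auto intro: ennreal_leI)
  qed
  have small: "M E \<le> ennreal (C * e)" if "0 < e" for e
  proof -
    obtain U where U: "open U" "E \<subseteq> U" "emeasure lborel (U - E) < e"
      using outer_regular_lborel[of E e] \<open>0 < e\<close> by auto
    define V where "V = U \<inter> box l u"
    have V: "open V" "E \<subseteq> V" "V \<subseteq> box l u" "emeasure lborel (V - E) < e"
    proof -
      show "open V" "E \<subseteq> V" "V \<subseteq> box l u" using U by (auto simp: V_def E_def)
      have "emeasure lborel (V - E) \<le> emeasure lborel (U - E)"
        using U by (intro emeasure_mono) (auto simp: V_def)
      then show "emeasure lborel (V - E) < e" using U by auto
    qed
    have [measurable]: "V \<in> sets borel" using V by simp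
    \<comment> \<open>Every cell contains a point of \<open>E\<close> at which the gauge is
      \<open>V\<close>, so all cells stay inside \<open>V\<close>; the value \<open>UNIV\<close>
      elsewhere only makes the map a gauge.\<close>
    obtain \<D> where D: "countable \<D>"
        "\<And>K. K \<in> \<D> \<Longrightarrow> interior K \<noteq> {} \<and> (\<exists>c d. K = cbox c d)"
        "pairwise (\<lambda>A B. interior A \<inter> interior B = {}) \<D>"
        "\<And>K. K \<in> \<D> \<Longrightarrow> \<exists>x \<in> E \<inter> K. K \<subseteq> (if x \<in> V then V else UNIV)"
        "E \<subseteq> \<Union>\<D>"
    proof (rule covering_lemma[of E l u "\<lambda>x. if x \<in> V then V else UNIV"])
      show "E \<subseteq> cbox l u" by (auto simp: E_def box_subset_cbox[THEN subsetD])
      show "gauge (\<lambda>x. if x \<in> V then V else UNIV)" using V by (auto simp: gauge_def)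
    qed (use False in auto)
    have DV: "K \<subseteq> V" if "K \<in> \<D>" for K using D(4)[OF that] V by (auto split: if_splits)
    \<comment> \<open>Cells may share boundary points. Their interiors are disjoint, which countable
      additivity needs, and what is lost is a null set for both measures.\<close>
    define W where "W = (\<Union>K\<in>\<D>. interior K)"
    have null: "K - interior K \<in> null_sets lborel" if KD: "K \<in> \<D>" for K
    proof -
      obtain c d where K: "K = cbox c d" using D(2)[OF KD] by auto
      have "negligible (cbox c d - box c d)" by (rule negligible_frontier_interval)
      then have "cbox c d - box c d \<in> null_sets lebesgue" by (simp add: negligible_iff_null_sets)
      then show ?thesis unfolding K interior_cbox
        by (metis Diff_iff null_sets_completion_iff sets_lborel borel_closed borel_open closed_cbox open_box sets.Diff)
    qed
    have WN: "(\<Union>K\<in>\<D>. K - interior K) \<in> null_sets lborel"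
      by (intro null_sets_UN' D null)
    have acM: "X \<in> null_sets M" "X \<in> null_sets P" if "X \<in> null_sets lborel" for X
      using that absolutely_continuousI_density[of "\<lambda>x. ennreal (- g x)" lborel]
        absolutely_continuousI_density[of "\<lambda>x. ennreal (g x)" lborel]
      by (auto simp: absolutely_continuous_def M_def P_def)
    have W[measurable]: "W \<in> sets borel" unfolding W_def by (intro borel_open) auto
    have sM[simp]: "sets M = sets borel" "sets P = sets borel" by (auto simp: M_def P_def)
    have "M E \<le> M (W \<union> (\<Union>K\<in>\<D>. K - interior K))"
      using D(5) null_setsD2[OF WN] W by (intro emeasure_mono) (auto simp: W_def)
    also have "\<dots> = M W" using acM[OF WN] by (intro emeasure_Un_null_set) auto
    also have "\<dots> = (\<integral>\<^sup>+K. emeasure M (interior K) \<partial>count_space \<D>)"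
      unfolding W_def using D(1,3)
      by (intro emeasure_UN_countable) (simp, simp, unfold disjoint_family_on_def pairwise_def, blast)
    also have "\<dots> \<le> (\<integral>\<^sup>+K. emeasure P (interior K) \<partial>count_space \<D>)"
    proof (intro nn_integral_mono)
      fix K assume "K \<in> space (count_space \<D>)"
      then have K: "K \<in> \<D>" by simp
      obtain c d where cd: "K = cbox c d" using D(2)[OF K] by auto
      show "M (interior K) \<le> P (interior K)"
        unfolding cd interior_cbox by (rule PM) (use DV[OF K] V cd in auto)
    qed
    also have "\<dots> = P W"
      unfolding W_def using D(1,3)
      by (intro emeasure_UN_countable[symmetric]) (simp, simp, unfold disjoint_family_on_def pairwise_def, blast)
    also have "\<dots> \<le> P (E \<union> (V - E))"
    proof (intro emeasure_mono)
      show "W \<subseteq> E \<union> (V - E)" using DV interior_subset unfolding W_def by blast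
    qed simp
    also have "\<dots> \<le> P E + P (V - E)" by (intro emeasure_subadditive) auto
    also have "P E = 0"
    proof -
      have "P E = (\<integral>\<^sup>+x. ennreal (g x) * indicator E x \<partial>lborel)"
        unfolding P_def by (rule emeasure_density) simp_all
      also have "\<dots> = (\<integral>\<^sup>+x. 0 \<partial>(lborel :: 'a measure))"
        by (rule nn_integral_cong) (auto simp: E_def indicator_def intro!: ennreal_neg)
      finally show ?thesis by simp
    qed
    also have "0 + P (V - E) = (\<integral>\<^sup>+x. ennreal (g x) * indicator (V - E) x \<partial>lborel)"
      unfolding P_def add_0 by (rule emeasure_density) simp_all
    also have "\<dots> \<le> (\<integral>\<^sup>+x. ennreal C * indicator (V - E) x \<partial>lborel)"
    proof (rule nn_integral_mono)
      fix x
      show "ennreal (g x) * indicator (V - E) x \<le> ennreal C * indicator (V - E) x"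
        using order_trans[OF abs_ge_self bdd[of x]] V(3) by (auto simp: indicator_def intro: ennreal_leI)
    qed
    also have "\<dots> = ennreal C * emeasure lborel (V - E)" by (simp add: nn_integral_cmult_indicator)
    also have "\<dots> \<le> ennreal C * ennreal e" using V(4) by (intro mult_left_mono) auto
    finally show ?thesis using C0 \<open>0 < e\<close> by (simp add: ennreal_mult)
  qed
  have "M E = 0"
  proof (rule ccontr)
    assume "M E \<noteq> 0"
    moreover have "M E \<noteq> \<infinity>" using small[of 1] by (auto simp: top_unique)
    ultimately obtain m where m: "M E = ennreal m" "0 < m"
      by (cases "M E") (auto simp: less_le)
    \<comment> \<open>This \<open>e\<close> keeps \<open>C * e\<close> below \<open>m / 2\<close>;
      the summand \<open>1\<close> covers the case \<open>C = 0\<close>.\<close>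
    have "m \<le> C * (m / (2 * (C + 1)))"
      using small[of "m / (2 * (C + 1))"] m C0 by simp
    also have "\<dots> \<le> m / 2" using m C0 by (simp add: field_simps)
    finally show False using m by simp
  qed
  then have "AE x in lborel. ennreal (- g x) * indicator E x = 0"
    unfolding M_def by (subst (asm) emeasure_density) (auto simp: nn_integral_0_iff_AE)
  then show ?thesis
    by eventually_elim (auto simp: E_def indicator_def ennreal_eq_0_iff not_less split: if_splits)
qed

section \<open>Smooth bump functions\<close>

text \<open>A quadratic spline rising from 0 to 1 on \<open>[0, 1]\<close>; its derivative is the
  tent of height 2 over that interval. Test functions only have to be continuously differentiable,
  so no smoother function is required.\<close>

definition smoothstep :: "real \<Rightarrow> real" where
  "smoothstep x = 2 * ((max 0 x)\<^sup>2 - 2 * (max 0 (x - 1/2))\<^sup>2 + (max 0 (x - 1))\<^sup>2)"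

definition smoothstep_deriv :: "real \<Rightarrow> real" where
  "smoothstep_deriv x = 4 * (max 0 x - 2 * max 0 (x - 1/2) + max 0 (x - 1))"

lemma DERIV_pos_part_square: "((\<lambda>x. (max 0 (x - c))\<^sup>2) has_real_derivative 2 * max 0 (x - c)) (at x)" for x c :: real
proof (cases x c rule: linorder_cases)
  case less
  have "((\<lambda>x. 0) has_real_derivative 2 * max 0 (x - c)) (at x)" using less by simp
  then show ?thesis
    by (rule has_field_derivative_transform_within_open[of _ _ _ "{..<c}"]) (use less in auto)
next
  case greater
  have "((\<lambda>x. (x - c)\<^sup>2) has_real_derivative 2 * max 0 (x - c)) (at x)"
    using greater by (auto intro!: derivative_eq_intros)
  then show ?thesis
    by (rule has_field_derivative_transform_within_open[of _ _ _ "{c<..}"]) (use greater in auto)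
next
  case equal
  have "((\<lambda>h. (max 0 h)\<^sup>2 / h) \<longlongrightarrow> 0) (at (0::real))"
  proof (rule Lim_null_comparison[OF _ tendsto_rabs_zero[OF tendsto_ident_at]])
    show "\<forall>\<^sub>F h in at (0::real). norm ((max 0 h)\<^sup>2 / h) \<le> \<bar>h\<bar>"
      by (auto simp: max_def power2_eq_square intro!: always_eventually)
  qed
  then show ?thesis using equal by (simp add: DERIV_def)
qed

lemma DERIV_smoothstep: "(smoothstep has_real_derivative smoothstep_deriv x) (at x)"
proof -
  note D = DERIV_pos_part_square[of 0 x, simplified] DERIV_pos_part_square[of "1/2" x] DERIV_pos_part_square[of 1 x]
  have "((\<lambda>x. 2 * ((max 0 x)\<^sup>2 - 2 * (max 0 (x - 1/2))\<^sup>2 + (max 0 (x - 1))\<^sup>2)) has_real_derivative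
     2 * (2 * max 0 x - 2 * (2 * max 0 (x - 1/2)) + 2 * max 0 (x - 1))) (at x)"
    by (intro DERIV_cmult DERIV_add DERIV_diff D)
  then show ?thesis unfolding smoothstep_def[abs_def] smoothstep_deriv_def by (simp add: algebra_simps)
qed

lemma smoothstep_deriv_bounds: "0 \<le> smoothstep_deriv x" "smoothstep_deriv x \<le> 2"
  by (auto simp: smoothstep_deriv_def max_def)

lemma smoothstep_deriv_eq_0: "x \<le> 0 \<Longrightarrow> smoothstep_deriv x = 0" "1 \<le> x \<Longrightarrow> smoothstep_deriv x = 0"
  by (auto simp: smoothstep_deriv_def max_def)

lemma continuous_on_smoothstep_deriv [continuous_intros]:
  "continuous_on A f \<Longrightarrow> continuous_on A (\<lambda>x. smoothstep_deriv (f x))"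
  unfolding smoothstep_deriv_def by (intro continuous_intros)

lemma continuous_on_smoothstep [continuous_intros]:
  "continuous_on A f \<Longrightarrow> continuous_on A (\<lambda>x. smoothstep (f x))"
  unfolding smoothstep_def by (intro continuous_intros)

lemma smoothstep_eq_0: "x \<le> 0 \<Longrightarrow> smoothstep x = 0"
  by (simp add: smoothstep_def)

lemma smoothstep_eq_1: "1 \<le> x \<Longrightarrow> smoothstep x = 1"
  by (simp add: smoothstep_def max_def power2_eq_square algebra_simps)

lemma smoothstep_bounds: "0 \<le> smoothstep x" "smoothstep x \<le> 1"
proof -
  have mono: "smoothstep x \<le> smoothstep y" if "x \<le> y" for x y
    using that by (rule DERIV_nonneg_imp_nondecreasing) (use DERIV_smoothstep smoothstep_deriv_bounds in blast)
  show "0 \<le> smoothstep x" using mono[of "min 0 x" x] smoothstep_eq_0[of "min 0 x"] by simp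
  show "smoothstep x \<le> 1" using mono[of x "max 1 x"] smoothstep_eq_1[of "max 1 x"] by simp
qed

lemma measurable_smoothstep [measurable]:
  "smoothstep \<in> borel_measurable borel" "smoothstep_deriv \<in> borel_measurable borel"
  by (intro borel_measurable_continuous_onI continuous_intros)+

text \<open>The indicator of the open interval is approached from inside: the support stays in
  \<open>[p, q]\<close> for every \<open>n\<close>, so a bump over an interval well inside the
  domain is always admissible as a test function.\<close>

definition bump :: "real \<Rightarrow> real \<Rightarrow> nat \<Rightarrow> real \<Rightarrow> real" where
  "bump p q n x = smoothstep (n * (x - p)) * smoothstep (n * (q - x))"

definition bump_deriv :: "real \<Rightarrow> real \<Rightarrow> nat \<Rightarrow> real \<Rightarrow> real" where
  "bump_deriv p q n x = n * smoothstep_deriv (n * (x - p)) * smoothstep (n * (q - x))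
     - n * smoothstep (n * (x - p)) * smoothstep_deriv (n * (q - x))"

lemma DERIV_bump: "(bump p q n has_real_derivative bump_deriv p q n x) (at x)"
proof -
  have 1: "((\<lambda>x. smoothstep (n * (x - p))) has_real_derivative smoothstep_deriv (n * (x - p)) * n) (at x)"
    by (rule DERIV_chain2[OF DERIV_smoothstep]) (auto intro!: derivative_eq_intros)
  have 2: "((\<lambda>x. smoothstep (n * (q - x))) has_real_derivative smoothstep_deriv (n * (q - x)) * (- n)) (at x)"
    by (rule DERIV_chain2[OF DERIV_smoothstep]) (auto intro!: derivative_eq_intros)
  show ?thesis unfolding bump_def[abs_def] bump_deriv_def
    by (rule DERIV_cong[OF DERIV_mult[OF 1 2]]) (simp add: algebra_simps)
qed

lemma continuous_on_bump [continuous_intros]: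
  "continuous_on A f \<Longrightarrow> continuous_on A (\<lambda>x. bump p q n (f x))"
  "continuous_on A f \<Longrightarrow> continuous_on A (\<lambda>x. bump_deriv p q n (f x))"
  unfolding bump_def bump_deriv_def by (intro continuous_intros; assumption)+

lemma measurable_bump [measurable]:
  "bump p q n \<in> borel_measurable borel" "bump_deriv p q n \<in> borel_measurable borel"
  by (intro borel_measurable_continuous_onI continuous_intros)+

lemma bump_bounds: "0 \<le> bump p q n x" "bump p q n x \<le> 1"
  using smoothstep_bounds by (auto simp: bump_def intro!: mult_nonneg_nonneg mult_le_one)

lemma bump_eq_0: "x \<le> p \<or> q \<le> x \<Longrightarrow> bump p q n x = 0"
  by (auto simp: bump_def smoothstep_eq_0 mult_nonneg_nonpos)

lemma bump_tendsto: "(\<lambda>n. bump p q n x) \<longlonglongrightarrow> indicator {p<..<q} x"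
proof (cases "p < x \<and> x < q")
  case True
  have ev: "\<forall>\<^sub>F n in sequentially. 1 \<le> real n * c" if "0 < c" for c
  proof -
    obtain N :: nat where "1 / c < real N" using reals_Archimedean2 by blast
    then have "1 \<le> real n * c" if "N \<le> n" for n
    proof -
      have "1 < real N * c" using \<open>1 / c < real N\<close> \<open>0 < c\<close> by (simp add: field_simps)
      also have "\<dots> \<le> real n * c" using that \<open>0 < c\<close> by (intro mult_right_mono) auto
      finally show ?thesis by simp
    qed
    then show ?thesis by (auto simp: eventually_sequentially)
  qed
  have "\<forall>\<^sub>F n in sequentially. 1 \<le> real n * (x - p)" "\<forall>\<^sub>F n in sequentially. 1 \<le> real n * (q - x)"
    using True by (auto intro: ev)
  then have "\<forall>\<^sub>F n in sequentially. bump p q n x = 1"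
    by eventually_elim (auto simp: bump_def smoothstep_eq_1)
  then show ?thesis using True by (auto intro: tendsto_eventually)
next
  case False
  then have "bump p q n x = 0" for n by (auto intro: bump_eq_0)
  then show ?thesis using False by (auto simp: indicator_def)
qed

lemma bump_support: "bump p q n x \<noteq> 0 \<Longrightarrow> p \<le> x" "bump p q n x \<noteq> 0 \<Longrightarrow> x \<le> q"
  using bump_eq_0[of x p q n] by fastforce+

text \<open>Entropy inequalities deliver integrals against differentiable functions; dominated
  convergence in \<open>n\<close> turns these into integrals over boxes.\<close>

lemma AE_nonneg_if_bump_integrals_nonneg:
  fixes g :: "real \<Rightarrow> real"
  assumes [measurable]: "g \<in> borel_measurable borel" and bdd: "\<And>x. l < x \<Longrightarrow> x < u \<Longrightarrow> \<bar>g x\<bar> \<le> C"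
    and bump: "\<And>p q n. l < p \<Longrightarrow> p < q \<Longrightarrow> q < u \<Longrightarrow> 0 \<le> (LINT x|lborel. bump p q n x * g x)"
  shows "AE x in lborel. l < x \<longrightarrow> x < u \<longrightarrow> 0 \<le> g x"
proof -
  have "AE x in lborel. x \<in> box l u \<longrightarrow> 0 \<le> g x"
  proof (rule AE_nonneg_if_box_integrals_nonneg)
    fix p q assume pq: "cbox p q \<subseteq> box l u"
    show "0 \<le> (LINT x:box p q|lborel. g x)"
    proof (cases "p < q")
      case False
      then show ?thesis by (simp add: set_lebesgue_integral_def)
    next
      case True
      then have "p \<in> cbox p q" "q \<in> cbox p q" by auto
      then have "p \<in> box l u" "q \<in> box l u" using pq by blast+
      then have lu: "l < p" "q < u" by auto
      have "(\<lambda>n. LINT x:{p..q}|lborel. bump p q n x * g x) \<longlonglongrightarrow> (LINT x:{p..q}|lborel. indicator {p<..<q} x * g x)"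
      proof (rule set_integral_tendsto_bounded)
        fix n x assume "x \<in> {p..q}"
        then show "\<bar>bump p q n x * g x\<bar> \<le> 1 * C"
          unfolding abs_mult using lu bump_bounds[of p q n x] bdd[of x] by (intro mult_mono) auto
      next
        show "AE x in lborel. x \<in> {p..q} \<longrightarrow> (\<lambda>n. bump p q n x * g x) \<longlonglongrightarrow> indicator {p<..<q} x * g x"
          using tendsto_mult_right[OF bump_tendsto] by auto
      qed auto
      moreover have "(LINT x:{p..q}|lborel. bump p q n x * g x) = (LINT x|lborel. bump p q n x * g x)" for n
        unfolding set_lebesgue_integral_def
        by (rule Bochner_Integration.integral_cong) (auto simp: indicator_def dest: bump_support)
      moreover have "(LINT x:{p..q}|lborel. indicator {p<..<q} x * g x) = (LINT x:box p q|lborel. g x)"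
        unfolding set_lebesgue_integral_def
        by (rule Bochner_Integration.integral_cong) (auto simp: indicator_def)
      ultimately show ?thesis
        using bump[OF lu(1) True lu(2)] by (auto intro: LIMSEQ_le_const)
    qed
  qed (use bdd in auto)
  then show ?thesis by eventually_elim auto
qed

text \<open>Testing against products is enough because a box is a product of intervals. One factor
  will localize the departure time, the other the position.\<close>

lemma AE_nonneg_if_bump_integrals_nonneg_pair:
  fixes g :: "real \<times> real \<Rightarrow> real"
  assumes [measurable]: "g \<in> borel_measurable borel"
    and bdd: "\<And>x y. l < x \<Longrightarrow> x < u \<Longrightarrow> l' < y \<Longrightarrow> y < u' \<Longrightarrow> \<bar>g (x, y)\<bar> \<le> C"
    and bump: "\<And>p q p' q' n. l < p \<Longrightarrow> p < q \<Longrightarrow> q < u \<Longrightarrow> l' < p' \<Longrightarrow> p' < q' \<Longrightarrow> q' < u' \<Longrightarrow>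
      0 \<le> (LINT P|lborel. bump p q n (fst P) * bump p' q' n (snd P) * g P)"
  shows "AE P in lborel. l < fst P \<longrightarrow> fst P < u \<longrightarrow> l' < snd P \<longrightarrow> snd P < u' \<longrightarrow> 0 \<le> g P"
proof -
  have box: "box (a, a') (b, b') = {a<..<b} \<times> {a'<..<b'}" for a a' b b' :: real
    by (auto simp: box_def Basis_prod_def)
  have "AE P in lborel. P \<in> box (l, l') (u, u') \<longrightarrow> 0 \<le> g P"
  proof (rule AE_nonneg_if_box_integrals_nonneg)
    fix P Q assume PQ: "cbox P Q \<subseteq> box (l, l') (u, u')"
    obtain p p' q q' where P: "P = (p, p')" "Q = (q, q')" by force
    show "0 \<le> (LINT x:box P Q|lborel. g x)"
    proof (cases "p < q \<and> p' < q'")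
      case False
      then have "box P Q = {}" by (auto simp: P box)
      then show ?thesis by (simp add: set_lebesgue_integral_def)
    next
      case True
      then have pq: "p < q" "p' < q'" by auto
      have sub: "{p..q} \<times> {p'..q'} \<subseteq> {l<..<u} \<times> {l'<..<u'}"
        using PQ unfolding P box cbox_Pair_eq by simp
      moreover have "(p, p') \<in> {p..q} \<times> {p'..q'}" "(q, q') \<in> {p..q} \<times> {p'..q'}" using pq by auto
      ultimately have "(p, p') \<in> {l<..<u} \<times> {l'<..<u'}" "(q, q') \<in> {l<..<u} \<times> {l'<..<u'}" by blast+
      then have lu: "l < p" "q < u" "l' < p'" "q' < u'" by auto
      let ?B = "{p..q} \<times> {p'..q'}"
      have "(\<lambda>n. LINT x:?B|lborel. bump p q n (fst x) * bump p' q' n (snd x) * g x)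
         \<longlonglongrightarrow> (LINT x:?B|lborel. indicator {p<..<q} (fst x) * indicator {p'<..<q'} (snd x) * g x)"
      proof (rule set_integral_tendsto_bounded)
        fix n x assume x: "x \<in> ?B"
        then have "\<bar>g x\<bar> \<le> C" using lu bdd[of "fst x" "snd x"] by (auto simp: mem_Times_iff)
        then show "\<bar>bump p q n (fst x) * bump p' q' n (snd x) * g x\<bar> \<le> (1 * 1) * C"
          unfolding abs_mult using bump_bounds by (intro mult_mono) auto
      next
        show "AE x in lborel. x \<in> ?B \<longrightarrow> (\<lambda>n. bump p q n (fst x) * bump p' q' n (snd x) * g x)
           \<longlonglongrightarrow> indicator {p<..<q} (fst x) * indicator {p'<..<q'} (snd x) * g x"
          by (intro always_eventually allI impI tendsto_intros bump_tendsto)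
      qed auto
      moreover have "(LINT x:?B|lborel. bump p q n (fst x) * bump p' q' n (snd x) * g x)
          = (LINT x|lborel. bump p q n (fst x) * bump p' q' n (snd x) * g x)" for n
        unfolding set_lebesgue_integral_def
        by (rule Bochner_Integration.integral_cong) (auto simp: indicator_def mem_Times_iff dest: bump_support)
      moreover have "(LINT x:?B|lborel. indicator {p<..<q} (fst x) * indicator {p'<..<q'} (snd x) * g x)
          = (LINT x:box P Q|lborel. g x)"
        unfolding set_lebesgue_integral_def P box
        by (rule Bochner_Integration.integral_cong) (auto simp: indicator_def mem_Times_iff)
      ultimately show ?thesis
        using bump[OF lu(1) pq(1) lu(2,3) pq(2) lu(4)] by (auto intro: LIMSEQ_le_const)
    qed
  next
    show "\<bar>g P\<bar> \<le> C" if "P \<in> box (l, l') (u, u')" for P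
      using that bdd[of "fst P" "snd P"] unfolding box by (auto simp: mem_Times_iff)
  qed auto
  then show ?thesis by eventually_elim (auto simp: box mem_Times_iff)
qed

section \<open>Flux functions\<close>

text \<open>The branches meet because \<open>v \<sigma>\<close> is the capacity. Written this way,
  the flux is a sum of Lipschitz functions of \<open>min d \<sigma>\<close> and
  \<open>max 0 (d - \<sigma>)\<close>, which themselves have Lipschitz constant 1.\<close>

lemma flux_eq:
  assumes "valid_road r"
  shows "flux r d = vfree r * min d (crit_density r) + curv r * (max 0 (d - crit_density r))\<^sup>2"
  using assms by (auto simp: flux_def crit_density_def valid_road_def min_def max_def)

lemma crit_density_pos: "valid_road r \<Longrightarrow> 0 < crit_density r"
  by (simp add: crit_density_def valid_road_def)

lemma flux_crit: "valid_road r \<Longrightarrow> flux r (crit_density r) = fcap r"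
  by (simp add: flux_def crit_density_def valid_road_def)

lemma flux_zero: "valid_road r \<Longrightarrow> flux r 0 = 0"
  using crit_density_pos[of r] by (simp add: flux_def)

lemma curv_neg: "valid_road r \<Longrightarrow> curv r < 0"
  by (auto simp: curv_def valid_road_def field_simps)

lemma flux_lanes: "valid_road r \<Longrightarrow> flux r (lanes r) = 0"
  by (auto simp: flux_def curv_def valid_road_def)

lemma flux_less_fcap: "valid_road r \<Longrightarrow> crit_density r < d \<Longrightarrow> flux r d < fcap r"
  using curv_neg[of r] by (auto simp: flux_def mult_neg_pos)

lemma flux_nonneg:
  assumes r: "valid_road r" and d: "d \<in> {0..lanes r}"
  shows "0 \<le> flux r d"
proof (cases "d \<le> crit_density r")
  case True
  then show ?thesis using r d by (auto simp: flux_def valid_road_def)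
next
  case False
  have "(d - crit_density r)\<^sup>2 \<le> (lanes r - crit_density r)\<^sup>2"
    using False d by (intro power_mono) auto
  then have "curv r * (lanes r - crit_density r)\<^sup>2 \<le> curv r * (d - crit_density r)\<^sup>2"
    using curv_neg[OF r] by (intro mult_left_mono_neg) auto
  then show ?thesis using False flux_lanes[OF r] r by (auto simp: flux_def valid_road_def)
qed

lemma flux_le_fcap: "valid_road r \<Longrightarrow> flux r d \<le> fcap r"
  using flux_less_fcap[of r d] flux_crit[of r]
  by (cases "d \<le> crit_density r") (auto simp: flux_def crit_density_def valid_road_def field_simps)

lemma flux_lipschitz:
  assumes r: "valid_road r"
  obtains C where "0 \<le> C" "\<And>x y. x \<in> {0..lanes r} \<Longrightarrow> y \<in> {0..lanes r} \<Longrightarrow> \<bar>flux r x - flux r y\<bar> \<le> C * \<bar>x - y\<bar>"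
proof
  let ?s = "crit_density r" and ?n = "lanes r"
  \<comment> \<open>The first summand is the slope of the free branch. The second bounds the
    congested one through \<open>X\<^sup>2 - Y\<^sup>2 = (X + Y) * (X - Y)\<close> with
    \<open>X + Y\<close> at most twice the number of lanes.\<close>
  show "0 \<le> vfree r + \<bar>curv r\<bar> * (2 * ?n)"
    using r crit_density_pos[OF r] by (auto simp: valid_road_def intro!: add_nonneg_nonneg)
  fix x y assume xy: "x \<in> {0..?n}" "y \<in> {0..?n}"
  define X Y where "X = max 0 (x - ?s)" and "Y = max 0 (y - ?s)"
  have XY: "0 \<le> X" "X \<le> ?n" "0 \<le> Y" "Y \<le> ?n"
    using xy crit_density_pos[OF r] by (auto simp: X_def Y_def)
  have lip: "\<bar>max 0 (u - s) - max 0 (w - s)\<bar> \<le> \<bar>u - w\<bar>" "\<bar>min u s - min w s\<bar> \<le> \<bar>u - w\<bar>" for u w s :: real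
    by linarith+
  have "\<bar>vfree r * min x ?s - vfree r * min y ?s\<bar> = vfree r * \<bar>min x ?s - min y ?s\<bar>"
    using r by (simp add: valid_road_def abs_mult flip: right_diff_distrib)
  also have "\<dots> \<le> vfree r * \<bar>x - y\<bar>"
    using r lip(2) by (intro mult_left_mono) (simp_all add: valid_road_def)
  finally have 1: "\<bar>vfree r * min x ?s - vfree r * min y ?s\<bar> \<le> vfree r * \<bar>x - y\<bar>" .
  have "\<bar>curv r * X\<^sup>2 - curv r * Y\<^sup>2\<bar> = \<bar>curv r\<bar> * ((X + Y) * \<bar>X - Y\<bar>)"
  proof -
    have "curv r * X\<^sup>2 - curv r * Y\<^sup>2 = curv r * ((X + Y) * (X - Y))"
      by (simp add: power2_eq_square algebra_simps)
    then show ?thesis using XY by (simp add: abs_mult)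
  qed
  also have "\<dots> \<le> \<bar>curv r\<bar> * ((2 * ?n) * \<bar>x - y\<bar>)"
    using XY lip(1)[of x ?s y] unfolding X_def[symmetric] Y_def[symmetric]
    by (intro mult_left_mono mult_mono) linarith+
  finally have 2: "\<bar>curv r * X\<^sup>2 - curv r * Y\<^sup>2\<bar> \<le> \<bar>curv r\<bar> * (2 * ?n) * \<bar>x - y\<bar>"
    by (simp add: mult.assoc)
  show "\<bar>flux r x - flux r y\<bar> \<le> (vfree r + \<bar>curv r\<bar> * (2 * ?n)) * \<bar>x - y\<bar>"
  proof -
    have "flux r x - flux r y = (vfree r * min x ?s - vfree r * min y ?s) + (curv r * X\<^sup>2 - curv r * Y\<^sup>2)"
      unfolding flux_eq[OF r] X_def Y_def by linarith
    then show ?thesis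
      using add_mono[OF 1 2] abs_triangle_ineq unfolding distrib_right by (metis order_trans)
  qed
qed

lemma measurable_flux [measurable]: "flux r \<in> borel_measurable borel"
  unfolding flux_def[abs_def] by measurable

definition kruzhkov_flux :: "road \<Rightarrow> real \<Rightarrow> real \<Rightarrow> real" where
  "kruzhkov_flux r k d = sgn (d - k) * (flux r d - flux r k)"

lemma measurable_kruzhkov_flux [measurable]: "kruzhkov_flux r k \<in> borel_measurable borel"
  unfolding kruzhkov_flux_def[abs_def] sgn_real_def by measurable

text \<open>The jump of the sign at \<open>k\<close> is harmless because the other factor vanishes
  there. For points on opposite sides of \<open>k\<close> the two distances to \<open>k\<close> add
  up to \<open>\<bar>x - y\<bar>\<close>; on the same side the sign is a common factor.\<close>

lemma kruzhkov_flux_lipschitz: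
  assumes C: "\<And>x y. x \<in> {0..lanes r} \<Longrightarrow> y \<in> {0..lanes r} \<Longrightarrow> \<bar>flux r x - flux r y\<bar> \<le> C * \<bar>x - y\<bar>"
    and k: "k \<in> {0..lanes r}" and x: "x \<in> {0..lanes r}" and y: "y \<in> {0..lanes r}"
  shows "\<bar>kruzhkov_flux r k x - kruzhkov_flux r k y\<bar> \<le> C * \<bar>x - y\<bar>"
proof -
  have xk: "\<bar>flux r x - flux r k\<bar> \<le> C * \<bar>x - k\<bar>" and yk: "\<bar>flux r y - flux r k\<bar> \<le> C * \<bar>y - k\<bar>"
    and xy: "\<bar>flux r x - flux r y\<bar> \<le> C * \<bar>x - y\<bar>"
    using C k x y by auto
  have add: "C * \<bar>x - k\<bar> + C * \<bar>y - k\<bar> = C * \<bar>x - y\<bar>" if "(x - k) * (y - k) \<le> 0"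
  proof -
    have "\<bar>x - k\<bar> + \<bar>y - k\<bar> = \<bar>x - y\<bar>" using that by (auto simp: mult_le_0_iff)
    then show ?thesis by (metis distrib_left)
  qed
  show ?thesis
  proof (cases "(x - k) * (y - k) \<le> 0")
    case True
    have "\<bar>kruzhkov_flux r k d\<bar> \<le> \<bar>flux r d - flux r k\<bar>" for d
      by (auto simp: kruzhkov_flux_def abs_mult sgn_real_def)
    from this[of x] this[of y] show ?thesis using add[OF True] xk yk by linarith
  next
    case False
    then have "sgn (x - k) = sgn (y - k) \<and> \<bar>sgn (y - k)\<bar> = 1"
      by (auto simp: not_le zero_less_mult_iff sgn_real_def)
    then have "kruzhkov_flux r k x - kruzhkov_flux r k y = sgn (y - k) * (flux r x - flux r y)"
      by (simp add: kruzhkov_flux_def algebra_simps)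
    then show ?thesis using xy \<open>_ \<and> \<bar>sgn (y - k)\<bar> = 1\<close> by (simp add: abs_mult)
  qed
qed

section \<open>The entropy inequality with boundary terms\<close>

text \<open>The kernel has integral 1, is at most \<open>2 / h i\<close> and lives on
  \<open>[h i, 2 * h i]\<close>, so it is an approximate delta at the start of the road that
  vanishes near the start itself. The distance to the limit is controlled by the averaged trace
  condition and by the variation of \<open>\<phi>\<close> over a thin strip.\<close>

lemma trace_limit:
  fixes R :: "real \<Rightarrow> real \<Rightarrow> real" and a q :: "real \<Rightarrow> real"
  assumes T: "0 \<le> T"
    and Rm: "(\<lambda>(t, x). R t x) \<in> borel_measurable borel"
    and Rn: "\<And>t x. t \<in> {0..T} \<Longrightarrow> x \<in> {0..L} \<Longrightarrow> R t x \<in> {0..n}"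
    and am[measurable]: "a \<in> borel_measurable borel" and an: "\<And>t. t \<in> {0..T} \<Longrightarrow> a t \<in> {0..n}"
    and tr: "((\<lambda>h. (LINT p:{0..T} \<times> {0..h}|lborel. (case p of (t, x) \<Rightarrow> \<bar>R t x - a t\<bar>)) / h) \<longlongrightarrow> 0) (at_right 0)"
    and qm[measurable]: "q \<in> borel_measurable borel"
    and lip: "\<And>x y. x \<in> {0..n} \<Longrightarrow> y \<in> {0..n} \<Longrightarrow> \<bar>q x - q y\<bar> \<le> C * \<bar>x - y\<bar>"
    and qb: "\<And>x. x \<in> {0..n} \<Longrightarrow> \<bar>q x\<bar> \<le> Q"
    and phm: "(\<lambda>(t, x). \<phi> t x) \<in> borel_measurable borel"
    and phb: "\<And>t x. t \<in> {0..T} \<Longrightarrow> x \<in> {0..L} \<Longrightarrow> \<bar>\<phi> t x\<bar> \<le> M"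
    and phd: "\<And>t x. t \<in> {0..T} \<Longrightarrow> x \<in> {0..L} \<Longrightarrow> \<bar>\<phi> t x - \<phi> t 0\<bar> \<le> D * x"
    and h: "\<And>i. 0 < h i" "\<And>i. 2 * h i \<le> L" "h \<longlonglongrightarrow> 0"
  shows "(\<lambda>i. LINT p:{0..T} \<times> {0..L}|lborel.
            q (R (fst p) (snd p)) * \<phi> (fst p) (snd p) * (smoothstep_deriv (snd p / h i - 1) / h i))
          \<longlonglongrightarrow> (LINT t:{0..T}|lborel. q (a t) * \<phi> t 0)"
proof -
  have L: "0 < L" using h(1)[of 0] h(2)[of 0] by linarith
  \<comment> \<open>The constants \<open>C\<close> and \<open>D\<close> come without a sign;
    monotonicity of products needs nonnegative ones.\<close>
  define C' where "C' = max 0 C"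
  define D' where "D' = max 0 D"
  define I where "I = (\<lambda>h. LINT p:{0..T} \<times> {0..h}|lborel. (case p of (t, x) \<Rightarrow> \<bar>R t x - a t\<bar>))"
  note [measurable] = measurable_Pair_curry[OF Rm] measurable_Pair_curry[OF phm]
  have [measurable]: "(\<lambda>t. \<phi> t 0) \<in> borel_measurable borel" by measurable
  have M0: "0 \<le> M" using phb[of 0 0] T L by force
  have n0: "0 \<le> n" using Rn[of 0 0] T L by force
  have Q0: "0 \<le> Q" using qb[of 0] n0 by force
  \<comment> \<open>The kernel is at most \<open>2 / h i\<close> on a strip of area
    \<open>2 * T * h i\<close>. The trace part gives \<open>(2 / h i) * I (2 * h i)\<close>, here
    rewritten as an average over the width \<open>2 * h i\<close>; the variation of
    \<open>\<phi>\<close> is at most \<open>D' * (2 * h i)\<close> on the strip and gives the second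
    summand.\<close>
  have bound: "\<bar>(LINT p:{0..T} \<times> {0..L}|lborel.
            q (R (fst p) (snd p)) * \<phi> (fst p) (snd p) * (smoothstep_deriv (snd p / h i - 1) / h i))
        - (LINT t:{0..T}|lborel. q (a t) * \<phi> t 0)\<bar>
        \<le> 4 * C' * M * (I (2 * h i) / (2 * h i)) + 8 * Q * D' * T * h i" for i
  proof -
    define k where "k = (\<lambda>x. smoothstep_deriv (x / h i - 1) / h i)"
    have hi: "0 < h i" "2 * h i \<le> L" using h by auto
    have kb: "0 \<le> k x" "k x \<le> 2 / h i" for x
      using smoothstep_deriv_bounds[of "x / h i - 1"] hi by (auto simp: k_def divide_right_mono)
    define K where "K = 2 / h i"
    have kK: "0 \<le> k x" "k x \<le> K" for x using kb by (auto simp: K_def)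
    have k0: "k x = 0" if "2 * h i < x" for x
    proof -
      have "1 \<le> x / h i - 1" using that hi by (simp add: field_simps)
      then show ?thesis by (simp add: k_def smoothstep_deriv_eq_0)
    qed
    have kc: "continuous_on UNIV k" unfolding k_def using hi by (intro continuous_intros) auto
    then have [measurable]: "k \<in> borel_measurable borel" by (rule borel_measurable_continuous_onI)
    have k1: "(LINT x:{0..L}|lborel. k x) = 1"
    proof -
      have "(LINT x:{0..L}|lborel. k x) = smoothstep (L / h i - 1) - smoothstep (0 / h i - 1)"
      proof (rule LINT_Icc_FTC)
        show "((\<lambda>x. smoothstep (x / h i - 1)) has_real_derivative k x) (at x)" for x
          unfolding k_def
          by (rule DERIV_cong[OF DERIV_chain2[OF DERIV_smoothstep]]) (use hi in \<open>auto intro!: derivative_eq_intros\<close>)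
      qed (use L kc in auto)
      moreover have "1 \<le> L / h i - 1" using hi by (simp add: field_simps)
      ultimately show ?thesis by (simp add: smoothstep_eq_0 smoothstep_eq_1)
    qed
    let ?B = "{0..T} \<times> {0..L}" and ?S = "{0..T} \<times> {0..2 * h i}"
    have S: "p \<in> ?B" if "p \<in> ?S" for p using that hi by auto
    have i1: "set_integrable lborel ?B (\<lambda>p. q (R (fst p) (snd p)) * \<phi> (fst p) (snd p) * k (snd p))"
      by (rule set_integrable_bounded[where C="Q * M * K"])
        (use qb Rn phb kK Q0 M0 in \<open>auto simp: abs_mult intro!: mult_mono\<close>)
    have i2: "set_integrable lborel ?B (\<lambda>p. q (a (fst p)) * \<phi> (fst p) 0 * k (snd p))"
      by (rule set_integrable_bounded[where C="Q * M * K"])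
        (use qb an phb kK Q0 M0 L in \<open>auto simp: abs_mult intro!: mult_mono\<close>)
    have "(LINT p:?B|lborel. q (a (fst p)) * \<phi> (fst p) 0 * k (snd p))
        = (LINT t:{0..T}|lborel. q (a t) * \<phi> t 0)"
      by (subst LINT_Times[OF i2]) (simp add: k1)
    then have e1: "(LINT p:?B|lborel. q (R (fst p) (snd p)) * \<phi> (fst p) (snd p) * k (snd p))
        - (LINT t:{0..T}|lborel. q (a t) * \<phi> t 0)
        = (LINT p:?B|lborel. q (R (fst p) (snd p)) * \<phi> (fst p) (snd p) * k (snd p) - q (a (fst p)) * \<phi> (fst p) 0 * k (snd p))"
      using i1 i2 by (simp add: set_integral_diff)
    have e2: "(LINT p:?B|lborel. q (R (fst p) (snd p)) * \<phi> (fst p) (snd p) * k (snd p) - q (a (fst p)) * \<phi> (fst p) 0 * k (snd p))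
      = (LINT p:?S|lborel. q (R (fst p) (snd p)) * \<phi> (fst p) (snd p) * k (snd p) - q (a (fst p)) * \<phi> (fst p) 0 * k (snd p))"
      unfolding set_lebesgue_integral_def
      by (rule Bochner_Integration.integral_cong) (use hi k0 in \<open>auto simp: indicator_def not_less[symmetric]\<close>)
    have e3: "\<bar>LINT p:?S|lborel. q (R (fst p) (snd p)) * \<phi> (fst p) (snd p) * k (snd p) - q (a (fst p)) * \<phi> (fst p) 0 * k (snd p)\<bar>
      \<le> (LINT p:?S|lborel. (2 / h i) * (C' * M * \<bar>R (fst p) (snd p) - a (fst p)\<bar> + Q * D' * (2 * h i)))"
    proof (rule set_integral_abs_le)
      show "set_integrable lborel ?S (\<lambda>p. q (R (fst p) (snd p)) * \<phi> (fst p) (snd p) * k (snd p) - q (a (fst p)) * \<phi> (fst p) 0 * k (snd p))"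
        by (rule set_integral_diff set_integrable_subset[OF i1] set_integrable_subset[OF i2]; use S in auto)+
      show "set_integrable lborel ?S (\<lambda>p. (2 / h i) * (C' * M * \<bar>R (fst p) (snd p) - a (fst p)\<bar> + Q * D' * (2 * h i)))"
      proof (rule set_integrable_bounded[where C="(2 / h i) * (C' * M * n + Q * D' * (2 * h i))"])
        fix p assume p: "p \<in> ?S"
        have "R (fst p) (snd p) \<in> {0..n}" "a (fst p) \<in> {0..n}" using S[OF p] Rn an by auto
        then have "\<bar>R (fst p) (snd p) - a (fst p)\<bar> \<le> n" by auto
        then have "(2 / h i) * (C' * M * \<bar>R (fst p) (snd p) - a (fst p)\<bar> + Q * D' * (2 * h i)) \<le> (2 / h i) * (C' * M * n + Q * D' * (2 * h i))"
          using hi M0 by (intro mult_left_mono add_right_mono) (auto simp: C'_def)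
        moreover have "0 \<le> (2 / h i) * (C' * M * \<bar>R (fst p) (snd p) - a (fst p)\<bar> + Q * D' * (2 * h i))"
          using hi M0 Q0 by (auto simp: C'_def D'_def)
        ultimately show "\<bar>(2 / h i) * (C' * M * \<bar>R (fst p) (snd p) - a (fst p)\<bar> + Q * D' * (2 * h i))\<bar> \<le> (2 / h i) * (C' * M * n + Q * D' * (2 * h i))"
          by linarith
      qed auto
      fix p assume p: "p \<in> ?S"
      obtain t x where tx: "p = (t, x)" by force
      have t: "t \<in> {0..T}" and x: "x \<in> {0..L}" "x \<le> 2 * h i" "0 \<le> x" using S[OF p] p tx by auto
      have "\<bar>q (R t x) * \<phi> t x - q (a t) * \<phi> t 0\<bar> = \<bar>(q (R t x) - q (a t)) * \<phi> t x + q (a t) * (\<phi> t x - \<phi> t 0)\<bar>"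
        by (simp add: algebra_simps)
      also have "\<dots> \<le> \<bar>q (R t x) - q (a t)\<bar> * \<bar>\<phi> t x\<bar> + \<bar>q (a t)\<bar> * \<bar>\<phi> t x - \<phi> t 0\<bar>"
        by (metis abs_mult abs_triangle_ineq)
      also have "\<dots> \<le> (C' * \<bar>R t x - a t\<bar>) * M + Q * (D' * (2 * h i))"
      proof (intro add_mono mult_mono)
        show "\<bar>q (R t x) - q (a t)\<bar> \<le> C' * \<bar>R t x - a t\<bar>"
          using lip[of "R t x" "a t"] Rn[OF t x(1)] an[OF t] mult_right_mono[of C C' "\<bar>R t x - a t\<bar>"]
          unfolding C'_def by fastforce
        show "\<bar>\<phi> t x - \<phi> t 0\<bar> \<le> D' * (2 * h i)"
        proof -
          have "D * x \<le> D' * (2 * h i)" using x hi unfolding D'_def by (intro mult_mono) auto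
          then show ?thesis using phd[OF t x(1)] by linarith
        qed
      qed (use phb t x qb an C'_def Q0 in auto)
      finally have *: "\<bar>q (R t x) * \<phi> t x - q (a t) * \<phi> t 0\<bar> \<le> C' * M * \<bar>R t x - a t\<bar> + Q * D' * (2 * h i)"
        by (simp add: mult_ac)
      have "\<bar>q (R t x) * \<phi> t x * k x - q (a t) * \<phi> t 0 * k x\<bar> = k x * \<bar>q (R t x) * \<phi> t x - q (a t) * \<phi> t 0\<bar>"
      proof -
        have "q (R t x) * \<phi> t x * k x - q (a t) * \<phi> t 0 * k x = k x * (q (R t x) * \<phi> t x - q (a t) * \<phi> t 0)"
          by (simp add: algebra_simps)
        then show ?thesis using kb(1)[of x] by (simp add: abs_mult)
      qed
      also have "\<dots> \<le> (2 / h i) * (C' * M * \<bar>R t x - a t\<bar> + Q * D' * (2 * h i))"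
        using * kb[of x] hi by (intro mult_mono) auto
      finally show "\<bar>q (R (fst p) (snd p)) * \<phi> (fst p) (snd p) * k (snd p) - q (a (fst p)) * \<phi> (fst p) 0 * k (snd p)\<bar>
          \<le> (2 / h i) * (C' * M * \<bar>R (fst p) (snd p) - a (fst p)\<bar> + Q * D' * (2 * h i))"
        by (simp add: tx)
    qed
    have e4: "(LINT p:?S|lborel. (2 / h i) * (C' * M * \<bar>R (fst p) (snd p) - a (fst p)\<bar> + Q * D' * (2 * h i)))
      = (2 / h i) * (C' * M * I (2 * h i) + (LINT p:?S|lborel. Q * D' * (2 * h i)))"
    proof -
      have 1: "set_integrable lborel ?S (\<lambda>p. \<bar>R (fst p) (snd p) - a (fst p)\<bar>)"
      proof (rule set_integrable_bounded[where C=n])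
        fix p assume p: "p \<in> ?S"
        have "R (fst p) (snd p) \<in> {0..n}" "a (fst p) \<in> {0..n}" using S[OF p] Rn an by auto
        then show "\<bar>\<bar>R (fst p) (snd p) - a (fst p)\<bar>\<bar> \<le> n" by auto
      qed simp_all
      have 2: "set_integrable lborel ?S (\<lambda>p. Q * D' * (2 * h i))"
        by (rule set_integrable_bounded[where C="\<bar>Q * D' * (2 * h i)\<bar>"]) simp_all
      have 3: "(LINT p:?S|lborel. \<bar>R (fst p) (snd p) - a (fst p)\<bar>) = I (2 * h i)"
        unfolding I_def case_prod_unfold ..
      show ?thesis
        unfolding set_integral_mult_right
        by (subst set_integral_add(2)[OF set_integrable_mult_right[OF 1] 2])
          (simp only: set_integral_mult_right 3)
    qed
    have e5: "(LINT p:?S|lborel. Q * D' * (2 * h i)) = Q * D' * (2 * h i) * (T * (2 * h i))"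
    proof -
      have "set_integrable lborel ?S (\<lambda>p. Q * D' * (2 * h i))"
        by (rule set_integrable_bounded[where C="\<bar>Q * D' * (2 * h i)\<bar>"]) auto
      from LINT_Times[OF this] show ?thesis using T hi by (simp add: set_lebesgue_integral_def)
    qed
    have e6: "(2 / h i) * (C' * M * I (2 * h i) + Q * D' * (2 * h i) * (T * (2 * h i)))
        = 4 * C' * M * (I (2 * h i) / (2 * h i)) + 8 * Q * D' * T * h i"
    proof -
      have "2 / y * (c * X + d * (2 * y) * (T * (2 * y))) = 4 * c * (X / (2 * y)) + 8 * d * T * y"
        if "0 < y" for y c d X :: real
        using that by (simp add: distrib_left)
      from this[OF hi(1), of "C' * M" "I (2 * h i)" "Q * D'"] show ?thesis by (simp only: mult.assoc)
    qed
    show ?thesis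
      using e3 unfolding e4 e5 e6 e2[symmetric] e1[symmetric] unfolding k_def .
  qed
  have "(\<lambda>i. I (2 * h i) / (2 * h i)) \<longlonglongrightarrow> 0"
  proof -
    have "((\<lambda>h. I h / h) \<longlongrightarrow> 0) (at_right 0)" using tr by (simp add: I_def)
    moreover have "filterlim (\<lambda>i. 2 * h i) (at_right 0) sequentially"
      by (rule tendsto_imp_filterlim_at_right) (use tendsto_mult_left[OF h(3), of 2] h in auto)
    ultimately show ?thesis by (rule filterlim_compose)
  qed
  then have "(\<lambda>i. 4 * C' * M * (I (2 * h i) / (2 * h i)) + 8 * Q * D' * T * h i) \<longlonglongrightarrow> 4 * C' * M * 0 + 8 * Q * D' * T * 0"
    by (intro tendsto_intros h)
  then have lim0: "(\<lambda>i. 4 * C' * M * (I (2 * h i) / (2 * h i)) + 8 * Q * D' * T * h i) \<longlonglongrightarrow> 0" by simp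
  show ?thesis
    by (rule LIM_zero_cancel, rule Lim_null_comparison[OF _ lim0]) (use bound in auto)
qed

text \<open>Derivatives exist on the whole plane, which avoids one-sided derivatives at the ends.
  Sign and vanishing are demanded on the road only: a function of \<open>t - x / v\<close> that
  vanishes for large arguments is zero at late times only for bounded \<open>x\<close>.\<close>

definition boundary_test ::
  "real \<Rightarrow> real \<Rightarrow> (real \<Rightarrow> real \<Rightarrow> real) \<Rightarrow> (real \<Rightarrow> real \<Rightarrow> real) \<Rightarrow> (real \<Rightarrow> real \<Rightarrow> real) \<Rightarrow> bool"
where
  "boundary_test T L \<phi> \<phi>t \<phi>x \<longleftrightarrow>
     (\<forall>t x. 0 \<le> x \<longrightarrow> x \<le> L \<longrightarrow> 0 \<le> \<phi> t x) \<and>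
     (\<forall>t x. ((\<lambda>s. \<phi> s x) has_real_derivative \<phi>t t x) (at t)) \<and>
     (\<forall>t x. ((\<lambda>y. \<phi> t y) has_real_derivative \<phi>x t x) (at x)) \<and>
     continuous_on UNIV (\<lambda>(t, x). \<phi> t x) \<and>
     continuous_on UNIV (\<lambda>(t, x). \<phi>t t x) \<and>
     continuous_on UNIV (\<lambda>(t, x). \<phi>x t x) \<and>
     (\<exists>d<T. \<forall>t x. d \<le> t \<longrightarrow> 0 \<le> x \<longrightarrow> x \<le> L \<longrightarrow> \<phi> t x = 0)"

lemma boundary_test_bounds:
  fixes \<phi> :: "real \<Rightarrow> real \<Rightarrow> real"
  assumes \<phi>: "boundary_test T L \<phi> \<phi>t \<phi>x"
  obtains M where
    "\<And>t x. t \<in> {0..T} \<Longrightarrow> x \<in> {0..L} \<Longrightarrow> \<bar>\<phi> t x\<bar> \<le> M"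
    "\<And>t x. t \<in> {0..T} \<Longrightarrow> x \<in> {0..L} \<Longrightarrow> \<bar>\<phi>t t x\<bar> \<le> M"
    "\<And>t x. t \<in> {0..T} \<Longrightarrow> x \<in> {0..L} \<Longrightarrow> \<bar>\<phi>x t x\<bar> \<le> M"
    "\<And>t x y. t \<in> {0..T} \<Longrightarrow> x \<in> {0..L} \<Longrightarrow> y \<in> {0..L} \<Longrightarrow> \<bar>\<phi> t x - \<phi> t y\<bar> \<le> M * \<bar>x - y\<bar>"
proof -
  obtain M1 where M1: "\<And>t x. t \<in> {0..T} \<Longrightarrow> x \<in> {0..L} \<Longrightarrow> \<bar>\<phi> t x\<bar> \<le> M1"
    using continuous_bounded_Times[of \<phi>] \<phi> unfolding boundary_test_def by metis
  obtain M2 where M2: "\<And>t x. t \<in> {0..T} \<Longrightarrow> x \<in> {0..L} \<Longrightarrow> \<bar>\<phi>t t x\<bar> \<le> M2"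
    using continuous_bounded_Times[of \<phi>t] \<phi> unfolding boundary_test_def by metis
  obtain M3 where M3: "\<And>t x. t \<in> {0..T} \<Longrightarrow> x \<in> {0..L} \<Longrightarrow> \<bar>\<phi>x t x\<bar> \<le> M3"
    using continuous_bounded_Times[of \<phi>x] \<phi> unfolding boundary_test_def by metis
  define M where "M = max M1 (max M2 M3)"
  show ?thesis
  proof (rule that[of M])
    fix t x y assume t: "t \<in> {0..T}" and xy: "x \<in> {0..L}" "y \<in> {0..L}"
    have "norm (\<phi> t x - \<phi> t y) \<le> M * norm (x - y)"
    proof (rule field_differentiable_bound[of "{0..L}" "\<phi> t" "\<phi>x t"])
      show "(\<phi> t has_field_derivative \<phi>x t z) (at z within {0..L})" if "z \<in> {0..L}" for z
        using \<phi> unfolding boundary_test_def by (blast intro: has_field_derivative_at_within)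
      show "norm (\<phi>x t z) \<le> M" if "z \<in> {0..L}" for z
        using M3[OF t that] by (simp add: M_def)
    qed (use xy in auto)
    then show "\<bar>\<phi> t x - \<phi> t y\<bar> \<le> M * \<bar>x - y\<bar>" by simp
  next
    fix t x assume tx: "t \<in> {0..T}" "x \<in> {0..L}"
    show "\<bar>\<phi> t x\<bar> \<le> M" using M1[OF tx] by (simp add: M_def)
    show "\<bar>\<phi>t t x\<bar> \<le> M" using M2[OF tx] by (simp add: M_def)
    show "\<bar>\<phi>x t x\<bar> \<le> M" using M3[OF tx] by (simp add: M_def)
  qed
qed

text \<open>The entropy functional for test functions that need not vanish at the ends of the road; the
  traces then contribute boundary terms.\<close>

definition balance ::
  "road \<Rightarrow> real \<Rightarrow> (real \<Rightarrow> real \<Rightarrow> real) \<Rightarrow> (real \<Rightarrow> real) \<Rightarrow> (real \<Rightarrow> real) \<Rightarrow> real \<Rightarrow>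
   (real \<Rightarrow> real \<Rightarrow> real) \<Rightarrow> (real \<Rightarrow> real \<Rightarrow> real) \<Rightarrow> (real \<Rightarrow> real \<Rightarrow> real) \<Rightarrow>
   (real \<Rightarrow> real) \<Rightarrow> (real \<Rightarrow> real) \<Rightarrow> real"
where
  "balance r T \<rho> a b c \<phi> \<phi>t \<phi>x \<eta> q =
     (LINT p:{0..T} \<times> {0..len r}|lborel.
        \<eta> (\<rho> (fst p) (snd p)) * \<phi>t (fst p) (snd p) + q (\<rho> (fst p) (snd p)) * \<phi>x (fst p) (snd p))
     + (LINT x:{0..len r}|lborel. \<eta> c * \<phi> 0 x)
     + (LINT t:{0..T}|lborel. q (a t) * \<phi> t 0)
     - (LINT t:{0..T}|lborel. q (b t) * \<phi> t (len r))"

text \<open>Used for roads 2, 3 and 4 with \<open>c = \<rho>init\<close> and for road 5 with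
  \<open>c = 0\<close>.\<close>

locale traced_solution =
  fixes r :: road and T :: real and \<rho> :: "real \<Rightarrow> real \<Rightarrow> real" and a b :: "real \<Rightarrow> real" and c :: real
  assumes road: "valid_road r" and T: "0 < T" and c: "c \<in> {0..lanes r}"
    and solution: "entropy_solution r T (\<lambda>x. c) \<rho>"
    and start: "trace_start r T \<rho> a" and final: "trace_end r T \<rho> b"
begin

lemma density_range: "t \<in> {0..T} \<Longrightarrow> x \<in> {0..len r} \<Longrightarrow> \<rho> t x \<in> {0..lanes r}"
  using solution by (simp add: entropy_solution_def)

lemma trace_range: "t \<in> {0..T} \<Longrightarrow> a t \<in> {0..lanes r}" "t \<in> {0..T} \<Longrightarrow> b t \<in> {0..lanes r}"
  using start final by (simp_all add: trace_start_def trace_end_def)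

lemma density_measurable: "(\<lambda>(t, x). \<rho> t x) \<in> borel_measurable borel"
  using solution by (simp add: entropy_solution_def)

lemmas density_measurable_curry [measurable] = measurable_Pair_curry[OF density_measurable]

lemma trace_measurable [measurable]: "a \<in> borel_measurable borel" "b \<in> borel_measurable borel"
  using start final by (simp_all add: trace_start_def trace_end_def)

lemma len_pos: "0 < len r"
  using road by (simp add: valid_road_def)

abbreviation "bal \<equiv> balance r T \<rho> a b c"

lemma balance_integrable:
  assumes \<phi>: "boundary_test T (len r) \<phi> \<phi>t \<phi>x"
    and m[measurable]: "\<eta> \<in> borel_measurable borel" "q \<in> borel_measurable borel"
    and bdd: "\<forall>d\<in>{0..lanes r}. \<bar>\<eta> d\<bar> \<le> B" "\<forall>d\<in>{0..lanes r}. \<bar>q d\<bar> \<le> B"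
  shows "set_integrable lborel ({0..T} \<times> {0..len r}) (\<lambda>p. \<eta> (\<rho> (fst p) (snd p)) * \<phi>t (fst p) (snd p))"
    and "set_integrable lborel ({0..T} \<times> {0..len r}) (\<lambda>p. q (\<rho> (fst p) (snd p)) * \<phi>x (fst p) (snd p))"
    and "set_integrable lborel {0..len r} (\<lambda>x. \<eta> c * \<phi> 0 x)"
    and "set_integrable lborel {0..T} (\<lambda>t. q (a t) * \<phi> t 0)"
    and "set_integrable lborel {0..T} (\<lambda>t. q (b t) * \<phi> t (len r))"
proof -
  obtain M where M: "\<And>t x. t \<in> {0..T} \<Longrightarrow> x \<in> {0..len r} \<Longrightarrow> \<bar>\<phi> t x\<bar> \<le> M"
    "\<And>t x. t \<in> {0..T} \<Longrightarrow> x \<in> {0..len r} \<Longrightarrow> \<bar>\<phi>t t x\<bar> \<le> M"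
    "\<And>t x. t \<in> {0..T} \<Longrightarrow> x \<in> {0..len r} \<Longrightarrow> \<bar>\<phi>x t x\<bar> \<le> M"
    using boundary_test_bounds[OF \<phi>] by metis
  have cont: "continuous_on UNIV (\<lambda>(t, x). \<phi> t x)" "continuous_on UNIV (\<lambda>(t, x). \<phi>t t x)"
    "continuous_on UNIV (\<lambda>(t, x). \<phi>x t x)"
    using \<phi> by (auto simp: boundary_test_def)
  note [measurable] = cont[THEN borel_measurable_continuous_onI, THEN measurable_Pair_curry]
  have B0: "0 \<le> B" using bdd(1)[rule_format, OF c] by linarith
  have ab: "\<bar>u * v\<bar> \<le> B * M" if "\<bar>u\<bar> \<le> B" "\<bar>v\<bar> \<le> M" for u v
    unfolding abs_mult using that B0 by (intro mult_mono) auto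
  show "set_integrable lborel ({0..T} \<times> {0..len r}) (\<lambda>p. \<eta> (\<rho> (fst p) (snd p)) * \<phi>t (fst p) (snd p))"
    by (rule set_integrable_bounded[where C="B * M"]; (intro ab bdd[rule_format] density_range M)?)
      (auto simp: mem_Times_iff)
  show "set_integrable lborel ({0..T} \<times> {0..len r}) (\<lambda>p. q (\<rho> (fst p) (snd p)) * \<phi>x (fst p) (snd p))"
    by (rule set_integrable_bounded[where C="B * M"]; (intro ab bdd[rule_format] density_range M)?)
      (auto simp: mem_Times_iff)
  show "set_integrable lborel {0..len r} (\<lambda>x. \<eta> c * \<phi> 0 x)"
    by (rule set_integrable_bounded[where C="B * M"]; (intro ab bdd[rule_format] c M)?) (use T in auto)
  show "set_integrable lborel {0..T} (\<lambda>t. q (a t) * \<phi> t 0)"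
    by (rule set_integrable_bounded[where C="B * M"]; (intro ab bdd[rule_format] trace_range M)?) (use len_pos in auto)
  show "set_integrable lborel {0..T} (\<lambda>t. q (b t) * \<phi> t (len r))"
    by (rule set_integrable_bounded[where C="B * M"]; (intro ab bdd[rule_format] trace_range M)?) (use len_pos in auto)
qed

lemma balance_linear:
  assumes \<phi>: "boundary_test T (len r) \<phi> \<phi>t \<phi>x"
    and m: "\<eta>1 \<in> borel_measurable borel" "q1 \<in> borel_measurable borel"
      "\<eta>2 \<in> borel_measurable borel" "q2 \<in> borel_measurable borel"
    and bdd: "\<forall>d\<in>{0..lanes r}. \<bar>\<eta>1 d\<bar> \<le> B" "\<forall>d\<in>{0..lanes r}. \<bar>q1 d\<bar> \<le> B"
       "\<forall>d\<in>{0..lanes r}. \<bar>\<eta>2 d\<bar> \<le> B" "\<forall>d\<in>{0..lanes r}. \<bar>q2 d\<bar> \<le> B"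
  shows "bal \<phi> \<phi>t \<phi>x (\<lambda>d. u * \<eta>1 d + w * \<eta>2 d) (\<lambda>d. u * q1 d + w * q2 d)
     = u * bal \<phi> \<phi>t \<phi>x \<eta>1 q1 + w * bal \<phi> \<phi>t \<phi>x \<eta>2 q2"
proof -
  note i1 = balance_integrable[OF \<phi> m(1,2) bdd(1,2)]
  note i2 = balance_integrable[OF \<phi> m(3,4) bdd(3,4)]
  have lin: "(LINT x:A|lborel. u * f x + w * g x) = u * (LINT x:A|lborel. f x) + w * (LINT x:A|lborel. g x)"
    if "set_integrable lborel A f" "set_integrable lborel A g" for A and f g :: "'z::euclidean_space \<Rightarrow> real"
    using that by (subst set_integral_add(2)) simp_all
  have "(LINT p:{0..T} \<times> {0..len r}|lborel. (u * \<eta>1 (\<rho> (fst p) (snd p)) + w * \<eta>2 (\<rho> (fst p) (snd p))) * \<phi>t (fst p) (snd p)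
       + (u * q1 (\<rho> (fst p) (snd p)) + w * q2 (\<rho> (fst p) (snd p))) * \<phi>x (fst p) (snd p))
     = u * (LINT p:{0..T} \<times> {0..len r}|lborel. \<eta>1 (\<rho> (fst p) (snd p)) * \<phi>t (fst p) (snd p) + q1 (\<rho> (fst p) (snd p)) * \<phi>x (fst p) (snd p))
     + w * (LINT p:{0..T} \<times> {0..len r}|lborel. \<eta>2 (\<rho> (fst p) (snd p)) * \<phi>t (fst p) (snd p) + q2 (\<rho> (fst p) (snd p)) * \<phi>x (fst p) (snd p))"
    by (subst lin[OF set_integral_add(1)[OF i1(1,2)] set_integral_add(1)[OF i2(1,2)], symmetric])
      (intro set_lebesgue_integral_cong, simp_all add: algebra_simps)
  moreover have "(LINT x:{0..len r}|lborel. (u * \<eta>1 c + w * \<eta>2 c) * \<phi> 0 x)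
     = u * (LINT x:{0..len r}|lborel. \<eta>1 c * \<phi> 0 x) + w * (LINT x:{0..len r}|lborel. \<eta>2 c * \<phi> 0 x)"
    by (subst lin[OF i1(3) i2(3), symmetric]) (simp only: distrib_right mult.assoc)
  moreover have "(LINT t:{0..T}|lborel. (u * q1 (a t) + w * q2 (a t)) * \<phi> t 0)
     = u * (LINT t:{0..T}|lborel. q1 (a t) * \<phi> t 0) + w * (LINT t:{0..T}|lborel. q2 (a t) * \<phi> t 0)"
    by (subst lin[OF i1(4) i2(4), symmetric]) (simp only: distrib_right mult.assoc)
  moreover have "(LINT t:{0..T}|lborel. (u * q1 (b t) + w * q2 (b t)) * \<phi> t (len r))
     = u * (LINT t:{0..T}|lborel. q1 (b t) * \<phi> t (len r)) + w * (LINT t:{0..T}|lborel. q2 (b t) * \<phi> t (len r))"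
    by (subst lin[OF i1(5) i2(5), symmetric]) (simp only: distrib_right mult.assoc)
  ultimately show ?thesis unfolding balance_def by (simp add: algebra_simps)
qed

lemma balance_cong:
  assumes "\<And>d. d \<in> {0..lanes r} \<Longrightarrow> \<eta>1 d = \<eta>2 d" "\<And>d. d \<in> {0..lanes r} \<Longrightarrow> q1 d = q2 d"
  shows "bal \<phi> \<phi>t \<phi>x \<eta>1 q1 = bal \<phi> \<phi>t \<phi>x \<eta>2 q2"
proof -
  have "(LINT p:{0..T} \<times> {0..len r}|lborel. \<eta>1 (\<rho> (fst p) (snd p)) * \<phi>t (fst p) (snd p) + q1 (\<rho> (fst p) (snd p)) * \<phi>x (fst p) (snd p))
     = (LINT p:{0..T} \<times> {0..len r}|lborel. \<eta>2 (\<rho> (fst p) (snd p)) * \<phi>t (fst p) (snd p) + q2 (\<rho> (fst p) (snd p)) * \<phi>x (fst p) (snd p))"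
    using assms density_range by (intro set_lebesgue_integral_cong) (auto simp: mem_Times_iff)
  moreover have "(LINT t:{0..T}|lborel. q1 (a t) * \<phi> t 0) = (LINT t:{0..T}|lborel. q2 (a t) * \<phi> t 0)"
    "(LINT t:{0..T}|lborel. q1 (b t) * \<phi> t (len r)) = (LINT t:{0..T}|lborel. q2 (b t) * \<phi> t (len r))"
    using assms(2) trace_range by (intro set_lebesgue_integral_cong; auto)+
  ultimately show ?thesis using assms(1)[OF c] by (simp add: balance_def)
qed

text \<open>By the fundamental theorem of calculus in each variable, the interior integral cancels
  the initial and the boundary terms. Entropies and their fluxes therefore matter only up to
  additive constants.\<close>

lemma balance_const:
  assumes \<phi>: "boundary_test T (len r) \<phi> \<phi>t \<phi>x"
  shows "bal \<phi> \<phi>t \<phi>x (\<lambda>_. u) (\<lambda>_. w) = 0"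
proof -
  note i = balance_integrable[OF \<phi>, of "\<lambda>_. 1" "\<lambda>_. 1" 1, simplified]
  have c: "continuous_on UNIV (\<lambda>s. \<phi>t s x)" "continuous_on UNIV (\<lambda>x. \<phi>x s x)" for s x
    using \<phi> unfolding boundary_test_def
    by (auto intro: continuous_on_Pair_curry[of \<phi>t _ "\<lambda>s. s" "\<lambda>_. x"] continuous_on_Pair_curry[of \<phi>x _ "\<lambda>_. s" "\<lambda>x. x"] continuous_intros)
  have D: "((\<lambda>s. \<phi> s x) has_real_derivative \<phi>t s x) (at s)" "((\<lambda>x. \<phi> s x) has_real_derivative \<phi>x s x) (at x)" for s x
    using \<phi> by (auto simp: boundary_test_def)
  have z: "\<phi> T x = 0" if "x \<in> {0..len r}" for x
    using \<phi> that unfolding boundary_test_def by (meson atLeastAtMost_iff less_imp_le)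
  have "(LINT p:{0..T} \<times> {0..len r}|lborel. \<phi>t (fst p) (snd p)) = (LINT x:{0..len r}|lborel. LINT t:{0..T}|lborel. \<phi>t t x)"
    by (subst LINT_Times_swap[OF i(1)]) simp
  also have "\<dots> = (LINT x:{0..len r}|lborel. - \<phi> 0 x)"
    using T LINT_Icc_FTC[OF _ D(1) c(1), of 0 T] z by (intro set_lebesgue_integral_cong) auto
  finally have t: "(LINT p:{0..T} \<times> {0..len r}|lborel. \<phi>t (fst p) (snd p)) = - (LINT x:{0..len r}|lborel. \<phi> 0 x)"
    using i(3) by (simp add: set_integral_uminus)
  have "(LINT p:{0..T} \<times> {0..len r}|lborel. \<phi>x (fst p) (snd p)) = (LINT t:{0..T}|lborel. LINT x:{0..len r}|lborel. \<phi>x t x)"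
    by (subst LINT_Times[OF i(2)]) simp
  also have "\<dots> = (LINT t:{0..T}|lborel. \<phi> t (len r) - \<phi> t 0)"
    using len_pos LINT_Icc_FTC[OF _ D(2) c(2), of 0 "len r"] by (intro set_lebesgue_integral_cong) auto
  also have "\<dots> = (LINT t:{0..T}|lborel. \<phi> t (len r)) - (LINT t:{0..T}|lborel. \<phi> t 0)"
    using i(4,5) by (simp add: set_integral_diff)
  finally have x: "(LINT p:{0..T} \<times> {0..len r}|lborel. \<phi>x (fst p) (snd p))
      = (LINT t:{0..T}|lborel. \<phi> t (len r)) - (LINT t:{0..T}|lborel. \<phi> t 0)" .
  have "(LINT p:{0..T} \<times> {0..len r}|lborel. u * \<phi>t (fst p) (snd p) + w * \<phi>x (fst p) (snd p))
     = u * (LINT p:{0..T} \<times> {0..len r}|lborel. \<phi>t (fst p) (snd p)) + w * (LINT p:{0..T} \<times> {0..len r}|lborel. \<phi>x (fst p) (snd p))"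
    using i(1,2) by (subst set_integral_add(2)) simp_all
  then show ?thesis unfolding balance_def t x by (simp add: algebra_simps)
qed

text \<open>Multiplying by a spatial cutoff that vanishes near both ends makes \<open>\<phi>\<close>
  admissible. The derivative of the cutoff is an approximate delta at the start minus one at the
  end, and in the limit these produce the two trace terms.\<close>

lemma balance_kruzhkov_nonneg:
  assumes \<phi>: "boundary_test T (len r) \<phi> \<phi>t \<phi>x" and k: "k \<in> {0..lanes r}"
  shows "0 \<le> bal \<phi> \<phi>t \<phi>x (\<lambda>d. \<bar>d - k\<bar>) (kruzhkov_flux r k)"
proof -
  let ?L = "len r" and ?B = "{0..T} \<times> {0..len r}" and ?q = "kruzhkov_flux r k"
  note [simp] = len_pos
  obtain C where C0: "0 \<le> C" and "\<And>x y. x \<in> {0..lanes r} \<Longrightarrow> y \<in> {0..lanes r} \<Longrightarrow> \<bar>flux r x - flux r y\<bar> \<le> C * \<bar>x - y\<bar>"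
    using flux_lipschitz[OF road] by metis
  then have lip: "\<bar>?q x - ?q y\<bar> \<le> C * \<bar>x - y\<bar>" if "x \<in> {0..lanes r}" "y \<in> {0..lanes r}" for x y
    using kruzhkov_flux_lipschitz[OF _ k that] by blast
  have n0: "0 \<le> lanes r" using k by simp
  have dk: "\<bar>d - k\<bar> \<le> lanes r" if "d \<in> {0..lanes r}" for d using that k by auto
  have qb: "\<bar>?q d\<bar> \<le> C * lanes r" if "d \<in> {0..lanes r}" for d
  proof -
    have "\<bar>?q d\<bar> \<le> C * \<bar>d - k\<bar>" using lip[OF that k] by (simp add: kruzhkov_flux_def)
    also have "\<dots> \<le> C * lanes r" using dk[OF that] C0 by (rule mult_left_mono)
    finally show ?thesis .
  qed
  obtain M where M: "\<And>t x. t \<in> {0..T} \<Longrightarrow> x \<in> {0..?L} \<Longrightarrow> \<bar>\<phi> t x\<bar> \<le> M"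
    "\<And>t x. t \<in> {0..T} \<Longrightarrow> x \<in> {0..?L} \<Longrightarrow> \<bar>\<phi>t t x\<bar> \<le> M"
    "\<And>t x. t \<in> {0..T} \<Longrightarrow> x \<in> {0..?L} \<Longrightarrow> \<bar>\<phi>x t x\<bar> \<le> M"
    "\<And>t x y. t \<in> {0..T} \<Longrightarrow> x \<in> {0..?L} \<Longrightarrow> y \<in> {0..?L} \<Longrightarrow> \<bar>\<phi> t x - \<phi> t y\<bar> \<le> M * \<bar>x - y\<bar>"
    by (rule boundary_test_bounds[OF \<phi>]) (rule that)
  have M0: "0 \<le> M" using M(1)[of 0 0] T abs_ge_zero[of "\<phi> 0 0"] less_imp_le[OF len_pos] by auto
  have cont: "continuous_on UNIV (\<lambda>(t, x). \<phi> t x)" "continuous_on UNIV (\<lambda>(t, x). \<phi>t t x)"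
    "continuous_on UNIV (\<lambda>(t, x). \<phi>x t x)"
    using \<phi> by (auto simp: boundary_test_def)
  note meas = cont[THEN borel_measurable_continuous_onI]
  note [measurable] = meas[THEN measurable_Pair_curry]
  have Dt: "((\<lambda>s. \<phi> s x) has_real_derivative \<phi>t t x) (at t)" and Dx: "((\<lambda>x. \<phi> t x) has_real_derivative \<phi>x t x) (at x)"
for t x
    using \<phi> by (auto simp: boundary_test_def)
  have pos: "0 \<le> \<phi> t x" if "0 \<le> x" "x \<le> ?L" for t x
    using \<phi> that by (auto simp: boundary_test_def)
  obtain d where d: "d < T" "\<And>t x. d \<le> t \<Longrightarrow> x \<in> {0..?L} \<Longrightarrow> \<phi> t x = 0"
    using \<phi> by (auto simp: boundary_test_def)
  \<comment> \<open>The factor 4 keeps the two transition zones, each inside distance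
    \<open>2 * h i\<close> of its end, from overlapping.\<close>
  define h where "h = (\<lambda>i. ?L / (4 * (real i + 1)))"
  have h: "0 < h i" "4 * h i \<le> ?L" "2 * h i \<le> ?L" for i
    using less_imp_le[OF len_pos] by (auto simp: h_def field_simps intro!: add_nonneg_nonneg)
  have h0: "h \<longlonglongrightarrow> 0"
  proof -
    have "(\<lambda>i. ?L / 4 * inverse (real (Suc i))) \<longlonglongrightarrow> ?L / 4 * 0"
      by (intro tendsto_intros LIMSEQ_inverse_real_of_nat)
    then show ?thesis unfolding h_def by (simp add: field_simps)
  qed
  define s where "s = (\<lambda>i x. smoothstep (x / h i - 1))"
  define s' where "s' = (\<lambda>i x. smoothstep_deriv (x / h i - 1) / h i)"
  \<comment> \<open>At every point one of the two summands equals 1, so \<open>X\<close> has values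
    in \<open>[0, 1]\<close>. Adding rather than multiplying splits the derivative into one term per
    end.\<close>
  define X where "X = (\<lambda>i x. s i x + s i (?L - x) - 1)"
  \<comment> \<open>Compact support also requires vanishing at very negative times. This factor is 0
    before time \<open>-2\<close> and 1 from time \<open>-1\<close> on, so it changes nothing on
    \<open>[0, T]\<close>.\<close>
  define cut where "cut = (\<lambda>t. smoothstep (t + 2))"
  define cut' where "cut' = (\<lambda>t. smoothstep_deriv (t + 2))"
  have [measurable]: "s' i \<in> borel_measurable borel" "X i \<in> borel_measurable borel" for i
    unfolding s'_def X_def s_def by measurable
  have Ds: "(s i has_real_derivative s' i x) (at x)" for i x
    unfolding s_def s'_def
    by (rule DERIV_cong[OF DERIV_chain2[OF DERIV_smoothstep]]) (use h(1)[of i] in \<open>auto intro!: derivative_eq_intros\<close>)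
  have Ds2: "((\<lambda>x. s i (?L - x)) has_real_derivative - s' i (?L - x)) (at x)" for i x
    by (rule DERIV_cong[OF DERIV_chain2[OF Ds]]) (auto intro!: derivative_eq_intros)
  have DX: "(X i has_real_derivative s' i x - s' i (?L - x)) (at x)" for i x
    unfolding X_def by (rule DERIV_cong[OF DERIV_diff[OF DERIV_add[OF Ds Ds2] DERIV_const]]) simp
  have Dc: "(cut has_real_derivative cut' t) (at t)" for t
    unfolding cut_def cut'_def
    by (rule DERIV_cong[OF DERIV_chain2[OF DERIV_smoothstep]]) (auto intro!: derivative_eq_intros)
  have s01: "0 \<le> s i x" "s i x \<le> 1" for i x using smoothstep_bounds by (auto simp: s_def)
  have s1: "s i x = 1" if "2 * h i \<le> x" for i x
    using that h(1)[of i] by (auto simp: s_def field_simps intro!: smoothstep_eq_1)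
  have s0: "s i x = 0" if "x \<le> h i" for i x
    using that h(1)[of i] by (auto simp: s_def field_simps intro!: smoothstep_eq_0)
  have half: "2 * h i \<le> x \<or> 2 * h i \<le> ?L - x" for i x using h(2)[of i] by linarith
  have X01: "0 \<le> X i x" "X i x \<le> 1" for i x
    using half[of i x] s01[of i x] s01[of i "?L - x"] s1[of i x] s1[of i "?L - x"] by (auto simp: X_def)
  have X0: "X i x = 0" if "x \<le> h i \<or> ?L - h i \<le> x" for i x
    using that
  proof
    assume "x \<le> h i"
    then show ?thesis using s0[of x i] s1[of i "?L - x"] h(1,2)[of i] by (simp add: X_def)
  next
    assume "?L - h i \<le> x"
    then show ?thesis using s0[of "?L - x" i] s1[of i x] h(1,2)[of i] by (simp add: X_def)
  qed
  have Xlim: "(\<lambda>i. X i x) \<longlonglongrightarrow> 1" if "0 < x" "x < ?L" for x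
  proof -
    have "\<forall>\<^sub>F i in sequentially. h i < min (x / 2) ((?L - x) / 2)"
      using that by (intro order_tendstoD(2)[OF h0]) auto
    then have "\<forall>\<^sub>F i in sequentially. X i x = 1"
      by eventually_elim (auto simp: X_def s1)
    then show ?thesis by (rule tendsto_eventually)
  qed
  have cut1: "cut t = 1" "cut' t = 0" if "0 \<le> t" for t
    using that by (auto simp: cut_def cut'_def smoothstep_eq_1 smoothstep_deriv_eq_0)

  have test: "test_function T ?L (\<lambda>t x. \<phi> t x * cut t * X i x)
     (\<lambda>t x. (\<phi>t t x * cut t + \<phi> t x * cut' t) * X i x)
     (\<lambda>t x. cut t * (\<phi>x t x * X i x + \<phi> t x * (s' i x - s' i (?L - x))))" for i
    unfolding test_function_def
  proof (intro conjI allI)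
    show "0 \<le> \<phi> t x * cut t * X i x" for t x
    proof (cases "0 \<le> x \<and> x \<le> ?L")
      case True
      then show ?thesis using pos X01 smoothstep_bounds by (simp add: cut_def)
    next
      case False
      then have "X i x = 0" using h(1)[of i] by (intro X0) linarith
      then show ?thesis by simp
    qed
    show "((\<lambda>s. \<phi> s x * cut s * X i x) has_real_derivative (\<phi>t t x * cut t + \<phi> t x * cut' t) * X i x) (at t)" for t x
      by (rule DERIV_cong[OF DERIV_mult[OF DERIV_mult[OF Dt Dc] DERIV_const]]) (simp add: algebra_simps)
    show "((\<lambda>x. \<phi> t x * cut t * X i x) has_real_derivative cut t * (\<phi>x t x * X i x + \<phi> t x * (s' i x - s' i (?L - x)))) (at x)" for t x
      by (rule DERIV_cong[OF DERIV_mult[OF DERIV_mult[OF Dx DERIV_const] DX]]) (simp add: algebra_simps)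
    have ccut: "continuous_on UNIV (\<lambda>p. cut (fst p))" "continuous_on UNIV (\<lambda>p. cut' (fst p))"
      unfolding cut_def cut'_def by (intro continuous_intros)+
    have cX: "continuous_on UNIV (\<lambda>p. X i (snd p))" "continuous_on UNIV (\<lambda>p. s' i (snd p))"
       "continuous_on UNIV (\<lambda>p. s' i (?L - snd p))"
      unfolding X_def s_def s'_def using h(1)[of i] by (intro continuous_intros; simp)+
    note c\<phi> = cont[unfolded case_prod_unfold]
    show "continuous_on UNIV (\<lambda>(t, x). (\<phi>t t x * cut t + \<phi> t x * cut' t) * X i x)"
      unfolding case_prod_unfold by (intro continuous_intros c\<phi> ccut cX)
    show "continuous_on UNIV (\<lambda>(t, x). cut t * (\<phi>x t x * X i x + \<phi> t x * (s' i x - s' i (?L - x))))"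
      unfolding case_prod_unfold by (intro continuous_intros c\<phi> ccut cX)
    show "\<exists>K. compact K \<and> K \<subseteq> {..<T} \<times> {0<..<?L} \<and> (\<forall>t x. (t, x) \<notin> K \<longrightarrow> \<phi> t x * cut t * X i x = 0)"
    proof (intro exI conjI allI impI)
      show "compact ({-2..d} \<times> {h i..?L - h i})" by (intro compact_Times) auto
      show "{-2..d} \<times> {h i..?L - h i} \<subseteq> {..<T} \<times> {0<..<?L}" using d(1) h(1)[of i] by auto
      fix t x assume tx: "(t, x) \<notin> {-2..d} \<times> {h i..?L - h i}"
      consider "t < -2" | "x \<le> h i \<or> ?L - h i \<le> x" | "d \<le> t" "x \<in> {0..?L}"
        using tx h(1)[of i] by fastforce
      then show "\<phi> t x * cut t * X i x = 0"
        by cases (auto simp: cut_def smoothstep_eq_0 X0 d(2))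
    qed
  qed

  \<comment> \<open>\<open>f\<close> collects the terms in which the cutoff is not differentiated;
    \<open>g\<close> is the factor of the derivative of the cutoff and gives rise to the
    traces.\<close>
  define f where "f = (\<lambda>p. \<bar>\<rho> (fst p) (snd p) - k\<bar> * \<phi>t (fst p) (snd p) + ?q (\<rho> (fst p) (snd p)) * \<phi>x (fst p) (snd p))"
  define g where "g = (\<lambda>p. ?q (\<rho> (fst p) (snd p)) * \<phi> (fst p) (snd p))"
  have [measurable]: "f \<in> borel_measurable borel" "g \<in> borel_measurable borel"
    unfolding f_def g_def by measurable
  have gb: "\<bar>g p\<bar> \<le> (C * lanes r) * M" if "p \<in> ?B" for p
    unfolding g_def abs_mult using that M(1) qb density_range C0 n0
    by (intro mult_mono) (auto simp: mem_Times_iff)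
  have fb: "\<bar>f p\<bar> \<le> lanes r * M + (C * lanes r) * M" if "p \<in> ?B" for p
  proof -
    have "\<bar>f p\<bar> \<le> \<bar>\<rho> (fst p) (snd p) - k\<bar> * \<bar>\<phi>t (fst p) (snd p)\<bar> + \<bar>?q (\<rho> (fst p) (snd p))\<bar> * \<bar>\<phi>x (fst p) (snd p)\<bar>"
      unfolding f_def by (rule order_trans[OF abs_triangle_ineq]) (simp add: abs_mult)
    also have "\<dots> \<le> lanes r * M + (C * lanes r) * M"
      using that M(2,3) qb dk density_range C0 n0
      by (intro add_mono mult_mono) (auto simp: mem_Times_iff)
    finally show ?thesis .
  qed
  have i1: "set_integrable lborel ?B (\<lambda>p. f p * X i (snd p))" for i
  proof (rule set_integrable_bounded)
    fix p assume "p \<in> ?B"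
    then show "\<bar>f p * X i (snd p)\<bar> \<le> (lanes r * M + (C * lanes r) * M) * 1"
      unfolding abs_mult using fb X01[where i=i] n0 M0 C0 by (intro mult_mono) auto
  qed auto
  have s'b: "\<bar>s' i x\<bar> \<le> 2 / h i" for i x
    using smoothstep_deriv_bounds h(1)[of i] by (auto simp: s'_def divide_right_mono)
  have i2: "set_integrable lborel ?B (\<lambda>p. g p * s' i (snd p))" for i
  proof (rule set_integrable_bounded)
    fix p assume "p \<in> ?B"
    then show "\<bar>g p * s' i (snd p)\<bar> \<le> ((C * lanes r) * M) * (2 / h i)"
      unfolding abs_mult using gb s'b[where i=i] n0 M0 C0 by (intro mult_mono) auto
  qed auto
  have i3: "set_integrable lborel ?B (\<lambda>p. g p * s' i (?L - snd p))" for i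
  proof (rule set_integrable_bounded)
    fix p assume "p \<in> ?B"
    then show "\<bar>g p * s' i (?L - snd p)\<bar> \<le> ((C * lanes r) * M) * (2 / h i)"
      unfolding abs_mult using gb s'b[where i=i] n0 M0 C0 by (intro mult_mono) auto
  qed auto
  have ineq: "0 \<le> (LINT p:?B|lborel. f p * X i (snd p)) + (LINT p:?B|lborel. g p * s' i (snd p))
      - (LINT p:?B|lborel. g p * s' i (?L - snd p)) + (LINT x:{0..?L}|lborel. \<bar>c - k\<bar> * \<phi> 0 x * X i x)" for i
  proof -
    have "0 \<le> (LINT p:?B|lborel.
               (case p of (t, x) \<Rightarrow>
                  \<bar>\<rho> t x - k\<bar> * ((\<phi>t t x * cut t + \<phi> t x * cut' t) * X i x)
                  + sgn (\<rho> t x - k) * (flux r (\<rho> t x) - flux r k) * (cut t * (\<phi>x t x * X i x + \<phi> t x * (s' i x - s' i (?L - x))))))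
            + (LINT x:{0..?L}|lborel. \<bar>c - k\<bar> * (\<phi> 0 x * cut 0 * X i x))"
      using solution k test[of i] unfolding entropy_solution_def by blast
    moreover have "(LINT p:?B|lborel.
               (case p of (t, x) \<Rightarrow>
                  \<bar>\<rho> t x - k\<bar> * ((\<phi>t t x * cut t + \<phi> t x * cut' t) * X i x)
                  + sgn (\<rho> t x - k) * (flux r (\<rho> t x) - flux r k) * (cut t * (\<phi>x t x * X i x + \<phi> t x * (s' i x - s' i (?L - x))))))
       = (LINT p:?B|lborel. (f p * X i (snd p) + g p * s' i (snd p)) - g p * s' i (?L - snd p))"
    proof (rule set_lebesgue_integral_cong)
      show "\<forall>p. p \<in> ?B \<longrightarrow> (case p of (t, x) \<Rightarrow>
                  \<bar>\<rho> t x - k\<bar> * ((\<phi>t t x * cut t + \<phi> t x * cut' t) * X i x)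
                  + sgn (\<rho> t x - k) * (flux r (\<rho> t x) - flux r k) * (cut t * (\<phi>x t x * X i x + \<phi> t x * (s' i x - s' i (?L - x)))))
         = (f p * X i (snd p) + g p * s' i (snd p)) - g p * s' i (?L - snd p)"
      proof (intro allI impI)
        fix p assume "p \<in> ?B"
        then obtain t x where p: "p = (t, x)" and t: "0 \<le> t" by auto
        show "(case p of (t, x) \<Rightarrow>
                  \<bar>\<rho> t x - k\<bar> * ((\<phi>t t x * cut t + \<phi> t x * cut' t) * X i x)
                  + sgn (\<rho> t x - k) * (flux r (\<rho> t x) - flux r k) * (cut t * (\<phi>x t x * X i x + \<phi> t x * (s' i x - s' i (?L - x)))))
         = (f p * X i (snd p) + g p * s' i (snd p)) - g p * s' i (?L - snd p)"
          unfolding p f_def g_def kruzhkov_flux_def prod.case cut1[OF t] fst_conv snd_conv by (simp add: algebra_simps)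
      qed
    qed simp
    moreover have "\<dots> = (LINT p:?B|lborel. f p * X i (snd p)) + (LINT p:?B|lborel. g p * s' i (snd p)) - (LINT p:?B|lborel. g p * s' i (?L - snd p))"
      by (subst set_integral_diff(2)[OF set_integral_add(1)[OF i1 i2] i3]) (subst set_integral_add(2)[OF i1 i2], rule refl)
    ultimately show ?thesis by (simp add: cut1 mult.assoc)
  qed

  have A: "(\<lambda>i. LINT p:?B|lborel. f p * X i (snd p)) \<longlonglongrightarrow> (LINT p:?B|lborel. f p)"
  proof (rule set_integral_tendsto_bounded)
    fix i p assume "p \<in> ?B"
    then show "\<bar>f p * X i (snd p)\<bar> \<le> (lanes r * M + (C * lanes r) * M) * 1"
      unfolding abs_mult using fb X01[where i=i] n0 M0 C0 by (intro mult_mono) auto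
  next
    show "AE p in lborel. p \<in> ?B \<longrightarrow> (\<lambda>i. f p * X i (snd p)) \<longlonglongrightarrow> f p"
      using AE_snd_neq[of 0] AE_snd_neq[of ?L]
    proof eventually_elim
      case (elim p)
      show ?case
      proof
        assume "p \<in> ?B"
        then have "(\<lambda>i. X i (snd p)) \<longlonglongrightarrow> 1" using elim by (intro Xlim) (auto simp: mem_Times_iff)
        from tendsto_mult_left[OF this, of "f p"] show "(\<lambda>i. f p * X i (snd p)) \<longlonglongrightarrow> f p" by simp
      qed
    qed
  qed auto
  have S: "(\<lambda>i. LINT p:?B|lborel. g p * s' i (snd p)) \<longlonglongrightarrow> (LINT t:{0..T}|lborel. ?q (a t) * \<phi> t 0)"
    unfolding g_def s'_def
  proof (rule trace_limit[where R=\<rho> and \<phi>=\<phi> and q="?q" and a=a and h=h and M=M and D=M and C=C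
      and Q="C * lanes r" and n="lanes r"])
    show "((\<lambda>h. (LINT p:{0..T} \<times> {0..h}|lborel. (case p of (t, x) \<Rightarrow> \<bar>\<rho> t x - a t\<bar>)) / h) \<longlongrightarrow> 0) (at_right 0)"
      using start by (simp add: trace_start_def)
    show "\<bar>\<phi> t x - \<phi> t 0\<bar> \<le> M * x" if "t \<in> {0..T}" "x \<in> {0..?L}" for t x
      using M(4)[OF that, of 0] that by simp
  qed (use T lip qb M density_range trace_range density_measurable meas h h0 in auto)
  \<comment> \<open>The limit at the end of the road is the limit at the start of the reversed
    road.\<close>
  have E: "(\<lambda>i. LINT p:?B|lborel. g p * s' i (?L - snd p)) \<longlonglongrightarrow> (LINT t:{0..T}|lborel. ?q (b t) * \<phi> t ?L)"
  proof -
    have "(\<lambda>i. LINT p:?B|lborel. ?q (\<rho> (fst p) (?L - snd p)) * \<phi> (fst p) (?L - snd p) * (smoothstep_deriv (snd p / h i - 1) / h i))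
       \<longlonglongrightarrow> (LINT t:{0..T}|lborel. ?q (b t) * \<phi> t (?L - 0))"
    proof (rule trace_limit[where R="\<lambda>t x. \<rho> t (?L - x)" and \<phi>="\<lambda>t x. \<phi> t (?L - x)" and q="?q" and a=b and h=h and M=M and D=M and C=C
      and Q="C * lanes r" and n="lanes r"])
      have "(LINT p:{0..T} \<times> {?L - h..?L}|lborel. (case p of (t, x) \<Rightarrow> \<bar>\<rho> t x - b t\<bar>))
          = (LINT p:{0..T} \<times> {0..h}|lborel. (case p of (t, x) \<Rightarrow> \<bar>\<rho> t (?L - x) - b t\<bar>))" for h
        using LINT_Times_reflect[of "\<lambda>p. \<bar>\<rho> (fst p) (snd p) - b (fst p)\<bar>" 0 T ?L h 0]
        by (simp add: case_prod_unfold)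
      then show "((\<lambda>h. (LINT p:{0..T} \<times> {0..h}|lborel. (case p of (t, x) \<Rightarrow> \<bar>\<rho> t (?L - x) - b t\<bar>)) / h) \<longlongrightarrow> 0) (at_right 0)"
        using final by (simp add: trace_end_def)
      show "\<bar>\<phi> t (?L - x) - \<phi> t (?L - 0)\<bar> \<le> M * x" if "t \<in> {0..T}" "x \<in> {0..?L}" for t x
        using M(4)[OF that(1), of "?L - x" ?L] that by simp
      show "\<rho> t (?L - x) \<in> {0..lanes r}" if "t \<in> {0..T}" "x \<in> {0..?L}" for t x
        using density_range[OF that(1), of "?L - x"] that by simp
      show "\<bar>\<phi> t (?L - x)\<bar> \<le> M" if "t \<in> {0..T}" "x \<in> {0..?L}" for t x
        using M(1)[OF that(1), of "?L - x"] that by simp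
      show "(\<lambda>(t, x). \<rho> t (?L - x)) \<in> borel_measurable borel" "(\<lambda>(t, x). \<phi> t (?L - x)) \<in> borel_measurable borel"
        unfolding case_prod_unfold by measurable
    qed (use T lip qb trace_range h h0 in auto)
    moreover have "(LINT p:?B|lborel. g p * s' i (?L - snd p))
       = (LINT p:?B|lborel. ?q (\<rho> (fst p) (?L - snd p)) * \<phi> (fst p) (?L - snd p) * (smoothstep_deriv (snd p / h i - 1) / h i))" for i
      using LINT_Times_reflect[of "\<lambda>p. g p * s' i (?L - snd p)" 0 T ?L ?L 0]
      by (simp add: g_def s'_def)
    ultimately show ?thesis by simp
  qed
  have I: "(\<lambda>i. LINT x:{0..?L}|lborel. \<bar>c - k\<bar> * \<phi> 0 x * X i x) \<longlonglongrightarrow> (LINT x:{0..?L}|lborel. \<bar>c - k\<bar> * \<phi> 0 x)"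
  proof (rule set_integral_tendsto_bounded)
    fix i x assume "x \<in> {0..?L}"
    then show "\<bar>\<bar>c - k\<bar> * \<phi> 0 x * X i x\<bar> \<le> (\<bar>c - k\<bar> * M) * 1"
      unfolding abs_mult using M(1)[of 0 x] T X01[of i x] M0 by (intro mult_mono) auto
  next
    show "AE x in lborel. x \<in> {0..?L} \<longrightarrow> (\<lambda>i. \<bar>c - k\<bar> * \<phi> 0 x * X i x) \<longlonglongrightarrow> \<bar>c - k\<bar> * \<phi> 0 x"
      using AE_lborel_singleton[of 0] AE_lborel_singleton[of ?L]
    proof eventually_elim
      case (elim x)
      show ?case
      proof
        assume "x \<in> {0..?L}"
        then have "(\<lambda>i. X i x) \<longlonglongrightarrow> 1" using elim by (intro Xlim) auto
        from tendsto_mult_left[OF this] show "(\<lambda>i. \<bar>c - k\<bar> * \<phi> 0 x * X i x) \<longlonglongrightarrow> \<bar>c - k\<bar> * \<phi> 0 x" by fastforce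
      qed
    qed
  qed auto
  have "0 \<le> (LINT p:?B|lborel. f p) + (LINT t:{0..T}|lborel. ?q (a t) * \<phi> t 0)
      - (LINT t:{0..T}|lborel. ?q (b t) * \<phi> t ?L) + (LINT x:{0..?L}|lborel. \<bar>c - k\<bar> * \<phi> 0 x)"
    by (rule LIMSEQ_le_const[OF tendsto_add[OF tendsto_diff[OF tendsto_add[OF A S] E] I]]) (use ineq in auto)
  then show ?thesis unfolding balance_def f_def by linarith
qed

section \<open>Transport of free flow\<close>

abbreviation "L \<equiv> len r"
abbreviation "v \<equiv> vfree r"
abbreviation "\<sigma> \<equiv> crit_density r"

definition slack :: "real \<Rightarrow> real" where
  "slack d = max 0 (\<sigma> - d)"

text \<open>\<open>v * excess d\<close> is the rate at which traffic of density \<open>d\<close>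
  falls behind an observer moving at free speed. It vanishes in free flow.\<close>

definition excess :: "real \<Rightarrow> real" where
  "excess d = d - flux r d / v"

lemma v_pos: "0 < v" and sigma_pos: "0 < \<sigma>" and sigma_less: "\<sigma> < lanes r"
  using road by (auto simp: valid_road_def crit_density_pos)

lemma fcap_eq: "fcap r = v * \<sigma>"
  using v_pos by (simp add: crit_density_def)

lemma flux_free: "d \<le> \<sigma> \<Longrightarrow> flux r d = v * d"
  by (simp add: flux_def)

lemma measurable_slack [measurable]: "slack \<in> borel_measurable borel"
  unfolding slack_def[abs_def] by measurable

lemma measurable_excess [measurable]: "excess \<in> borel_measurable borel"
  unfolding excess_def[abs_def] by measurable

lemma slack_bounds: "0 \<le> slack d" "d \<in> {0..lanes r} \<Longrightarrow> slack d \<le> \<sigma>"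
  using sigma_pos by (auto simp: slack_def)

lemma flux_bounds: "d \<in> {0..lanes r} \<Longrightarrow> \<bar>flux r d\<bar> \<le> fcap r"
  using flux_nonneg[OF road] flux_le_fcap[OF road] by auto

section \<open>One-sided entropies and mass from the Kruzhkov family\<close>

lemma kruzhkov_bounds:
  assumes "k \<in> {0..lanes r}" "d \<in> {0..lanes r}"
  shows "\<bar>kruzhkov_flux r k d\<bar> \<le> fcap r"
  using assms[THEN flux_nonneg[OF road]] flux_le_fcap[OF road, of d] flux_le_fcap[OF road, of k]
  by (auto simp: kruzhkov_flux_def sgn_real_def)

text \<open>If one of the constants is an end of \<open>[0, n]\<close>, its modulus is affine on the
  range, and adding it to the modulus centred at \<open>\<sigma>\<close> leaves twice a one-sided
  entropy up to constants, which \<open>balance_const\<close> removes.\<close>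

lemma balance_two_kruzhkov:
  assumes \<phi>: "boundary_test T L \<phi> \<phi>t \<phi>x" and k: "k \<in> {0..lanes r}" "l \<in> {0..lanes r}"
    and m: "\<eta> \<in> borel_measurable borel" "q \<in> borel_measurable borel"
    and bdd: "\<forall>d\<in>{0..lanes r}. \<bar>\<eta> d\<bar> \<le> B" "\<forall>d\<in>{0..lanes r}. \<bar>q d\<bar> \<le> B"
    and eq: "\<And>d. d \<in> {0..lanes r} \<Longrightarrow> \<bar>d - k\<bar> + \<bar>d - l\<bar> = 2 * \<eta> d + u"
      "\<And>d. d \<in> {0..lanes r} \<Longrightarrow> kruzhkov_flux r k d + kruzhkov_flux r l d = 2 * q d + w"
  shows "0 \<le> bal \<phi> \<phi>t \<phi>x \<eta> q"
proof -
  define B' where "B' = max (lanes r) (fcap r)"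
  have kb: "\<forall>d\<in>{0..lanes r}. \<bar>\<bar>d - k\<bar>\<bar> \<le> B'" "\<forall>d\<in>{0..lanes r}. \<bar>kruzhkov_flux r k d\<bar> \<le> B'"
    if "k \<in> {0..lanes r}" for k
    using that kruzhkov_bounds by (fastforce simp: B'_def)+
  have "0 \<le> 1 * bal \<phi> \<phi>t \<phi>x (\<lambda>d. \<bar>d - k\<bar>) (kruzhkov_flux r k) + 1 * bal \<phi> \<phi>t \<phi>x (\<lambda>d. \<bar>d - l\<bar>) (kruzhkov_flux r l)"
    using balance_kruzhkov_nonneg[OF \<phi> k(1)] balance_kruzhkov_nonneg[OF \<phi> k(2)] by simp
  also have "\<dots> = bal \<phi> \<phi>t \<phi>x (\<lambda>d. 1 * \<bar>d - k\<bar> + 1 * \<bar>d - l\<bar>) (\<lambda>d. 1 * kruzhkov_flux r k d + 1 * kruzhkov_flux r l d)"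
    by (rule balance_linear[OF \<phi> _ _ _ _ kb[OF k(1)] kb[OF k(2)], symmetric]) simp_all
  also have "\<dots> = bal \<phi> \<phi>t \<phi>x (\<lambda>d. 2 * \<eta> d + 1 * u) (\<lambda>d. 2 * q d + 1 * w)"
    using eq by (intro balance_cong) simp_all
  also have "\<dots> = 2 * bal \<phi> \<phi>t \<phi>x \<eta> q + 1 * bal \<phi> \<phi>t \<phi>x (\<lambda>_. u) (\<lambda>_. w)"
    by (rule balance_linear[OF \<phi> m, where B="max B (max \<bar>u\<bar> \<bar>w\<bar>)"])
      (use bdd in \<open>auto intro: order_trans[OF _ max.cobounded1] simp: max.coboundedI2\<close>)
  finally show ?thesis using balance_const[OF \<phi>] by simp
qed

text \<open>With the constants \<open>\<sigma>\<close> and \<open>n\<close> the slopes cancel above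
  \<open>\<sigma>\<close>. Below it the flux is linear, so the entropy flux is an exact multiple of
  the entropy and there is a single speed of propagation.\<close>

lemma balance_slack_nonneg:
  assumes \<phi>: "boundary_test T L \<phi> \<phi>t \<phi>x"
  shows "0 \<le> bal \<phi> \<phi>t \<phi>x slack (\<lambda>d. v * slack d)"
proof (rule balance_two_kruzhkov[OF \<phi>, where k=\<sigma> and l="lanes r" and B="max \<sigma> (fcap r)" and u="lanes r - \<sigma>" and w="- fcap r"])
  show "\<forall>d\<in>{0..lanes r}. \<bar>slack d\<bar> \<le> max \<sigma> (fcap r)" "\<forall>d\<in>{0..lanes r}. \<bar>v * slack d\<bar> \<le> max \<sigma> (fcap r)"
    using slack_bounds v_pos by (auto simp: fcap_eq abs_mult max.coboundedI1 max.coboundedI2)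
  show "\<bar>d - \<sigma>\<bar> + \<bar>d - lanes r\<bar> = 2 * slack d + (lanes r - \<sigma>)" if "d \<in> {0..lanes r}" for d
    using that by (auto simp: slack_def max_def abs_if)
  show "kruzhkov_flux r \<sigma> d + kruzhkov_flux r (lanes r) d = 2 * (v * slack d) + (- fcap r)" if "d \<in> {0..lanes r}" for d
  proof (cases "d < \<sigma>")
    case True
    then show ?thesis using sigma_less flux_free[of d] flux_crit[OF road] flux_lanes[OF road]
      by (simp add: kruzhkov_flux_def slack_def fcap_eq algebra_simps)
  next
    case False
    then show ?thesis using that sigma_less flux_crit[OF road] flux_lanes[OF road]
      by (auto simp: kruzhkov_flux_def slack_def sgn_real_def)
  qed
qed (use sigma_pos sigma_less in auto)

text \<open>The counterpart with the constants \<open>\<sigma>\<close> and \<open>0\<close>. Its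
  entropy flux is nonpositive: congestion only moves backwards.\<close>

lemma balance_congestion_nonneg:
  assumes \<phi>: "boundary_test T L \<phi> \<phi>t \<phi>x"
  shows "0 \<le> bal \<phi> \<phi>t \<phi>x (\<lambda>d. max 0 (d - \<sigma>)) (\<lambda>d. if \<sigma> < d then flux r d - fcap r else 0)"
proof (rule balance_two_kruzhkov[OF \<phi>, where k=\<sigma> and l=0 and B="max (lanes r) (fcap r)" and u=\<sigma> and w="fcap r"])
  show "\<forall>d\<in>{0..lanes r}. \<bar>max 0 (d - \<sigma>)\<bar> \<le> max (lanes r) (fcap r)"
    using sigma_pos by auto
  show "\<forall>d\<in>{0..lanes r}. \<bar>if \<sigma> < d then flux r d - fcap r else 0\<bar> \<le> max (lanes r) (fcap r)"
  proof
    fix d assume "d \<in> {0..lanes r}"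
    then have "0 \<le> flux r d" "flux r d \<le> fcap r" using flux_nonneg[OF road] flux_le_fcap[OF road] by auto
    then show "\<bar>if \<sigma> < d then flux r d - fcap r else 0\<bar> \<le> max (lanes r) (fcap r)" by auto
  qed
  show "\<bar>d - \<sigma>\<bar> + \<bar>d - 0\<bar> = 2 * max 0 (d - \<sigma>) + \<sigma>" if "d \<in> {0..lanes r}" for d
    using that by (auto simp: max_def)
  show "kruzhkov_flux r \<sigma> d + kruzhkov_flux r 0 d = 2 * (if \<sigma> < d then flux r d - fcap r else 0) + fcap r" if "d \<in> {0..lanes r}" for d
    using that sigma_pos flux_crit[OF road] flux_zero[OF road]
    by (auto simp: kruzhkov_flux_def sgn_real_def)
qed (use sigma_pos sigma_less in auto)

text \<open>For \<open>k = n\<close> the modulus is \<open>n - d\<close> on the whole range, so the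
  entropy inequality is one half of conservation of mass, the half that bounds the outflow from
  below.\<close>

lemma balance_mass_nonpos:
  assumes \<phi>: "boundary_test T L \<phi> \<phi>t \<phi>x"
  shows "bal \<phi> \<phi>t \<phi>x (\<lambda>d. d) (flux r) \<le> 0"
proof -
  have n: "lanes r \<in> {0..lanes r}" using sigma_pos sigma_less by simp
  have "0 \<le> bal \<phi> \<phi>t \<phi>x (\<lambda>d. \<bar>d - lanes r\<bar>) (kruzhkov_flux r (lanes r))"
    by (rule balance_kruzhkov_nonneg[OF \<phi> n])
  also have "\<dots> = bal \<phi> \<phi>t \<phi>x (\<lambda>d. (-1) * d + 1 * lanes r) (\<lambda>d. (-1) * flux r d + 1 * 0)"
    using flux_lanes[OF road] by (intro balance_cong) (auto simp: kruzhkov_flux_def sgn_real_def)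
  also have "\<dots> = (-1) * bal \<phi> \<phi>t \<phi>x (\<lambda>d. d) (flux r) + 1 * bal \<phi> \<phi>t \<phi>x (\<lambda>_. lanes r) (\<lambda>_. 0)"
    using flux_bounds sigma_pos sigma_less
    by (intro balance_linear[OF \<phi>, where B="max (lanes r) (fcap r)"]) (auto simp: max.coboundedI1 max.coboundedI2)
  finally show ?thesis using balance_const[OF \<phi>] by simp
qed

text \<open>With a test function that decreases in time and is constant in space, every term of the
  balance of \<open>(\<rho> - \<sigma>)\<^sup>+\<close> except the one at the start of the road has a sign.\<close>

lemma start_free_if_end_free:
  assumes c0: "c \<le> \<sigma>" and free: "AE t in lborel. t \<in> {0..T} \<longrightarrow> b t \<le> \<sigma>"
  shows "AE t in lborel. t \<in> {0..T} \<longrightarrow> a t \<le> \<sigma>"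
proof -
  let ?q = "\<lambda>d. if \<sigma> < d then flux r d - fcap r else 0"
  \<comment> \<open>Test functions vanish before time \<open>T\<close>, so the claim is proved up to
    each \<open>e < T\<close> and extended at the end along \<open>T - 1 / Suc n\<close>.\<close>
  have "AE t in lborel. t \<in> {0..T} \<longrightarrow> t < e \<longrightarrow> a t \<le> \<sigma>" if e: "e < T" for e
  proof -
    \<comment> \<open>Continuously differentiable, decreasing, zero from \<open>e\<close> on and
      strictly positive before, so a vanishing weighted integrand determines the trace at every
      earlier time.\<close>
    define \<psi> where "\<psi> = (\<lambda>t::real. (max 0 (e - t))\<^sup>2)"
    have D: "(\<psi> has_real_derivative - 2 * max 0 (e - t)) (at t)" for t
    proof -
      have "((\<lambda>t. (max 0 (- t - (- e)))\<^sup>2) has_real_derivative 2 * max 0 (- t - (- e)) * (- 1)) (at t)"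
        by (rule DERIV_chain2[OF DERIV_pos_part_square]) (auto intro!: derivative_eq_intros)
      then show ?thesis by (simp add: \<psi>_def add.commute)
    qed
    have bt: "boundary_test T L (\<lambda>t x. \<psi> t) (\<lambda>t x. - 2 * max 0 (e - t)) (\<lambda>t x. 0)"
      unfolding boundary_test_def
    proof (intro conjI allI impI)
      show "\<exists>d<T. \<forall>t x. d \<le> t \<longrightarrow> 0 \<le> x \<longrightarrow> x \<le> L \<longrightarrow> \<psi> t = 0"
        using e by (intro exI[of _ e]) (auto simp: \<psi>_def)
      show "(\<psi> has_real_derivative - 2 * max 0 (e - t)) (at t)" for t by (rule D)
    qed (auto simp: \<psi>_def case_prod_unfold intro!: continuous_intros)
    have bound: "\<bar>?q d\<bar> \<le> max (lanes r) (fcap r)" "\<bar>max 0 (d - \<sigma>)\<bar> \<le> max (lanes r) (fcap r)" if "d \<in> {0..lanes r}" for d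
      using that flux_nonneg[OF road, of d] flux_le_fcap[OF road, of d] sigma_pos sigma_less by auto
    have int: "set_integrable lborel {0..T} (\<lambda>t. ?q (a t) * \<psi> t)"
      by (rule balance_integrable(4)[OF bt, of "\<lambda>d. max 0 (d - \<sigma>)" ?q "max (lanes r) (fcap r)"])
        (use bound in auto)
    have "0 \<le> bal (\<lambda>t x. \<psi> t) (\<lambda>t x. - 2 * max 0 (e - t)) (\<lambda>t x. 0) (\<lambda>d. max 0 (d - \<sigma>)) ?q"
      by (rule balance_congestion_nonneg[OF bt])
    moreover have "(LINT p:{0..T} \<times> {0..L}|lborel. max 0 (\<rho> (fst p) (snd p) - \<sigma>) * (- 2 * max 0 (e - fst p))
        + ?q (\<rho> (fst p) (snd p)) * 0) \<le> 0"
    proof -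
      have "0 \<le> (LINT p:{0..T} \<times> {0..L}|lborel. max 0 (\<rho> (fst p) (snd p) - \<sigma>) * (2 * max 0 (e - fst p)))"
        unfolding set_lebesgue_integral_def by (intro integral_nonneg_AE) (auto intro!: always_eventually)
      moreover have "(LINT p:{0..T} \<times> {0..L}|lborel. max 0 (\<rho> (fst p) (snd p) - \<sigma>) * (- 2 * max 0 (e - fst p))
        + ?q (\<rho> (fst p) (snd p)) * 0) = - (LINT p:{0..T} \<times> {0..L}|lborel. max 0 (\<rho> (fst p) (snd p) - \<sigma>) * (2 * max 0 (e - fst p)))"
        unfolding set_lebesgue_integral_def integral_minus[symmetric]
        by (rule Bochner_Integration.integral_cong) auto
      ultimately show ?thesis by linarith
    qed
    moreover have "(LINT t:{0..T}|lborel. ?q (b t) * \<psi> t) = 0"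
      unfolding set_lebesgue_integral_def
      by (rule integral_eq_zero_AE) (use free in \<open>eventually_elim, auto simp: indicator_def\<close>)
    ultimately have "0 \<le> (LINT t:{0..T}|lborel. ?q (a t) * \<psi> t)"
      using c0 by (simp add: balance_def)
    then have "(LINT t|lborel. indicator {0..T} t *\<^sub>R (- (?q (a t) * \<psi> t))) \<le> 0"
      by (simp add: set_lebesgue_integral_def)
    \<comment> \<open>Above \<open>\<sigma>\<close> the flux is below capacity, so the entropy flux
      is nonpositive. The start term thus has the sign opposite to the inequality just derived and
      must vanish almost everywhere.\<close>
    moreover have nn: "0 \<le> indicator {0..T} t *\<^sub>R (- (?q (a t) * \<psi> t))" for t
      using flux_le_fcap[OF road, of "a t"] by (auto simp: indicator_def \<psi>_def mult_nonpos_nonneg)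
    moreover have "integrable lborel (\<lambda>t. indicator {0..T} t *\<^sub>R (- (?q (a t) * \<psi> t)))"
      using int by (simp add: set_integrable_def)
    ultimately have "AE t in lborel. indicator {0..T} t *\<^sub>R (- (?q (a t) * \<psi> t)) = 0"
      using integral_nonneg_eq_0_iff_AE[of lborel "\<lambda>t. indicator {0..T} t *\<^sub>R (- (?q (a t) * \<psi> t))"]
        integral_nonneg_AE[of "\<lambda>t. indicator {0..T} t *\<^sub>R (- (?q (a t) * \<psi> t))" lborel]
      by (auto intro: antisym always_eventually)
    then show ?thesis
    proof eventually_elim
      case (elim t)
      show ?case
      proof (intro impI)
        assume t: "t \<in> {0..T}" "t < e"
        then have "?q (a t) = 0" using elim by (auto simp: \<psi>_def max_def)
        then show "a t \<le> \<sigma>" using flux_less_fcap[OF road, of "a t"] by (auto split: if_splits)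
      qed
    qed
  qed
  then have "AE t in lborel. \<forall>n::nat. t \<in> {0..T} \<longrightarrow> t < T - 1 / Suc n \<longrightarrow> a t \<le> \<sigma>"
    by (subst AE_all_countable) auto
  then show ?thesis using AE_lborel_singleton[of T]
  proof eventually_elim
    case (elim t)
    show ?case
    proof
      assume t: "t \<in> {0..T}"
      then have "0 < T - t" using elim by auto
      then obtain n :: nat where "1 / Suc n < T - t" using nat_approx_posE by blast
      then show "a t \<le> \<sigma>" using elim t by (auto simp: algebra_simps)
    qed
  qed
qed

section \<open>Weak transport along free-flow characteristics, labelled by their departure time
  \<open>t - x / v\<close>\<close>

lemma boundary_test_characteristic:
  assumes \<theta>: "\<And>s. (\<theta> has_real_derivative \<theta>' s) (at s)" "continuous_on UNIV \<theta>'" "\<And>s. 0 \<le> \<theta> s"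
      "\<And>s. q \<le> s \<Longrightarrow> \<theta> s = 0" "q + L / v < T"
    and Z: "\<And>x. (Z has_real_derivative Z' x) (at x)" "continuous_on UNIV Z'" "\<And>x. 0 \<le> x \<Longrightarrow> x \<le> L \<Longrightarrow> 0 \<le> Z x"
  shows "boundary_test T L (\<lambda>t x. \<theta> (t - x / v) * Z x) (\<lambda>t x. \<theta>' (t - x / v) * Z x)
     (\<lambda>t x. \<theta> (t - x / v) * Z' x - \<theta>' (t - x / v) / v * Z x)"
  unfolding boundary_test_def
proof (intro conjI allI impI)
  have c\<theta>: "continuous_on UNIV \<theta>"
    by (intro continuous_at_imp_continuous_on ballI) (rule DERIV_isCont[OF \<theta>(1)])
  have cZ: "continuous_on UNIV Z"
    by (intro continuous_at_imp_continuous_on ballI) (rule DERIV_isCont[OF Z(1)])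
  note v0 = v_pos less_imp_neq[OF v_pos, symmetric]
  have "continuous_on UNIV (\<lambda>p :: real \<times> real. fst p - snd p / v)"
    using v0 by (intro continuous_intros) simp
  note ch = continuous_on_compose2[OF _ this subset_UNIV]
  have "continuous_on UNIV (snd :: real \<times> real \<Rightarrow> real)"
    by (intro continuous_intros)
  note sn = continuous_on_compose2[OF _ this subset_UNIV]
  show "continuous_on UNIV (\<lambda>(t, x). \<theta> (t - x / v) * Z x)"
    "continuous_on UNIV (\<lambda>(t, x). \<theta>' (t - x / v) * Z x)"
    "continuous_on UNIV (\<lambda>(t, x). \<theta> (t - x / v) * Z' x - \<theta>' (t - x / v) / v * Z x)"
    unfolding case_prod_unfold using v0
    by (intro continuous_on_mult continuous_on_diff continuous_on_divide continuous_on_const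
        ch[OF c\<theta>] ch[OF \<theta>(2)] sn[OF cZ] sn[OF Z(2)]; simp)+
  show "((\<lambda>s. \<theta> (s - x / v) * Z x) has_real_derivative \<theta>' (t - x / v) * Z x) (at t)" for t x
    by (rule DERIV_cong[OF DERIV_mult[OF DERIV_chain2[OF \<theta>(1)] DERIV_const]]) (auto intro!: derivative_eq_intros)
  have "((\<lambda>x. \<theta> (t - x / v)) has_real_derivative \<theta>' (t - x / v) * (- 1 / v)) (at x)" for t x
    by (rule DERIV_chain2[OF \<theta>(1)]) (use v0 in \<open>auto intro!: derivative_eq_intros\<close>)
  from DERIV_mult[OF this Z(1)]
  show "((\<lambda>x. \<theta> (t - x / v) * Z x) has_real_derivative \<theta> (t - x / v) * Z' x - \<theta>' (t - x / v) / v * Z x) (at x)" for t x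
    by (rule DERIV_cong) (simp add: algebra_simps)
  show "0 \<le> \<theta> (t - x / v) * Z x" if "0 \<le> x" "x \<le> L" for t x
    using \<theta>(3) Z(3)[OF that] by simp
  show "\<exists>d<T. \<forall>t x. d \<le> t \<longrightarrow> 0 \<le> x \<longrightarrow> x \<le> L \<longrightarrow> \<theta> (t - x / v) * Z x = 0"
  \<comment> \<open>Nothing in the support departs after \<open>q\<close>, and a departure at time
    \<open>q\<close> reaches the end of the road at \<open>q + L / v\<close>.\<close>
  proof (intro exI[of _ "q + L / v"] conjI allI impI)
    fix t x assume "q + L / v \<le> t" "0 \<le> x" "x \<le> L"
    moreover from this have "x / v \<le> L / v" using v_pos by (simp add: divide_right_mono)
    ultimately have "\<theta> (t - x / v) = 0" by (intro \<theta>(4)) simp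
    then show "\<theta> (t - x / v) * Z x = 0" by simp
  qed (use \<theta>(5) in simp)
qed

text \<open>The operator \<open>\<partial>\<^sub>t + v \<partial>\<^sub>x\<close> annihilates
  functions of \<open>t - x / v\<close>, so only \<open>v * \<theta> * Z'\<close> remains in the
  interior, and the initial term is zero because the initial datum has no slack. A constant
  \<open>Z\<close> compares the two ends of the road; a \<open>Z\<close> that vanishes at the start
  compares the end with the interior.\<close>

lemma slack_transport_weak:
  assumes c0: "\<sigma> \<le> c"
    and \<theta>: "\<And>s. (\<theta> has_real_derivative \<theta>' s) (at s)" "continuous_on UNIV \<theta>'" "\<And>s. 0 \<le> \<theta> s"
      "\<And>s. q \<le> s \<Longrightarrow> \<theta> s = 0" "q + L / v < T"
    and Z: "\<And>x. (Z has_real_derivative Z' x) (at x)" "continuous_on UNIV Z'" "\<And>x. 0 \<le> x \<Longrightarrow> x \<le> L \<Longrightarrow> 0 \<le> Z x"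
  shows "(LINT t:{0..T}|lborel. slack (b t) * \<theta> (t - L / v)) * Z L
    \<le> (LINT p:{0..T} \<times> {0..L}|lborel. slack (\<rho> (fst p) (snd p)) * (\<theta> (fst p - snd p / v) * Z' (snd p)))
      + (LINT t:{0..T}|lborel. slack (a t) * \<theta> t) * Z 0"
proof -
  have "0 \<le> bal (\<lambda>t x. \<theta> (t - x / v) * Z x) (\<lambda>t x. \<theta>' (t - x / v) * Z x)
     (\<lambda>t x. \<theta> (t - x / v) * Z' x - \<theta>' (t - x / v) / v * Z x) slack (\<lambda>d. v * slack d)"
    by (rule balance_slack_nonneg[OF boundary_test_characteristic[OF \<theta> Z]])
  also have "\<dots> = v * ((LINT p:{0..T} \<times> {0..L}|lborel. slack (\<rho> (fst p) (snd p)) * (\<theta> (fst p - snd p / v) * Z' (snd p)))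
      + (LINT t:{0..T}|lborel. slack (a t) * \<theta> t) * Z 0
      - (LINT t:{0..T}|lborel. slack (b t) * \<theta> (t - L / v)) * Z L)"
  proof -
    have pointwise: "slack d * (\<theta>' s * z) + v * slack d * (\<theta> s * z' - \<theta>' s / v * z) = v * (slack d * (\<theta> s * z'))" for d s z z'
      using v_pos by (simp add: field_simps)
    have e1: "(LINT p:{0..T} \<times> {0..L}|lborel. slack (\<rho> (fst p) (snd p)) * (\<theta>' (fst p - snd p / v) * Z (snd p))
          + v * slack (\<rho> (fst p) (snd p)) * (\<theta> (fst p - snd p / v) * Z' (snd p) - \<theta>' (fst p - snd p / v) / v * Z (snd p)))
        = v * (LINT p:{0..T} \<times> {0..L}|lborel. slack (\<rho> (fst p) (snd p)) * (\<theta> (fst p - snd p / v) * Z' (snd p)))"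
      unfolding pointwise by (rule set_integral_mult_right)
    have e2: "(LINT x:{0..L}|lborel. slack c * (\<theta> (0 - x / v) * Z x)) = 0"
      using c0 by (simp add: slack_def)
    have trace: "(LINT t:{0..T}|lborel. v * slack (d t) * (\<theta> (w t) * z)) = v * ((LINT t:{0..T}|lborel. slack (d t) * \<theta> (w t)) * z)" for d w z
    proof -
      have "(LINT t:{0..T}|lborel. v * slack (d t) * (\<theta> (w t) * z)) = (LINT t:{0..T}|lborel. (v * z) * (slack (d t) * \<theta> (w t)))"
        by (intro set_lebesgue_integral_cong) (simp_all add: mult_ac)
      then show ?thesis by (simp only: set_integral_mult_right mult_ac)
    qed
    have e3: "(LINT t:{0..T}|lborel. v * slack (a t) * (\<theta> (t - 0 / v) * Z 0)) = v * ((LINT t:{0..T}|lborel. slack (a t) * \<theta> t) * Z 0)"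
      using trace[of a "\<lambda>t. t"] by simp
    show ?thesis unfolding balance_def e1 e2 e3 trace by (simp add: algebra_simps)
  qed
  finally show ?thesis using v_pos by (simp add: zero_le_mult_iff)
qed

text \<open>If \<open>\<theta>\<close> is close to a delta at \<open>s\<close>, then
  \<open>\<Theta>\<close> is close to the indicator of departure times before \<open>s\<close>. The
  inequality is then the mass balance of the region in front of the characteristic departing at
  \<open>s\<close>, and the right-hand side is the exchange across it.\<close>

lemma mass_transport_weak:
  assumes \<theta>: "\<And>s. (\<Theta> has_real_derivative - \<theta> s) (at s)" "continuous_on UNIV \<theta>" "\<And>s. 0 \<le> \<Theta> s"
      "\<And>s. q \<le> s \<Longrightarrow> \<Theta> s = 0" "q + L / v < T"
  shows "(LINT x:{0..L}|lborel. c * \<Theta> (- x / v)) + (LINT t:{0..T}|lborel. flux r (a t) * \<Theta> t)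
      - (LINT t:{0..T}|lborel. flux r (b t) * \<Theta> (t - L / v))
    \<le> (LINT p:{0..T} \<times> {0..L}|lborel. excess (\<rho> (fst p) (snd p)) * \<theta> (fst p - snd p / v))"
proof -
  have "bal (\<lambda>t x. \<Theta> (t - x / v) * 1) (\<lambda>t x. - \<theta> (t - x / v) * 1)
     (\<lambda>t x. \<Theta> (t - x / v) * 0 - (- \<theta> (t - x / v)) / v * 1) (\<lambda>d. d) (flux r) \<le> 0"
    using \<theta> by (intro balance_mass_nonpos boundary_test_characteristic) (auto intro!: continuous_intros)
  moreover have "d * (- \<theta> s * 1) + flux r d * (\<Theta> s * 0 - (- \<theta> s) / v * 1) = - (excess d * \<theta> s)" for d s
    using v_pos by (simp add: excess_def field_simps)
  ultimately show ?thesis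
    unfolding balance_def by (simp add: set_lebesgue_integral_def)
qed

section \<open>Statements about almost every characteristic\<close>

lemma slack_abs_bound: "d \<in> {0..lanes r} \<Longrightarrow> \<bar>slack d\<bar> \<le> \<sigma>"
  using slack_bounds[of d] by simp

lemma slack_pos_iff: "0 < slack d \<longleftrightarrow> d < \<sigma>"
  by (auto simp: slack_def)

text \<open>The case \<open>Z = 1\<close>: slack arriving at time \<open>t\<close> is at most the
  slack that entered at time \<open>t - L / v\<close>.\<close>

lemma slack_transport_ends:
  assumes c0: "\<sigma> \<le> c"
  shows "AE t in lborel. t \<in> {0..T} \<longrightarrow> b t < \<sigma> \<longrightarrow> L / v \<le> t \<and> a (t - L / v) < \<sigma>"
proof -
  \<comment> \<open>Extension by zero encodes the congested initial datum: for
    \<open>t < L / v\<close> the shifted start slack is zero, so no slack can arrive yet.\<close>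
  define ua where "ua = (\<lambda>t. indicator {0..T} t * slack (a t))"
  define ub where "ub = (\<lambda>t. indicator {0..T} t * slack (b t))"
  have [measurable]: "ua \<in> borel_measurable borel" "ub \<in> borel_measurable borel"
    unfolding ua_def ub_def by measurable
  have bd: "\<bar>ua t\<bar> \<le> \<sigma>" "\<bar>ub t\<bar> \<le> \<sigma>" for t
    using slack_abs_bound trace_range[of t] sigma_pos by (auto simp: ua_def ub_def indicator_def)
  have "AE t in lborel. 0 < t \<longrightarrow> t < T \<longrightarrow> 0 \<le> ua (- (L / v) + t) - ub t"
  proof (rule AE_nonneg_if_bump_integrals_nonneg)
    show "\<bar>ua (- (L / v) + t) - ub t\<bar> \<le> \<sigma> + \<sigma>" for t
      using bd(1)[of "- (L / v) + t"] bd(2)[of t] by linarith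
    fix p q n assume pq: "0 < p" "p < q" "q < T"
    \<comment> \<open>The bump localizes the arrival time, whereas \<open>\<theta>\<close> is a
      function of the departure time; hence the shift.\<close>
    have D: "((\<lambda>s. bump p q n (s + L / v)) has_real_derivative bump_deriv p q n (s + L / v)) (at s)" for s
      by (rule DERIV_cong[OF DERIV_chain2[OF DERIV_bump]]) (auto intro!: derivative_eq_intros)
    have "(LINT t:{0..T}|lborel. slack (b t) * bump p q n (t - L / v + L / v)) * 1
      \<le> (LINT P:{0..T} \<times> {0..L}|lborel. slack (\<rho> (fst P) (snd P)) * (bump p q n (fst P - snd P / v + L / v) * 0))
      + (LINT t:{0..T}|lborel. slack (a t) * bump p q n (t + L / v)) * 1"
    proof (rule slack_transport_weak[OF c0, where \<theta>="\<lambda>s. bump p q n (s + L / v)" and q="q - L / v" and Z="\<lambda>_. 1" and Z'="\<lambda>_. 0"])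
      show "((\<lambda>s. bump p q n (s + L / v)) has_real_derivative bump_deriv p q n (s + L / v)) (at s)" for s by (rule D)
    qed (use pq bump_bounds in \<open>auto intro!: continuous_intros bump_eq_0\<close>)
    also have "(LINT t:{0..T}|lborel. slack (b t) * bump p q n (t - L / v + L / v)) = (LINT t|lborel. bump p q n t * ub t)"
      unfolding set_lebesgue_integral_def ub_def by (rule Bochner_Integration.integral_cong) auto
    also have "(LINT t:{0..T}|lborel. slack (a t) * bump p q n (t + L / v)) = (LINT t|lborel. bump p q n (t + L / v) * ua t)"
      unfolding set_lebesgue_integral_def ua_def by (rule Bochner_Integration.integral_cong) auto
    also have "\<dots> = (LINT t|lborel. bump p q n t * ua (- (L / v) + t))"
      by (subst LINT_translate[of _ "- (L / v)"]) simp
    finally have "(LINT t|lborel. bump p q n t * ub t) \<le> (LINT t|lborel. bump p q n t * ua (- (L / v) + t))"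
      by simp
    moreover have "integrable lborel (\<lambda>t. bump p q n t * w t)" if "w \<in> borel_measurable borel" "\<And>t. \<bar>w t\<bar> \<le> \<sigma>" for w
    proof (rule integrable_bounded_support[of "{p..q}" _ "1 * \<sigma>"])
      show "\<bar>bump p q n t * w t\<bar> \<le> 1 * \<sigma>" for t
        unfolding abs_mult using that(2) bump_bounds[of p q n t] by (intro mult_mono) auto
    qed (use that(1) in \<open>auto simp: bump_eq_0\<close>)
    ultimately show "0 \<le> (LINT t|lborel. bump p q n t * (ua (- (L / v) + t) - ub t))"
      using bd by (simp add: right_diff_distrib)
  qed auto
  then show ?thesis using AE_lborel_singleton[of 0] AE_lborel_singleton[of T]
  proof eventually_elim
    case (elim t)
    show ?case
    proof (intro impI)
      assume t: "t \<in> {0..T}" "b t < \<sigma>"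
      then have "0 < ub t" by (simp add: ub_def slack_pos_iff)
      then have "0 < ua (- (L / v) + t)" using elim t by auto
      then show "L / v \<le> t \<and> a (t - L / v) < \<sigma>"
        by (cases "- (L / v) + t \<in> {0..T}") (auto simp: ua_def slack_pos_iff)
    qed
  qed
qed

text \<open>Slack at the end of the road is bounded by the slack at every earlier point of the same
  characteristic. In the coordinates departure time and position, this is a statement about almost
  every point of a rectangle, and Fubini turns it into one about almost every
  characteristic.\<close>

lemma slack_transport_interior:
  assumes c0: "\<sigma> \<le> c"
  shows "AE s in lborel. 0 < s \<longrightarrow> s < T - L / v \<longrightarrow> b (s + L / v) < \<sigma> \<longrightarrow>
    (AE x in lborel. 0 < x \<longrightarrow> x < L \<longrightarrow> \<rho> (s + x / v) x < \<sigma>)"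
proof -
  define U where "U = (\<lambda>P. indicator ({0..T} \<times> {0..L}) P * slack (\<rho> (fst P) (snd P)))"
  define ub where "ub = (\<lambda>t. indicator {0..T} t * slack (b t))"
  have [measurable]: "U \<in> borel_measurable borel" "ub \<in> borel_measurable borel"
    unfolding U_def ub_def by measurable
  have bd: "\<bar>U P\<bar> \<le> \<sigma>" "\<bar>ub t\<bar> \<le> \<sigma>" for P t
    using slack_abs_bound trace_range[of t] density_range[of "fst P" "snd P"] sigma_pos
    by (auto simp: U_def ub_def indicator_def mem_Times_iff)
  have ms[measurable]: "(\<lambda>P. U (fst P + 1 / v * snd P, snd P)) \<in> borel_measurable borel"
    by measurable
  have "AE P in lborel. 0 < fst P \<longrightarrow> fst P < T - L / v \<longrightarrow> 0 < snd P \<longrightarrow> snd P < L \<longrightarrow>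
      0 \<le> U (fst P + 1 / v * snd P, snd P) - ub (L / v + fst P)"
  proof (rule AE_nonneg_if_bump_integrals_nonneg_pair)
    show "\<bar>U (fst (s, x) + 1 / v * snd (s, x), snd (s, x)) - ub (L / v + fst (s, x))\<bar> \<le> \<sigma> + \<sigma>" for s x
      using bd(1)[of "(s + 1 / v * x, x)"] bd(2)[of "L / v + s"] by simp
    fix p q p' q' n assume pq: "0 < p" "p < q" "q < T - L / v" and pq': "0 < p'" "p' < q'" "q' < L"
    let ?\<theta> = "bump p q n" and ?\<zeta> = "bump p' q' n"
    have cont: "continuous_on UNIV ?\<theta>" "continuous_on UNIV ?\<zeta>" "continuous_on UNIV (bump_deriv p q n)"
      by (intro continuous_intros)+
    \<comment> \<open>\<open>Z = F - F 0\<close> has derivative \<open>?\<zeta>\<close>, which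
      localizes the position. It vanishes at the start, where no information is wanted, and weights
      the end by the integral of \<open>?\<zeta>\<close>.\<close>
    obtain F where F: "\<And>x. (F has_real_derivative ?\<zeta> x) (at x)"
      using continuous_antiderivative[OF cont(2)] by metis
    have FL: "F L - F 0 = (LINT x|lborel. ?\<zeta> x)"
    proof -
      have "F L - F 0 = (LINT x:{0..L}|lborel. ?\<zeta> x)"
        using LINT_Icc_FTC[OF _ F cont(2), of 0 L] len_pos by simp
      also have "\<dots> = (LINT x|lborel. ?\<zeta> x)"
        unfolding set_lebesgue_integral_def using pq'
        by (intro Bochner_Integration.integral_cong) (auto simp: indicator_def dest: bump_support)
      finally show ?thesis .
    qed
    have "(LINT t:{0..T}|lborel. slack (b t) * ?\<theta> (t - L / v)) * (F L - F 0)
      \<le> (LINT P:{0..T} \<times> {0..L}|lborel. slack (\<rho> (fst P) (snd P)) * (?\<theta> (fst P - snd P / v) * ?\<zeta> (snd P)))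
      + (LINT t:{0..T}|lborel. slack (a t) * ?\<theta> t) * (F 0 - F 0)"
    proof (rule slack_transport_weak[OF c0, where q=q and Z="\<lambda>x. F x - F 0"])
      show "((\<lambda>x. F x - F 0) has_real_derivative ?\<zeta> x) (at x)" for x
        using DERIV_diff[OF F[of x] DERIV_const] by simp
      show "0 \<le> F x - F 0" if "0 \<le> x" "x \<le> L" for x
      proof -
        have "F 0 \<le> F x"
          by (rule DERIV_nonneg_imp_nondecreasing[OF that(1)]) (use F bump_bounds(1) in blast)
        then show ?thesis by simp
      qed
      show "?\<theta> s = 0" if "q \<le> s" for s using that by (simp add: bump_eq_0)
      show "(?\<theta> has_real_derivative bump_deriv p q n s) (at s)" for s by (rule DERIV_bump)
    qed (use pq cont bump_bounds in auto)
    also have "(LINT t:{0..T}|lborel. slack (b t) * ?\<theta> (t - L / v)) = (LINT t|lborel. ?\<theta> (t - L / v) * ub t)"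
      unfolding set_lebesgue_integral_def ub_def by (rule Bochner_Integration.integral_cong) auto
    also have "\<dots> = (LINT t|lborel. ?\<theta> t * ub (L / v + t))"
      by (subst LINT_translate[of _ "L / v"]) simp
    also have "(LINT P:{0..T} \<times> {0..L}|lborel. slack (\<rho> (fst P) (snd P)) * (?\<theta> (fst P - snd P / v) * ?\<zeta> (snd P)))
        = (LINT P|lborel. ?\<theta> (fst P - snd P / v) * ?\<zeta> (snd P) * U P)"
      unfolding set_lebesgue_integral_def U_def by (rule Bochner_Integration.integral_cong) auto
    \<comment> \<open>The shear straightens the characteristics into vertical lines, so that the
      weight becomes a product of bumps.\<close>
    also have "\<dots> = (LINT P|lborel. ?\<theta> (fst P) * ?\<zeta> (snd P) * U (fst P + 1 / v * snd P, snd P))"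
      by (subst LINT_shear[of _ "1 / v"]) simp_all
    finally have le: "(LINT t|lborel. ?\<theta> t * ub (L / v + t)) * (LINT x|lborel. ?\<zeta> x)
        \<le> (LINT P|lborel. ?\<theta> (fst P) * ?\<zeta> (snd P) * U (fst P + 1 / v * snd P, snd P))"
      by (simp add: FL)
    have int: "integrable lborel (\<lambda>P :: real \<times> real. ?\<theta> (fst P) * ?\<zeta> (snd P) * w P)"
      if "w \<in> borel_measurable borel" "\<And>P. \<bar>w P\<bar> \<le> \<sigma>" for w
    proof (rule integrable_bounded_support[of "{p..q} \<times> {p'..q'}" _ "(1 * 1) * \<sigma>"])
      show "\<bar>?\<theta> (fst P) * ?\<zeta> (snd P) * w P\<bar> \<le> (1 * 1) * \<sigma>" for P
        unfolding abs_mult using that(2) bump_bounds by (intro mult_mono) auto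
    qed (use that(1) in \<open>auto simp: mem_Times_iff bump_eq_0\<close>)
    have i1: "integrable lborel (\<lambda>P :: real \<times> real. ?\<theta> (fst P) * ?\<zeta> (snd P) * ub (L / v + fst P))"
      by (rule int) (use bd in auto)
    have i2: "integrable lborel (\<lambda>P. ?\<theta> (fst P) * ?\<zeta> (snd P) * U (fst P + 1 / v * snd P, snd P))"
      by (rule int) (use bd in auto)
    have "(LINT P|lborel. (?\<theta> (fst P) * ub (L / v + fst P)) * ?\<zeta> (snd P)) = (LINT t|lborel. ?\<theta> t * ub (L / v + t)) * (LINT x|lborel. ?\<zeta> x)"
      by (rule LINT_prod) (use i1 in \<open>simp add: mult_ac\<close>)
    then have "(LINT P|lborel. ?\<theta> (fst P) * ?\<zeta> (snd P) * ub (L / v + fst P)) = (LINT t|lborel. ?\<theta> t * ub (L / v + t)) * (LINT x|lborel. ?\<zeta> x)"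
      by (simp add: mult_ac)
    then show "0 \<le> (LINT P|lborel. ?\<theta> (fst P) * ?\<zeta> (snd P) * (U (fst P + 1 / v * snd P, snd P) - ub (L / v + fst P)))"
      using le i1 i2 by (simp add: right_diff_distrib)
  qed measurable
  then have "AE P in lborel \<Otimes>\<^sub>M lborel. 0 < fst P \<longrightarrow> fst P < T - L / v \<longrightarrow> 0 < snd P \<longrightarrow> snd P < L \<longrightarrow>
      0 \<le> U (fst P + 1 / v * snd P, snd P) - ub (L / v + fst P)"
    unfolding lborel_prod .
  from lborel_pair.AE_pair[OF this] show ?thesis
  proof eventually_elim
    case (elim s)
    show ?case
    proof (intro impI)
      assume s: "0 < s" "s < T - L / v" and b: "b (s + L / v) < \<sigma>"
      have "0 < L / v" using len_pos v_pos by simp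
      then have ub: "0 < ub (L / v + s)" using s b by (simp add: ub_def slack_pos_iff add.commute)
      show "AE x in lborel. 0 < x \<longrightarrow> x < L \<longrightarrow> \<rho> (s + x / v) x < \<sigma>"
        using elim
      proof eventually_elim
        case (elim x)
        show ?case
        proof (intro impI)
          assume "0 < x" "x < L"
          then have "0 < U (s + x / v, x)" using elim s ub by simp
          then show "\<rho> (s + x / v) x < \<sigma>" by (cases "(s + x / v, x) \<in> {0..T} \<times> {0..L}") (auto simp: U_def slack_pos_iff)
        qed
      qed
    qed
  qed
qed

lemma excess_bound:
  assumes d: "d \<in> {0..lanes r}"
  shows "\<bar>excess d\<bar> \<le> lanes r + fcap r / v"
proof -
  have "0 \<le> flux r d / v" "flux r d / v \<le> fcap r / v"
    using flux_nonneg[OF road d] flux_le_fcap[OF road, of d] v_pos by (auto intro: divide_right_mono)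
  then show ?thesis using d by (auto simp: excess_def abs_le_iff)
qed

text \<open>The sharp form of \<open>mass_transport_weak\<close>. Fubini rewrites each of its terms
  as an integral of the bump \<open>?\<theta>\<close> against a function of the departure time,
  after which the bumps can be removed.\<close>

lemma mass_transport:
  "AE s in lborel. 0 < s \<longrightarrow> s < T - L / v \<longrightarrow>
    c * L + (LINT t:{0..s}|lborel. flux r (a t)) - (LINT t:{0..s + L / v}|lborel. flux r (b t))
      \<le> (LINT x:{0..L}|lborel. excess (\<rho> (s + x / v) x))"
proof -
  define E where "E = (\<lambda>P. indicator ({0..T} \<times> {0..L}) P * excess (\<rho> (fst P) (snd P)))"
  define fa where "fa = (\<lambda>t. indicator {0..T} t * flux r (a t))"
  define fb where "fb = (\<lambda>t. indicator {0..T} t * flux r (b t))"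
  define W where "W = (\<lambda>s. LINT x|lborel. E (s + 1 / v * x, x))"
  \<comment> \<open>The cumulative flow, as an integral over the whole line of a flow extended by
    zero; this is the shape that exchanging the order of integration produces.\<close>
  define cum :: "(real \<Rightarrow> real) \<Rightarrow> real \<Rightarrow> real" where "cum = (\<lambda>f s. LINT t|lborel. (if t \<le> s then f t else 0))"
  define K where "K = lanes r + fcap r / v"
  define B where "B = fcap r"
  have Lv: "0 < L / v" using len_pos v_pos by simp
  have B0: "0 \<le> B" and K0: "0 \<le> K" using sigma_pos sigma_less v_pos fcap_eq by (auto simp: B_def K_def)
  have [measurable]: "E \<in> borel_measurable borel" "fa \<in> borel_measurable borel" "fb \<in> borel_measurable borel"
    unfolding E_def fa_def fb_def by measurable
  have EK: "\<bar>E P\<bar> \<le> K" for P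
    using excess_bound[OF density_range[of "fst P" "snd P"]] K0
    by (auto simp: E_def K_def indicator_def mem_Times_iff)
  have E0: "E P = 0" if "snd P \<notin> {0..L}" for P using that by (auto simp: E_def mem_Times_iff)
  have fB: "\<bar>fa t\<bar> \<le> B" "\<bar>fb t\<bar> \<le> B" for t
    using flux_bounds trace_range[of t] B0 by (auto simp: fa_def fb_def B_def indicator_def)
  have f0: "fa t = 0" "fb t = 0" if "t \<notin> {0..T}" for t using that by (auto simp: fa_def fb_def)
  have [measurable]: "W \<in> borel_measurable borel"
  proof -
    have "(\<lambda>P. E (fst P + 1 / v * snd P, snd P)) \<in> borel_measurable (lborel \<Otimes>\<^sub>M lborel)"
      unfolding lborel_prod by measurable
    then have "(\<lambda>s. LINT x|lborel. E (s + 1 / v * x, x)) \<in> borel_measurable lborel"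
      by (intro lborel.borel_measurable_lebesgue_integral) (simp add: case_prod_unfold)
    then show ?thesis by (simp add: W_def)
  qed
  have cm[measurable]: "cum f \<in> borel_measurable borel" if [measurable]: "f \<in> borel_measurable borel" for f
  proof -
    have "(\<lambda>P. if snd P \<le> fst P then f (snd P) else 0) \<in> borel_measurable (lborel \<Otimes>\<^sub>M lborel)"
      unfolding lborel_prod
    proof (rule measurable_If)
      have "closed {P :: real \<times> real. snd P \<le> fst P}" by (intro closed_Collect_le continuous_intros)
      then show "{P \<in> space (lborel :: (real \<times> real) measure). snd P \<le> fst P} \<in> sets lborel" by simp
    qed simp_all
    then have "(\<lambda>s. LINT t|lborel. (if t \<le> s then f t else 0)) \<in> borel_measurable lborel"
      by (intro lborel.borel_measurable_lebesgue_integral) (simp add: case_prod_unfold)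
    then show ?thesis by (simp add: cum_def)
  qed
  have WK: "\<bar>W s\<bar> \<le> K * L" for s
  proof -
    have "W s = (LINT x:{0..L}|lborel. E (s + 1 / v * x, x))"
      unfolding W_def set_lebesgue_integral_def
    proof (rule Bochner_Integration.integral_cong)
      show "E (s + 1 / v * x, x) = indicator {0..L} x *\<^sub>R E (s + 1 / v * x, x)" for x
        using E0[of "(s + 1 / v * x, x)"] by (cases "x \<in> {0..L}") simp_all
    qed simp
    also have "\<bar>\<dots>\<bar> \<le> K * (L - 0)"
      by (rule LINT_Icc_abs_le) (use len_pos EK in auto)
    finally show ?thesis by simp
  qed
  have cB: "\<bar>cum f s\<bar> \<le> B * T" if [measurable]: "f \<in> borel_measurable borel"
    and f: "\<And>t. \<bar>f t\<bar> \<le> B" "\<And>t. t \<notin> {0..T} \<Longrightarrow> f t = 0" for f s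
  proof -
    have "cum f s = (LINT t:{0..T}|lborel. (if t \<le> s then f t else 0))"
      unfolding cum_def set_lebesgue_integral_def
    proof (rule Bochner_Integration.integral_cong)
      show "(if t \<le> s then f t else 0) = indicator {0..T} t *\<^sub>R (if t \<le> s then f t else 0)" for t
        using f(2)[of t] by (cases "t \<in> {0..T}") simp_all
    qed simp
    also have "\<bar>\<dots>\<bar> \<le> B * (T - 0)"
      by (rule LINT_Icc_abs_le) (use T f(1) B0 in auto)
    finally show ?thesis by simp
  qed
  have "AE s in lborel. 0 < s \<longrightarrow> s < T - L / v \<longrightarrow> 0 \<le> W s - (c * L + cum fa s - cum fb (L / v + s))"
  proof (rule AE_nonneg_if_bump_integrals_nonneg)
    show "\<bar>W s - (c * L + cum fa s - cum fb (L / v + s))\<bar> \<le> K * L + \<bar>c * L\<bar> + B * T + B * T" for s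
      using WK[of s] cB[of fa s] cB[of fb "L / v + s"] fB f0 by simp
    fix p q n assume pq: "0 < p" "p < q" "q < T - L / v"
    let ?\<theta> = "bump p q n"
    have cont: "continuous_on UNIV ?\<theta>" by (intro continuous_intros)
    obtain F where F: "\<And>x. (F has_real_derivative ?\<theta> x) (at x)"
      using continuous_antiderivative[OF cont] by metis
    \<comment> \<open>Subtracting from \<open>F q\<close> makes the antiderivative nonnegative and
      zero from \<open>q\<close> on, as \<open>mass_transport_weak\<close> demands.\<close>
    define \<Theta> where "\<Theta> = (\<lambda>s. F q - F s)"
    have zero: "\<Theta> s = 0" if "q \<le> s" for s
    proof -
      have "F s - F q = (LINT x:{q..s}|lborel. ?\<theta> x)" using LINT_Icc_FTC[OF that F cont] by simp
      also have "\<dots> = 0"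
        unfolding set_lebesgue_integral_def
        by (rule integral_eq_zero_AE) (auto simp: indicator_def bump_eq_0)
      finally show ?thesis by (simp add: \<Theta>_def)
    qed
    have rep: "\<Theta> s = (LINT y|lborel. (if s \<le> y then ?\<theta> y else 0))" for s
    proof (cases "s \<le> q")
      case True
      have "\<Theta> s = (LINT x:{s..q}|lborel. ?\<theta> x)" using LINT_Icc_FTC[OF True F cont] by (simp add: \<Theta>_def)
      also have "\<dots> = (LINT y|lborel. (if s \<le> y then ?\<theta> y else 0))"
        unfolding set_lebesgue_integral_def
        by (rule Bochner_Integration.integral_cong) (auto simp: indicator_def dest: bump_support)
      finally show ?thesis .
    next
      case False
      have "(LINT y|lborel. (if s \<le> y then ?\<theta> y else 0)) = 0"
        by (rule integral_eq_zero_AE) (use False in \<open>auto simp: bump_eq_0\<close>)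
      then show ?thesis using zero[of s] False by simp
    qed
    have nonneg: "0 \<le> \<Theta> s" for s
      unfolding rep by (rule integral_nonneg_AE) (simp add: bump_bounds)
    have int: "integrable lborel (\<lambda>t. ?\<theta> t * w t)" if "w \<in> borel_measurable borel" "\<And>t. \<bar>w t\<bar> \<le> D" for w D
    proof (rule integrable_bounded_support[of "{p..q}" _ "1 * D"])
      show "\<bar>?\<theta> t * w t\<bar> \<le> 1 * D" for t
        unfolding abs_mult using that(2) bump_bounds[of p q n t] by (intro mult_mono) auto
    qed (use that(1) in \<open>auto simp: bump_eq_0\<close>)
    have weak: "(LINT x:{0..L}|lborel. c * \<Theta> (- x / v)) + (LINT t:{0..T}|lborel. flux r (a t) * \<Theta> t)
      - (LINT t:{0..T}|lborel. flux r (b t) * \<Theta> (t - L / v))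
      \<le> (LINT P:{0..T} \<times> {0..L}|lborel. excess (\<rho> (fst P) (snd P)) * ?\<theta> (fst P - snd P / v))"
    proof (rule mass_transport_weak[where q=q])
      show "(\<Theta> has_real_derivative - ?\<theta> s) (at s)" for s
        unfolding \<Theta>_def using DERIV_diff[OF DERIV_const F[of s], of "F q"] by simp
    qed (use cont nonneg zero pq in auto)
    \<comment> \<open>Initial points have \<open>- x / v \<le> 0 < p\<close>: they lie in front of
      every characteristic seen by the bump, so each carries its full integral.\<close>
    have initial: "(LINT x:{0..L}|lborel. c * \<Theta> (- x / v)) = (LINT y|lborel. ?\<theta> y * (c * L))"
    proof -
      have "\<Theta> (- x / v) = (LINT y|lborel. ?\<theta> y)" if "0 \<le> x" for x
        unfolding rep
      proof (rule Bochner_Integration.integral_cong)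
        fix y
        have "- x / v \<le> 0" using that v_pos by simp
        then show "(if - x / v \<le> y then ?\<theta> y else 0) = ?\<theta> y"
          using pq bump_support(1)[of p q n y] by force
      qed simp
      then have "(LINT x:{0..L}|lborel. c * \<Theta> (- x / v)) = (LINT x:{0..L}|lborel. c * (LINT y|lborel. ?\<theta> y))"
        by (intro set_lebesgue_integral_cong) simp_all
      then show ?thesis using len_pos by (simp add: set_lebesgue_integral_def mult_ac)
    qed
    \<comment> \<open>Instead of weighting the flow at time \<open>t\<close> by the part of the bump
      beyond \<open>t - k\<close>, weight each departure time \<open>y\<close> by the flow up to
      time \<open>k + y\<close>. The delay \<open>k\<close> is 0 at the start of the road and
      \<open>L / v\<close> at its end.\<close>
    have fub: "(LINT t|lborel. f t * \<Theta> (t - k)) = (LINT y|lborel. ?\<theta> y * cum f (k + y))"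
      if [measurable]: "f \<in> borel_measurable borel" and f: "\<And>t. \<bar>f t\<bar> \<le> B" "\<And>t. t \<notin> {0..T} \<Longrightarrow> f t = 0" for f k
    proof -
      let ?h = "\<lambda>t y. if t \<le> k + y then f t * ?\<theta> y else 0"
      have "integrable lborel (\<lambda>P. ?h (fst P) (snd P))"
      proof (rule integrable_bounded_support[of "{0..T} \<times> {p..q}" _ "B * 1"])
        fix P
        have "\<bar>f (fst P) * ?\<theta> (snd P)\<bar> \<le> B * 1"
          unfolding abs_mult using f(1) B0 bump_bounds by (intro mult_mono) auto
        then show "\<bar>?h (fst P) (snd P)\<bar> \<le> B * 1" using B0 by simp
      next
        show "?h (fst P) (snd P) = 0" if "P \<notin> {0..T} \<times> {p..q}" for P
          using that f(2)[of "fst P"] bump_eq_0[of "snd P" p q n]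
          by (cases "fst P \<in> {0..T}") (auto simp: mem_Times_iff)
      qed auto
      then have "integrable (lborel \<Otimes>\<^sub>M lborel) (\<lambda>(t, y). ?h t y)"
        by (simp add: lborel_prod case_prod_unfold)
      from lborel_pair.Fubini_integral[OF this]
      have "(LINT t|lborel. LINT y|lborel. ?h t y) = (LINT y|lborel. LINT t|lborel. ?h t y)" by simp
      also have "(\<lambda>t. LINT y|lborel. ?h t y) = (\<lambda>t. f t * \<Theta> (t - k))"
      proof
        fix t
        have "f t * \<Theta> (t - k) = (LINT y|lborel. f t * (if t - k \<le> y then ?\<theta> y else 0))"
          unfolding rep by simp
        also have "\<dots> = (LINT y|lborel. ?h t y)"
          by (rule Bochner_Integration.integral_cong) (auto simp: algebra_simps)
        finally show "(LINT y|lborel. ?h t y) = f t * \<Theta> (t - k)" by simp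
      qed
      also have "(\<lambda>y. LINT t|lborel. ?h t y) = (\<lambda>y. ?\<theta> y * cum f (k + y))"
      proof
        fix y
        have "?\<theta> y * cum f (k + y) = (LINT t|lborel. ?\<theta> y * (if t \<le> k + y then f t else 0))"
          unfolding cum_def by simp
        also have "\<dots> = (LINT t|lborel. ?h t y)"
          by (rule Bochner_Integration.integral_cong) auto
        finally show "(LINT t|lborel. ?h t y) = ?\<theta> y * cum f (k + y)" by simp
      qed
      finally show ?thesis .
    qed
    have start': "(LINT t:{0..T}|lborel. flux r (a t) * \<Theta> t) = (LINT y|lborel. ?\<theta> y * cum fa y)"
    proof -
      have "(LINT t:{0..T}|lborel. flux r (a t) * \<Theta> t) = (LINT t|lborel. fa t * \<Theta> (t - 0))"
        unfolding set_lebesgue_integral_def fa_def by (rule Bochner_Integration.integral_cong) auto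
      also have "\<dots> = (LINT y|lborel. ?\<theta> y * cum fa (0 + y))" by (rule fub) (use fB f0 in auto)
      finally show ?thesis by simp
    qed
    have end': "(LINT t:{0..T}|lborel. flux r (b t) * \<Theta> (t - L / v)) = (LINT y|lborel. ?\<theta> y * cum fb (L / v + y))"
    proof -
      have "(LINT t:{0..T}|lborel. flux r (b t) * \<Theta> (t - L / v)) = (LINT t|lborel. fb t * \<Theta> (t - L / v))"
        unfolding set_lebesgue_integral_def fb_def by (rule Bochner_Integration.integral_cong) auto
      also have "\<dots> = (LINT y|lborel. ?\<theta> y * cum fb (L / v + y))" by (rule fub) (use fB f0 in auto)
      finally show ?thesis .
    qed
    have interior: "(LINT P:{0..T} \<times> {0..L}|lborel. excess (\<rho> (fst P) (snd P)) * ?\<theta> (fst P - snd P / v))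
        = (LINT y|lborel. ?\<theta> y * W y)"
    proof -
      have "(LINT P:{0..T} \<times> {0..L}|lborel. excess (\<rho> (fst P) (snd P)) * ?\<theta> (fst P - snd P / v))
          = (LINT P|lborel. E P * ?\<theta> (fst P - snd P / v))"
        unfolding set_lebesgue_integral_def E_def by (rule Bochner_Integration.integral_cong) auto
      also have "\<dots> = (LINT P|lborel. E (fst P + 1 / v * snd P, snd P) * ?\<theta> (fst P))"
        by (subst LINT_shear[of _ "1 / v"]) simp_all
      also have "\<dots> = (LINT s|lborel. LINT x|lborel. E (s + 1 / v * x, x) * ?\<theta> s)"
      proof (subst LINT_pair)
        show "integrable lborel (\<lambda>P. E (fst P + 1 / v * snd P, snd P) * ?\<theta> (fst P))"
        proof (rule integrable_bounded_support[of "{p..q} \<times> {0..L}" _ "K * 1"])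
          show "\<bar>E (fst P + 1 / v * snd P, snd P) * ?\<theta> (fst P)\<bar> \<le> K * 1" for P
            unfolding abs_mult using EK K0 bump_bounds by (intro mult_mono) auto
          show "E (fst P + 1 / v * snd P, snd P) * ?\<theta> (fst P) = 0" if "P \<notin> {p..q} \<times> {0..L}" for P
            using that E0[of "(fst P + 1 / v * snd P, snd P)"] bump_eq_0[of "fst P" p q n]
            by (cases "snd P \<in> {0..L}") (auto simp: mem_Times_iff)
        qed auto
      qed simp
      also have "\<dots> = (LINT s|lborel. ?\<theta> s * W s)"
        unfolding W_def by (rule Bochner_Integration.integral_cong) simp_all
      finally show ?thesis .
    qed
    have i: "integrable lborel (\<lambda>y. ?\<theta> y * W y)" "integrable lborel (\<lambda>y. ?\<theta> y * (c * L))"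
      "integrable lborel (\<lambda>y. ?\<theta> y * cum fa y)" "integrable lborel (\<lambda>y. ?\<theta> y * cum fb (L / v + y))"
      by (rule int[where D="K * L"] int[where D="\<bar>c * L\<bar>"] int[where D="B * T"]; use WK cB fB f0 in auto)+
    have "(LINT y|lborel. ?\<theta> y * (W y - (c * L + cum fa y - cum fb (L / v + y))))
        = (LINT y|lborel. ?\<theta> y * W y - (?\<theta> y * (c * L) + ?\<theta> y * cum fa y - ?\<theta> y * cum fb (L / v + y)))"
      by (simp only: right_diff_distrib distrib_left)
    also have "\<dots> = (LINT y|lborel. ?\<theta> y * W y) - ((LINT y|lborel. ?\<theta> y * (c * L)) + (LINT y|lborel. ?\<theta> y * cum fa y)
          - (LINT y|lborel. ?\<theta> y * cum fb (L / v + y)))"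
      using i by (simp del: integral_mult_left_zero integral_mult_right_zero integrable_mult_left_iff)
    finally show "0 \<le> (LINT y|lborel. ?\<theta> y * (W y - (c * L + cum fa y - cum fb (L / v + y))))"
      using weak unfolding initial start' end' interior by linarith
  qed measurable
  then show ?thesis
  proof eventually_elim
    case (elim s)
    show ?case
    proof (intro impI)
      assume s: "0 < s" "s < T - L / v"
      have ca: "cum fa s = (LINT t:{0..s}|lborel. flux r (a t))"
        unfolding cum_def fa_def set_lebesgue_integral_def
        by (rule Bochner_Integration.integral_cong) (use s Lv in \<open>auto simp: indicator_def\<close>)
      have cb: "cum fb (L / v + s) = (LINT t:{0..s + L / v}|lborel. flux r (b t))"
        unfolding cum_def fb_def set_lebesgue_integral_def
        by (rule Bochner_Integration.integral_cong) (use s Lv in \<open>auto simp: indicator_def\<close>)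
      have "W s = (LINT x:{0..L}|lborel. excess (\<rho> (s + x / v) x))"
        unfolding W_def E_def set_lebesgue_integral_def
      proof (rule Bochner_Integration.integral_cong)
        fix x
        have "x \<in> {0..L} \<Longrightarrow> s + x / v \<in> {0..T}"
          using s v_pos divide_right_mono[of x L v] divide_nonneg_pos[of x v] by auto
        then show "indicator ({0..T} \<times> {0..L}) (s + 1 / v * x, x) * excess (\<rho> (fst (s + 1 / v * x, x)) (snd (s + 1 / v * x, x)))
            = indicator {0..L} x *\<^sub>R excess (\<rho> (s + x / v) x)"
          by (auto simp: indicator_def)
      qed simp
      then show "c * L + (LINT t:{0..s}|lborel. flux r (a t)) - (LINT t:{0..s + L / v}|lborel. flux r (b t))
          \<le> (LINT x:{0..L}|lborel. excess (\<rho> (s + x / v) x))"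
        using elim s ca cb by simp
    qed
  qed
qed

text \<open>The start trace and the inflow stay in the conclusion because the argument has to be
  continued upstream: for the residential route, road 3 hands both over to road 2.\<close>

lemma free_arrival:
  assumes c0: "\<sigma> \<le> c"
  shows "AE t in lborel. t \<in> {0..T} \<longrightarrow> b t < \<sigma> \<longrightarrow> L / v \<le> t \<and> a (t - L / v) < \<sigma> \<and>
    c * L + (LINT s:{0..t - L / v}|lborel. flux r (a s)) \<le> (LINT s:{0..t}|lborel. flux r (b s))"
  \<comment> \<open>The first fact speaks of arrival times, the next two of departure times and are
    translated. The two excluded points provide the strict bounds \<open>0 < s\<close> and
    \<open>s < T - L / v\<close>.\<close>
  using slack_transport_ends[OF c0] AE_translate[OF slack_transport_interior[OF c0], of "- (L / v)"]
    AE_translate[OF mass_transport, of "- (L / v)"] AE_lborel_singleton[of T] AE_lborel_singleton[of "L / v"]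
proof eventually_elim
  case (elim t)
  show ?case
  proof (intro impI)
    assume t: "t \<in> {0..T}" "b t < \<sigma>"
    define s where "s = - (L / v) + t"
    have ends: "L / v \<le> t" "a (t - L / v) < \<sigma>" using elim(1) t by auto
    have s: "0 < s" "s < T - L / v" "s + L / v = t" "t - L / v = s"
      using ends elim(4,5) t by (auto simp: s_def)
    have free: "AE x in lborel. 0 < x \<longrightarrow> x < L \<longrightarrow> \<rho> (s + x / v) x < \<sigma>"
      using elim(2) s t unfolding s_def[symmetric] by simp
    have "(LINT x:{0..L}|lborel. excess (\<rho> (s + x / v) x)) = 0"
      unfolding set_lebesgue_integral_def
    proof (rule integral_eq_zero_AE)
      show "AE x in lborel. indicator {0..L} x *\<^sub>R excess (\<rho> (s + x / v) x) = 0"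
        using free AE_lborel_singleton[of 0] AE_lborel_singleton[of L]
      proof eventually_elim
        case (elim x)
        show ?case
        proof (cases "x \<in> {0..L}")
          case True
          then have "\<rho> (s + x / v) x < \<sigma>" using elim by auto
          then show ?thesis using v_pos by (simp add: excess_def flux_free)
        qed simp
      qed
    qed
    then have "c * L + (LINT x:{0..s}|lborel. flux r (a x)) \<le> (LINT x:{0..t}|lborel. flux r (b x))"
      using elim(3) s unfolding s_def[symmetric] by simp
    then show "L / v \<le> t \<and> a (t - L / v) < \<sigma> \<and>
        c * L + (LINT s:{0..t - L / v}|lborel. flux r (a s)) \<le> (LINT s:{0..t}|lborel. flux r (b s))"
      using ends s(4) by simp
  qed
qed

lemma inflow_nonneg: "s \<le> T \<Longrightarrow> 0 \<le> (LINT t:{0..s}|lborel. flux r (a t))"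
  unfolding set_lebesgue_integral_def
  by (rule integral_nonneg_AE) (use flux_nonneg[OF road] trace_range in \<open>auto simp: indicator_def\<close>)

end

section \<open>The network\<close>

text \<open>If the exit can take both capacities, sending all of them is feasible and no feasible
  choice exceeds it. Otherwise maximality saturates the exit.\<close>

lemma merge_flux:
  assumes g: "junction_rule {3, 4} {5} (distribution \<alpha> Right_Junction) c g"
    and c: "0 < c 3" "0 < c 4" "0 < c 5"
  shows "g 5 = min (c 3 + c 4) (c 5)"
proof (cases "c 3 + c 4 \<le> c 5")
  case True
  then have am: "is_arg_max (\<lambda>g'. \<Sum>i\<in>{3, 4}. g' i) (distribution_feasible {3, 4} {5} (distribution \<alpha> Right_Junction) c) g"
    using g by (simp add: junction_rule_def)
  have "distribution_feasible {3, 4} {5} (distribution \<alpha> Right_Junction) c (\<lambda>i. if i = 5 then c 3 + c 4 else c i)"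
    using c True by (simp add: distribution_feasible_def)
  then have "c 3 + c 4 \<le> g 3 + g 4" using am by (fastforce simp: is_arg_max_def not_less)
  moreover have "g 3 \<le> c 3" "g 4 \<le> c 4" "g 5 = g 3 + g 4"
    using am by (simp_all add: is_arg_max_def distribution_feasible_def)
  ultimately show ?thesis using True by simp
next
  case False
  then obtain l m where am: "is_arg_max (\<lambda>(l', m'). \<Sum>i\<in>{3, 4}. m' * c i) (proportional_feasible {3, 4} {5} c) (l, m)"
    and g5: "g 5 = l * c 5"
    using g by (auto simp: junction_rule_def)
  have feas: "l \<le> 1" "m * c 3 + m * c 4 = l * c 5"
    using am by (auto simp: is_arg_max_def proportional_feasible_def)
  \<comment> \<open>The competitor fills the exit, \<open>\<lambda> = 1\<close>, and scales the
    incoming capacities to match; it is admissible as the exit is the smaller side. Optimality of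
    \<open>(l, m)\<close> then gives \<open>c 5 \<le> l * c 5\<close>, hence
    \<open>l = 1\<close>.\<close>
  define \<mu> where "\<mu> = c 5 / (c 3 + c 4)"
  have \<mu>: "\<mu> * c 3 + \<mu> * c 4 = c 5" unfolding \<mu>_def distrib_left[symmetric] using c by simp
  have "proportional_feasible {3, 4} {5} c (1, \<mu>)"
    using c False \<mu> by (simp add: proportional_feasible_def \<mu>_def)
  then have "\<mu> * c 3 + \<mu> * c 4 \<le> m * c 3 + m * c 4"
    using am by (fastforce simp: is_arg_max_def not_less)
  then have "c 5 \<le> l * c 5" using \<mu> feas by simp
  then have "l = 1" using c feas(1) by simp
  then show ?thesis using g5 False by simp
qed

text \<open>Both branches of the rule conserve flux. If road 2 were congested at its end while road
  3 is free at its start, both capacities would be the common flux capacity and the rule would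
  assign it, but a density strictly below critical carries less.\<close>

lemma straight_junction:
  assumes J: "junction_riemann N {2} {3} (distribution \<alpha> Middle_Junction) d g d"
    and N: "valid_road (N 2)" "valid_road (N 3)" "crit_density (N 3) = crit_density (N 2)" "fcap (N 3) = fcap (N 2)"
  shows "flux (N 2) (d 2) = flux (N 3) (d 3)" "d 3 < crit_density (N 3) \<Longrightarrow> d 2 < crit_density (N 2)"
proof -
  define c where "c = (\<lambda>i. if i \<in> {2} then cap_in (N i) (d i) else cap_out (N i) (d i))"
  have R: "junction_rule {2} {3} (distribution \<alpha> Middle_Junction) c g"
    and fl: "flux (N 2) (d 2) = g 2" "flux (N 3) (d 3) = g 3"
    using J by (auto simp: junction_riemann_def c_def)
  have "g 2 = g 3"
  proof (cases "c 2 \<le> c 3")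
    case True
    then show ?thesis using R by (simp add: junction_rule_def is_arg_max_def distribution_feasible_def)
  next
    case False
    then show ?thesis using R by (auto simp: junction_rule_def is_arg_max_def proportional_feasible_def)
  qed
  then show eq: "flux (N 2) (d 2) = flux (N 3) (d 3)" using fl by simp
  assume d3: "d 3 < crit_density (N 3)"
  show "d 2 < crit_density (N 2)"
  proof (rule ccontr)
    assume d2: "\<not> d 2 < crit_density (N 2)"
    have c: "c 2 = fcap (N 2)" "c 3 = fcap (N 2)"
      using d2 d3 N flux_crit[OF N(1)] by (auto simp: c_def cap_in_def cap_out_def)
    have pos: "0 < fcap (N 2)" using N by (simp add: valid_road_def)
    have am: "is_arg_max (\<lambda>g'. \<Sum>i\<in>{2}. g' i) (distribution_feasible {2} {3} (distribution \<alpha> Middle_Junction) c) g"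
      using R c by (simp add: junction_rule_def)
    have "distribution_feasible {2} {3} (distribution \<alpha> Middle_Junction) c (\<lambda>i. fcap (N 2))"
      using c pos by (simp add: distribution_feasible_def)
    then have "fcap (N 2) \<le> g 2" using am by (fastforce simp: is_arg_max_def not_less)
    moreover have "flux (N 3) (d 3) < fcap (N 3)"
      using d3 N by (auto simp: flux_def crit_density_def valid_road_def field_simps)
    ultimately show False using eq fl N(4) by simp
  qed
qed

section \<open>Congestion up to depletion, and the exit throughput\<close>

lemma AE_not_if_unique:
  fixes P :: "real \<Rightarrow> bool"
  assumes "\<And>s t. P s \<Longrightarrow> P t \<Longrightarrow> s = t"
  shows "AE t in lborel. \<not> P t"
proof (cases "\<exists>t. P t")
  case True
  then obtain s where "P s" ..
  then show ?thesis using AE_lborel_singleton[of s] assms by (auto elim!: eventually_mono)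
qed auto

text \<open>A route whose exit is uncongested at time \<open>t\<close> has sent off all of its initial traffic, so \<open>t\<close>
  can only precede depletion as the single time at which the queue vanishes.\<close>

lemma AE_congested_until_depleted:
  fixes M b :: "real \<Rightarrow> real"
  assumes "AE t in lborel. t \<in> {0..T} \<longrightarrow> b t < s \<longrightarrow> m \<le> M t"
  shows "AE t in lborel. t \<in> {0..T} \<longrightarrow> M t \<le> m \<longrightarrow> (\<forall>u\<in>{0..<t}. M u < m) \<longrightarrow> s \<le> b t"
proof -
  \<comment> \<open>Two such times, one earlier than the other, would give both
    \<open>M u = m\<close> and \<open>M u < m\<close> at the earlier one.\<close>
  have "AE t in lborel. \<not> (0 \<le> t \<and> M t = m \<and> (\<forall>u\<in>{0..<t}. M u < m))"
    by (rule AE_not_if_unique) (metis atLeastLessThan_iff less_irrefl linorder_neqE_linordered_idom)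
  then show ?thesis using assms
  proof eventually_elim
    case (elim t)
    show ?case
    proof (intro impI)
      assume t: "t \<in> {0..T}" "M t \<le> m" "\<forall>u\<in>{0..<t}. M u < m"
      show "s \<le> b t"
      proof (rule ccontr)
        assume "\<not> s \<le> b t"
        then have "M t = m" using elim(2) t by auto
        then show False using elim(1) t by auto
      qed
    qed
  qed
qed

theorem proposition5p1:
  fixes N :: "nat \<Rightarrow> road" and n5 \<alpha> T \<rho>init :: real
    and \<rho> :: "nat \<Rightarrow> real \<Rightarrow> real \<Rightarrow> real"
    and a b :: "nat \<Rightarrow> real \<Rightarrow> real"
    and \<gamma> :: "junction \<Rightarrow> real \<Rightarrow> nat \<Rightarrow> real"
  assumes "toy_network N n5"
    and "0 < \<alpha>" and "\<alpha> < 1"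
    and "0 < T"
    and "\<rho>init \<le> 1" and "\<forall>i\<in>{1..4}. crit_density (N i) < \<rho>init"
    and "network_solution N \<alpha> T (\<lambda>i x. if i = 5 then 0 else \<rho>init) \<rho> a b \<gamma>"
  shows "(n5 < n5_star N \<longrightarrow>
            (AE t\<in>{0..T} in lborel. queues_not_depleted N \<rho>init \<gamma> t \<longrightarrow>
               \<gamma> Right_Junction t 5 = n5 * fcap (N 1))) \<and>
         (n5 \<ge> n5_star N \<longrightarrow>
            (AE t\<in>{0..T} in lborel. queues_not_depleted N \<rho>init \<gamma> t \<longrightarrow>
               \<gamma> Right_Junction t 5 = fcap (N 2) + fcap (N 4)))"
proof -
  note net = assms(1)[unfolded toy_network_def]
  note sol = assms(7)[unfolded network_solution_def]
  have valid: "valid_road (N i)" if "i \<in> {1..5}" for i using net that by blast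
  have same: "crit_density (N 3) = crit_density (N 2)" "fcap (N 3) = fcap (N 2)" "vfree (N 3) = vfree (N 2)"
    using net by (auto simp: crit_density_def)
  have len: "len (N 2) + len (N 3) = len (N 4)" and fcap5: "fcap (N 5) = n5 * fcap (N 1)" using net by auto
  have lanes: "lanes (N i) = 1" if "i \<in> {1..4}" for i using net that by blast
  have dense: "crit_density (N i) \<le> \<rho>init" "\<rho>init \<in> {0..lanes (N i)}" if "i \<in> {2, 3, 4}" for i
    using assms(5) assms(6)[rule_format, of i] lanes[of i] crit_density_pos[OF valid, of i] that by auto
  have congested: "traced_solution (N i) T (\<rho> i) (a i) (b i) \<rho>init" if i: "i \<in> {2, 3, 4}" for i
  proof
    show "entropy_solution (N i) T (\<lambda>x. \<rho>init) (\<rho> i)" "trace_start (N i) T (\<rho> i) (a i)" "trace_end (N i) T (\<rho> i) (b i)"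
      using sol i by (auto dest!: bspec[of _ _ i])
  qed (use valid i assms(4) dense(2)[OF i] in auto)
  interpret exit_road: traced_solution "N 5" T "\<rho> 5" "a 5" "b 5" 0
  proof
    show "entropy_solution (N 5) T (\<lambda>x. 0) (\<rho> 5)" "trace_start (N 5) T (\<rho> 5) (a 5)" "trace_end (N 5) T (\<rho> 5) (b 5)"
      using sol by (auto dest!: bspec[of _ _ 5])
  qed (use valid[of 5] assms(4) net in auto)
  interpret r2: traced_solution "N 2" T "\<rho> 2" "a 2" "b 2" \<rho>init by (rule congested) simp
  interpret r3: traced_solution "N 3" T "\<rho> 3" "a 3" "b 3" \<rho>init by (rule congested) simp
  interpret r4: traced_solution "N 4" T "\<rho> 4" "a 4" "b 4" \<rho>init by (rule congested) simp

  have junction: "AE t in lborel. t \<in> {0..T} \<longrightarrow>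
      junction_riemann N (incoming w) (outgoing w) (distribution \<alpha> w) (\<lambda>i. if i \<in> incoming w then b i t else a i t) (\<gamma> w t)
        (\<lambda>i. if i \<in> incoming w then b i t else a i t)" for w
    using sol by (auto simp: Let_def)
  \<comment> \<open>The traces are fixed points of the junction Riemann solver, so the assigned
    fluxes are the fluxes of the traces.\<close>
  have right: "AE t in lborel. t \<in> {0..T} \<longrightarrow> (\<forall>i\<in>{3, 4}. \<gamma> Right_Junction t i = flux (N i) (b i t))"
    using junction[of Right_Junction] by eventually_elim (auto simp: junction_riemann_def)
  have middle: "AE t in lborel. t \<in> {0..T} \<longrightarrow> flux (N 2) (b 2 t) = flux (N 3) (a 3 t) \<and>
      (a 3 t < crit_density (N 3) \<longrightarrow> b 2 t < crit_density (N 2))"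
    using junction[of Middle_Junction]
  proof eventually_elim
    case (elim t)
    show ?case
    proof
      assume "t \<in> {0..T}"
      then have "junction_riemann N {2} {3} (distribution \<alpha> Middle_Junction) (\<lambda>i. if i \<in> {2} then b i t else a i t)
          (\<gamma> Middle_Junction t) (\<lambda>i. if i \<in> {2} then b i t else a i t)"
        using elim by simp
      note straight_junction[OF this valid[of 2] valid[of 3] same(1,2)]
      then show "flux (N 2) (b 2 t) = flux (N 3) (a 3 t) \<and> (a 3 t < crit_density (N 3) \<longrightarrow> b 2 t < crit_density (N 2))"
        by simp
    qed
  qed

  have amount: "amount_left \<gamma> i t = (LINT s:{0..t}|lborel. flux (N i) (b i s))" if "i \<in> {3, 4}" "t \<in> {0..T}" for i t
    unfolding amount_left_def
  proof (rule set_lebesgue_integral_cong_AE)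
    have "i \<in> incoming Right_Junction \<union> outgoing Right_Junction" using that by auto
    then show "(\<lambda>s. \<gamma> Right_Junction s i) \<in> borel_measurable lborel" using sol by auto
    have [measurable]: "b i \<in> borel_measurable borel" using that r3.trace_measurable r4.trace_measurable by auto
    show "(\<lambda>s. flux (N i) (b i s)) \<in> borel_measurable lborel" by measurable
    show "AE s\<in>{0..t} in lborel. \<gamma> Right_Junction s i = flux (N i) (b i s)"
      using right by eventually_elim (use that in auto)
  qed simp

  have leave4: "AE t in lborel. t \<in> {0..T} \<longrightarrow> b 4 t < crit_density (N 4) \<longrightarrow> \<rho>init * len (N 4) \<le> amount_left \<gamma> 4 t"
    using r4.free_arrival[OF dense(1)[of 4, simplified]]
  proof eventually_elim
    case (elim t)
    show ?case
    proof (intro impI)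
      assume t: "t \<in> {0..T}" "b 4 t < crit_density (N 4)"
      have "0 < r4.L / r4.v" using r4.len_pos r4.v_pos by simp
      then show "\<rho>init * len (N 4) \<le> amount_left \<gamma> 4 t"
        using elim t amount[of 4 t] r4.inflow_nonneg[of "t - r4.L / r4.v"] by auto
    qed
  qed
  \<comment> \<open>The free characteristic departed from road 3 at
    \<open>s = t - r3.L / r3.v\<close>, so the junction and road 2 are examined at \<open>s\<close>,
    whence the translations. The outflow of road 2 up to \<open>s\<close> equals the inflow of road
    3 up to \<open>s\<close>; its lower bound supplies the missing part
    \<open>\<rho>init * r2.L\<close>, and the two lengths add up to
    \<open>len (N 4)\<close>.\<close>
  have leave3: "AE t in lborel. t \<in> {0..T} \<longrightarrow> b 3 t < crit_density (N 3) \<longrightarrow> \<rho>init * len (N 4) \<le> amount_left \<gamma> 3 t"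
    using r3.free_arrival[OF dense(1)[of 3, simplified]] AE_translate[OF middle, of "- (r3.L / r3.v)"]
      AE_translate[OF r2.free_arrival[OF dense(1)[of 2, simplified]], of "- (r3.L / r3.v)"]
  proof eventually_elim
    case (elim t)
    show ?case
    proof (intro impI)
      assume t: "t \<in> {0..T}" "b 3 t < crit_density (N 3)"
      define s where "s = - (r3.L / r3.v) + t"
      have pos: "0 < r3.L / r3.v" "0 < r2.L / r2.v"
        using r3.len_pos r3.v_pos r2.len_pos r2.v_pos by simp_all
      have e: "r3.L / r3.v \<le> t" "a 3 s < crit_density (N 3)"
        "\<rho>init * r3.L + (LINT x:{0..s}|lborel. flux (N 3) (a 3 x)) \<le> (LINT x:{0..t}|lborel. flux (N 3) (b 3 x))"
        using elim(1) t by (auto simp: s_def)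
      have s: "s \<in> {0..T}" using e(1) t pos by (auto simp: s_def)
      then have "b 2 s < crit_density (N 2)" using elim(2) e(2) unfolding s_def[symmetric] by blast
      then have "\<rho>init * r2.L + (LINT x:{0..s - r2.L / r2.v}|lborel. flux (N 2) (a 2 x)) \<le> (LINT x:{0..s}|lborel. flux (N 2) (b 2 x))"
        using elim(3) s unfolding s_def[symmetric] by blast
      moreover have "0 \<le> (LINT x:{0..s - r2.L / r2.v}|lborel. flux (N 2) (a 2 x))"
        using s pos by (intro r2.inflow_nonneg) auto
      moreover have "(LINT x:{0..s}|lborel. flux (N 2) (b 2 x)) = (LINT x:{0..s}|lborel. flux (N 3) (a 3 x))"
      proof (rule set_lebesgue_integral_cong_AE)
        show "AE x\<in>{0..s} in lborel. flux (N 2) (b 2 x) = flux (N 3) (a 3 x)"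
          using middle by eventually_elim (use s in auto)
      qed measurable
      ultimately have "\<rho>init * (len (N 2) + len (N 3)) \<le> (LINT x:{0..t}|lborel. flux (N 3) (b 3 x))"
        using e(3) by (simp add: distrib_left)
      then show "\<rho>init * len (N 4) \<le> amount_left \<gamma> 3 t" using amount[of 3 t] t len by simp
    qed
  qed

  \<comment> \<open>Above the critical density the road could send its full capacity but carries
    strictly less, which the non-reflecting condition excludes.\<close>
  have "AE t in lborel. t \<in> {0..T} \<longrightarrow> b 5 t \<le> crit_density (N 5)"
  proof -
    have "AE t\<in>{0..T} in lborel. flux (N 5) (b 5 t) = cap_in (N 5) (b 5 t)" using sol by blast
    then show ?thesis
    proof eventually_elim
      case (elim t)
      then show ?case using flux_less_fcap[OF valid[of 5], of "b 5 t"] by (auto simp: cap_in_def split: if_splits)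
    qed
  qed
  from exit_road.start_free_if_end_free[OF less_imp_le[OF exit_road.sigma_pos] this]
  have free5: "AE t in lborel. t \<in> {0..T} \<longrightarrow> a 5 t \<le> crit_density (N 5)" .

  \<comment> \<open>One formula covers both regimes; the minimum changes its branch exactly at
    \<open>n5_star N\<close>.\<close>
  have throughput: "AE t in lborel. t \<in> {0..T} \<longrightarrow> queues_not_depleted N \<rho>init \<gamma> t \<longrightarrow>
      \<gamma> Right_Junction t 5 = min (fcap (N 2) + fcap (N 4)) (n5 * fcap (N 1))"
    using AE_congested_until_depleted[OF leave3] AE_congested_until_depleted[OF leave4] free5 junction[of Right_Junction]
  proof eventually_elim
    case (elim t)
    show ?case
    proof (intro impI)
      assume t: "t \<in> {0..T}" "queues_not_depleted N \<rho>init \<gamma> t"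
      have b: "crit_density (N 3) \<le> b 3 t" "crit_density (N 4) \<le> b 4 t"
        using elim(1,2) t unfolding queues_not_depleted_def by blast+
      define c where "c = (\<lambda>i. if i \<in> {3, 4} then cap_in (N i) (if i \<in> incoming Right_Junction then b i t else a i t)
          else cap_out (N i) (if i \<in> incoming Right_Junction then b i t else a i t))"
      have "junction_rule {3, 4} {5} (distribution \<alpha> Right_Junction) c (\<gamma> Right_Junction t)"
        using elim(4) t unfolding junction_riemann_def c_def by simp
      \<comment> \<open>Congested incoming ends and a free exit each offer full capacity; at exactly
        the critical density of an incoming road, this uses that the flux there equals the
        capacity.\<close>
      moreover have "c 3 = fcap (N 3)" "c 4 = fcap (N 4)" "c 5 = fcap (N 5)"
        using b elim(3) t flux_crit[OF valid, of 3] flux_crit[OF valid, of 4]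
        by (auto simp: c_def cap_in_def cap_out_def)
      moreover have "0 < fcap (N 3)" "0 < fcap (N 4)" "0 < fcap (N 5)"
        using valid[of 3] valid[of 4] valid[of 5] by (auto simp: valid_road_def)
      ultimately show "\<gamma> Right_Junction t 5 = min (fcap (N 2) + fcap (N 4)) (n5 * fcap (N 1))"
        using merge_flux[of \<alpha> c "\<gamma> Right_Junction t"] same(2) fcap5 by simp
    qed
  qed
  have "0 < fcap (N 1)" using valid[of 1] by (simp add: valid_road_def)
  then have "n5 < n5_star N \<longleftrightarrow> n5 * fcap (N 1) < fcap (N 2) + fcap (N 4)"
    by (simp add: n5_star_def pos_less_divide_eq)
  then show ?thesis using throughput by (auto elim!: eventually_mono simp: min_def not_less)
qed

end
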